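(* Let $A$ be a noetherian commutative ring, let $\mathfrak{a}$ be an ideal in $A$, and let $\widehat{M}$ be an $\mathfrak{a}$-adically flat $\mathfrak{a}$-adically complete $A$-module. Then $\widehat{M}$ is a flat $A$-module.
   Context: An $A$-module $N$ is $\mathfrak{a}$-torsion if every element of $N$ is annihilated by some power of $\mathfrak{a}$. An $A$-module $M$ is $\mathfrak{a}$-adically flat if $\operatorname{Tor}^A_i(N, M) = 0$ for every $i > 0$ and every $\mathfrak{a}$-torsion $A$-module $N$. With $A_k := A/\mathfrak{a}^{k+1}$, an $A$-module $M$ is $\mathfrak{a}$-adically complete if the canonical homomorphism $M \to \lim_{\leftarrow k} (A_k \otimes_A M)$ is an isomorphism. *)

theory Defs
  imports "HOL-Algebra.Module" "HOL-Algebra.Ideal_Product" "HOL-Algebra.Ring_Divisibility"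
begin

section \<open>Homomorphisms, submodules and quotients\<close>

definition mod_hom :: "('a, 'r) ring_scheme \<Rightarrow> ('a, 'm, 'x) module_scheme
    \<Rightarrow> ('a, 'n, 'y) module_scheme \<Rightarrow> ('m \<Rightarrow> 'n) set" where
  "mod_hom R M N = {f \<in> carrier M \<rightarrow> carrier N.
     (\<forall>x\<in>carrier M. \<forall>y\<in>carrier M. f (x \<oplus>\<^bsub>M\<^esub> y) = f x \<oplus>\<^bsub>N\<^esub> f y) \<and>
     (\<forall>r\<in>carrier R. \<forall>x\<in>carrier M. f (r \<odot>\<^bsub>M\<^esub> x) = r \<odot>\<^bsub>N\<^esub> f x)}"

definition mod_iso :: "('a, 'r) ring_scheme \<Rightarrow> ('a, 'm, 'x) module_scheme
    \<Rightarrow> ('a, 'n, 'y) module_scheme \<Rightarrow> ('m \<Rightarrow> 'n) set" where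
  "mod_iso R M N = {f \<in> mod_hom R M N. bij_betw f (carrier M) (carrier N)}"

definition mod_span :: "('a, 'r) ring_scheme \<Rightarrow> ('a, 'm, 'x) module_scheme \<Rightarrow> 'm set \<Rightarrow> 'm set" where
  "mod_span R M S = \<Inter>{H. submodule H R M \<and> S \<subseteq> H}"

text \<open>The record type \<^typ>\<open>('a, 'm) module\<close> inherits the fields \<^const>\<open>monoid.mult\<close> and \<^const>\<open>one\<close>
  from rings; they play no role for modules and are left unspecified.\<close>

definition quot_mod :: "('a, 'm, 'x) module_scheme \<Rightarrow> 'm set \<Rightarrow> ('a, 'm set) module" where
  "quot_mod M H =
    \<lparr>carrier = a_rcosets\<^bsub>M\<^esub> H, monoid.mult = undefined, one = undefined, zero = H, add = set_add M,
     smult = (\<lambda>r X. \<Union>x\<in>X. H +>\<^bsub>M\<^esub> (r \<odot>\<^bsub>M\<^esub> x))\<rparr>"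

definition regular_mod :: "('a, 'r) ring_scheme \<Rightarrow> ('a, 'a) module" where
  "regular_mod R = \<lparr>carrier = carrier R, monoid.mult = monoid.mult R, one = one R, zero = zero R, add = add R,
     smult = monoid.mult R\<rparr>"


section \<open>Free modules\<close>

definition free_mod :: "('a, 'r) ring_scheme \<Rightarrow> 'x set \<Rightarrow> ('a, 'x \<Rightarrow> 'a) module" where
  "free_mod R X =
    \<lparr>carrier = {f. range f \<subseteq> carrier R \<and> finite {x. f x \<noteq> \<zero>\<^bsub>R\<^esub>} \<and> {x. f x \<noteq> \<zero>\<^bsub>R\<^esub>} \<subseteq> X},
     monoid.mult = undefined, one = undefined,
     zero = (\<lambda>_. \<zero>\<^bsub>R\<^esub>), add = (\<lambda>f g x. f x \<oplus>\<^bsub>R\<^esub> g x), smult = (\<lambda>r f x. r \<otimes>\<^bsub>R\<^esub> f x)\<rparr>"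

definition basis_elt :: "('a, 'r) ring_scheme \<Rightarrow> 'x \<Rightarrow> 'x \<Rightarrow> 'a" where
  "basis_elt R x = (\<lambda>y. if y = x then \<one>\<^bsub>R\<^esub> else \<zero>\<^bsub>R\<^esub>)"

text \<open>The linear extension to the free module of a map \<open>g\<close> from the basis to \<open>N\<close>.\<close>

definition lin_ext :: "('a, 'r) ring_scheme \<Rightarrow> ('a, 'n, 'y) module_scheme \<Rightarrow> ('x \<Rightarrow> 'n)
    \<Rightarrow> ('x \<Rightarrow> 'a) \<Rightarrow> 'n" where
  "lin_ext R N g f = (\<Oplus>\<^bsub>N\<^esub>x\<in>{x. f x \<noteq> \<zero>\<^bsub>R\<^esub>}. f x \<odot>\<^bsub>N\<^esub> g x)"


section \<open>Tensor products\<close>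

definition tensor_rels :: "('a, 'r) ring_scheme \<Rightarrow> ('a, 'm, 'x) module_scheme
    \<Rightarrow> ('a, 'n, 'y) module_scheme \<Rightarrow> ('m \<times> 'n \<Rightarrow> 'a) set" where
  "tensor_rels R M N =
    (let F = free_mod R (carrier M \<times> carrier N); e = (\<lambda>m n. basis_elt R (m, n)) in
      {e (m \<oplus>\<^bsub>M\<^esub> m') n \<ominus>\<^bsub>F\<^esub> (e m n \<oplus>\<^bsub>F\<^esub> e m' n) | m m' n.
         m \<in> carrier M \<and> m' \<in> carrier M \<and> n \<in> carrier N} \<union>
      {e m (n \<oplus>\<^bsub>N\<^esub> n') \<ominus>\<^bsub>F\<^esub> (e m n \<oplus>\<^bsub>F\<^esub> e m n') | m n n'.
         m \<in> carrier M \<and> n \<in> carrier N \<and> n' \<in> carrier N} \<union>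
      {e (r \<odot>\<^bsub>M\<^esub> m) n \<ominus>\<^bsub>F\<^esub> (r \<odot>\<^bsub>F\<^esub> e m n) | r m n.
         r \<in> carrier R \<and> m \<in> carrier M \<and> n \<in> carrier N} \<union>
      {e m (r \<odot>\<^bsub>N\<^esub> n) \<ominus>\<^bsub>F\<^esub> (r \<odot>\<^bsub>F\<^esub> e m n) | r m n.
         r \<in> carrier R \<and> m \<in> carrier M \<and> n \<in> carrier N})"

definition tensor_null :: "('a, 'r) ring_scheme \<Rightarrow> ('a, 'm, 'x) module_scheme
    \<Rightarrow> ('a, 'n, 'y) module_scheme \<Rightarrow> ('m \<times> 'n \<Rightarrow> 'a) set" where
  "tensor_null R M N = mod_span R (free_mod R (carrier M \<times> carrier N)) (tensor_rels R M N)"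

definition tensor :: "('a, 'r) ring_scheme \<Rightarrow> ('a, 'm, 'x) module_scheme
    \<Rightarrow> ('a, 'n, 'y) module_scheme \<Rightarrow> ('a, ('m \<times> 'n \<Rightarrow> 'a) set) module" where
  "tensor R M N = quot_mod (free_mod R (carrier M \<times> carrier N)) (tensor_null R M N)"

definition pure_tensor :: "('a, 'r) ring_scheme \<Rightarrow> ('a, 'm, 'x) module_scheme
    \<Rightarrow> ('a, 'n, 'y) module_scheme \<Rightarrow> 'm \<Rightarrow> 'n \<Rightarrow> ('m \<times> 'n \<Rightarrow> 'a) set" where
  "pure_tensor R M N m n =
     tensor_null R M N +>\<^bsub>free_mod R (carrier M \<times> carrier N)\<^esub> basis_elt R (m, n)"

text \<open>The map \<open>f \<otimes> g\<close> from \<open>M \<otimes> N\<close> to \<open>M' \<otimes> N'\<close>. For homomorphisms \<open>f\<close> and \<open>g\<close> the linear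
  extension is constant on every coset \<open>X\<close>.\<close>

definition tensor_map :: "('a, 'r) ring_scheme \<Rightarrow> ('a, 'm', 'x) module_scheme
    \<Rightarrow> ('a, 'n', 'y) module_scheme \<Rightarrow> ('m \<Rightarrow> 'm') \<Rightarrow> ('n \<Rightarrow> 'n')
    \<Rightarrow> ('m \<times> 'n \<Rightarrow> 'a) set \<Rightarrow> ('m' \<times> 'n' \<Rightarrow> 'a) set" where
  "tensor_map R M' N' f g X =
     the_elem (lin_ext R (tensor R M' N') (\<lambda>(m, n). pure_tensor R M' N' (f m) (g n)) ` X)"


section \<open>Flat modules\<close>

text \<open>The type arguments are the universes of the modules against which flatness is tested; a
  theorem concluding \<open>flat_module TYPE('k) TYPE('l) R M\<close> for type variables \<open>'k\<close> and \<open>'l\<close> asserts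
  flatness without any restriction.\<close>

definition flat_module :: "'k itself \<Rightarrow> 'l itself \<Rightarrow> ('a, 'r) ring_scheme
    \<Rightarrow> ('a, 'm, 'x) module_scheme \<Rightarrow> bool" where
  "flat_module _ _ R M \<longleftrightarrow> module R M \<and>
    (\<forall>(K :: ('a, 'k) module) (L :: ('a, 'l) module) f.
       module R K \<and> module R L \<and> f \<in> mod_hom R K L \<and> inj_on f (carrier K) \<longrightarrow>
       inj_on (tensor_map R L M f id) (carrier (tensor R K M)))"


section \<open>Tor\<close>

text \<open>A canonical free resolution \<open>\<dots> \<rightarrow> F\<^sub>1 \<rightarrow> F\<^sub>0 \<rightarrow> N \<rightarrow> 0\<close>: the basis of \<open>F\<^sub>0\<close> consists of all elements
  of \<open>N\<close>, the basis of \<open>F\<^sub>1\<close> of all formal linear combinations of basis elements of \<open>F\<^sub>0\<close> which are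
  mapped to zero in \<open>N\<close>, and the basis of \<open>F\<^sub>n\<^sub>+\<^sub>2\<close> of all formal linear combinations of basis elements
  of \<open>F\<^sub>n\<^sub>+\<^sub>1\<close> which are mapped to zero in \<open>F\<^sub>n\<close>. The nested datatype hosts the bases in all
  degrees in a single type.\<close>

datatype ('a, 'n) syzygy = Gen (gen: 'n) | Rel (rel: "('a \<times> ('a, 'n) syzygy) list")

definition formal_sum :: "('a, 'r) ring_scheme \<Rightarrow> ('a \<times> 'x) list \<Rightarrow> 'x \<Rightarrow> 'a" where
  "formal_sum R l = (\<lambda>x. foldr (add R) (map fst (filter (\<lambda>p. snd p = x) l)) \<zero>\<^bsub>R\<^esub>)"

fun res_basis :: "('a, 'r) ring_scheme \<Rightarrow> ('a, 'n, 'x) module_scheme \<Rightarrow> nat \<Rightarrow> ('a, 'n) syzygy set"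
where
  "res_basis R N 0 = Gen ` carrier N"
| "res_basis R N (Suc 0) =
     {Rel l | l. l \<in> lists (carrier R \<times> res_basis R N 0) \<and>
        lin_ext R N gen (formal_sum R l) = \<zero>\<^bsub>N\<^esub>}"
| "res_basis R N (Suc (Suc n)) =
     {Rel l | l. l \<in> lists (carrier R \<times> res_basis R N (Suc n)) \<and>
        lin_ext R (free_mod R (res_basis R N n)) (\<lambda>s. formal_sum R (rel s)) (formal_sum R l)
          = \<zero>\<^bsub>free_mod R (res_basis R N n)\<^esub>}"

definition res_mod :: "('a, 'r) ring_scheme \<Rightarrow> ('a, 'n, 'x) module_scheme \<Rightarrow> nat
    \<Rightarrow> ('a, ('a, 'n) syzygy \<Rightarrow> 'a) module" where
  "res_mod R N n = free_mod R (res_basis R N n)"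

definition res_aug :: "('a, 'r) ring_scheme \<Rightarrow> ('a, 'n, 'x) module_scheme
    \<Rightarrow> (('a, 'n) syzygy \<Rightarrow> 'a) \<Rightarrow> 'n" where
  "res_aug R N = lin_ext R N gen"

text \<open>\<open>res_diff R N n\<close> is the differential from degree \<^term>\<open>Suc n\<close> to degree \<open>n\<close>.\<close>

definition res_diff :: "('a, 'r) ring_scheme \<Rightarrow> ('a, 'n, 'x) module_scheme \<Rightarrow> nat
    \<Rightarrow> (('a, 'n) syzygy \<Rightarrow> 'a) \<Rightarrow> (('a, 'n) syzygy \<Rightarrow> 'a)" where
  "res_diff R N n = lin_ext R (res_mod R N n) (\<lambda>s. formal_sum R (rel s))"

definition tor_chain :: "('a, 'r) ring_scheme \<Rightarrow> ('a, 'n, 'x) module_scheme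
    \<Rightarrow> ('a, 'm, 'y) module_scheme \<Rightarrow> nat
    \<Rightarrow> ('a, ((('a, 'n) syzygy \<Rightarrow> 'a) \<times> 'm \<Rightarrow> 'a) set) module" where
  "tor_chain R N M n = tensor R (res_mod R N n) M"

definition tor_diff :: "('a, 'r) ring_scheme \<Rightarrow> ('a, 'n, 'x) module_scheme
    \<Rightarrow> ('a, 'm, 'y) module_scheme \<Rightarrow> nat
    \<Rightarrow> ((('a, 'n) syzygy \<Rightarrow> 'a) \<times> 'm \<Rightarrow> 'a) set \<Rightarrow> ((('a, 'n) syzygy \<Rightarrow> 'a) \<times> 'm \<Rightarrow> 'a) set" where
  "tor_diff R N M n = tensor_map R (res_mod R N n) M (res_diff R N n) id"

primrec tor_cycles :: "('a, 'r) ring_scheme \<Rightarrow> ('a, 'n, 'x) module_scheme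
    \<Rightarrow> ('a, 'm, 'y) module_scheme \<Rightarrow> nat \<Rightarrow> ((('a, 'n) syzygy \<Rightarrow> 'a) \<times> 'm \<Rightarrow> 'a) set set" where
  "tor_cycles R N M 0 = carrier (tor_chain R N M 0)"
| "tor_cycles R N M (Suc n) =
     a_kernel (tor_chain R N M (Suc n)) (tor_chain R N M n) (tor_diff R N M n)"

definition tor_boundaries :: "('a, 'r) ring_scheme \<Rightarrow> ('a, 'n, 'x) module_scheme
    \<Rightarrow> ('a, 'm, 'y) module_scheme \<Rightarrow> nat \<Rightarrow> ((('a, 'n) syzygy \<Rightarrow> 'a) \<times> 'm \<Rightarrow> 'a) set set" where
  "tor_boundaries R N M n = tor_diff R N M n ` carrier (tor_chain R N M (Suc n))"

definition Tor :: "('a, 'r) ring_scheme \<Rightarrow> nat \<Rightarrow> ('a, 'n, 'x) module_scheme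
    \<Rightarrow> ('a, 'm, 'y) module_scheme
    \<Rightarrow> ('a, ((('a, 'n) syzygy \<Rightarrow> 'a) \<times> 'm \<Rightarrow> 'a) set set) module" where
  "Tor R i N M =
     quot_mod ((tor_chain R N M i)\<lparr>carrier := tor_cycles R N M i\<rparr>) (tor_boundaries R N M i)"


section \<open>Adic flatness and adic completeness\<close>

definition ideal_power :: "('a, 'r) ring_scheme \<Rightarrow> 'a set \<Rightarrow> nat \<Rightarrow> 'a set" where
  "ideal_power R I k = I [^]\<^bsub>ideals_set R\<^esub> k"

definition torsion_module :: "('a, 'r) ring_scheme \<Rightarrow> 'a set \<Rightarrow> ('a, 'n, 'x) module_scheme \<Rightarrow> bool"
where
  "torsion_module R I N \<longleftrightarrow> module R N \<and>
     (\<forall>x\<in>carrier N. \<exists>k. \<forall>r\<in>ideal_power R I k. r \<odot>\<^bsub>N\<^esub> x = \<zero>\<^bsub>N\<^esub>)"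

text \<open>The type argument is the universe of the torsion modules \<open>N\<close>. The universe \<^typ>\<open>'a list set\<close>
  is large enough: it contains an isomorphic copy of every finitely generated module over a ring
  with elements in \<^typ>\<open>'a\<close> (see \<open>fg_module_embeds\<close> below), every torsion module is the directed
  union of its finitely generated submodules, which are again torsion, and Tor commutes with
  directed unions. So vanishing in this universe implies vanishing in every universe.\<close>

definition adically_flat :: "'n itself \<Rightarrow> ('a, 'r) ring_scheme \<Rightarrow> 'a set
    \<Rightarrow> ('a, 'm, 'x) module_scheme \<Rightarrow> bool" where
  "adically_flat _ R I M \<longleftrightarrow> module R M \<and>
     (\<forall>(N :: ('a, 'n) module) i. torsion_module R I N \<and> i > 0 \<longrightarrow>
        carrier (Tor R i N M) = {\<zero>\<^bsub>Tor R i N M\<^esub>})"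

definition adic_trunc :: "('a, 'r) ring_scheme \<Rightarrow> 'a set \<Rightarrow> nat \<Rightarrow> ('a, 'a set) module" where
  "adic_trunc R I k = quot_mod (regular_mod R) (ideal_power R I (k + 1))"

definition inv_limit :: "(nat \<Rightarrow> ('a, 'm) module) \<Rightarrow> (nat \<Rightarrow> 'm \<Rightarrow> 'm) \<Rightarrow> ('a, nat \<Rightarrow> 'm) module"
where
  "inv_limit T p =
    \<lparr>carrier = {x. \<forall>k. x k \<in> carrier (T k) \<and> p k (x (Suc k)) = x k},
     monoid.mult = undefined, one = undefined,
     zero = (\<lambda>k. \<zero>\<^bsub>T k\<^esub>), add = (\<lambda>x y k. x k \<oplus>\<^bsub>T k\<^esub> y k), smult = (\<lambda>r x k. r \<odot>\<^bsub>T k\<^esub> x k)\<rparr>"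

text \<open>Adding \<^term>\<open>ideal_power R I (k + 1)\<close> to a coset of \<^term>\<open>ideal_power R I (k + 2)\<close> is the
  projection \<open>A\<^sub>k\<^sub>+\<^sub>1 \<rightarrow> A\<^sub>k\<close>.\<close>

definition adic_completion :: "('a, 'r) ring_scheme \<Rightarrow> 'a set \<Rightarrow> ('a, 'm, 'x) module_scheme
    \<Rightarrow> ('a, nat \<Rightarrow> ('a set \<times> 'm \<Rightarrow> 'a) set) module" where
  "adic_completion R I M =
     inv_limit (\<lambda>k. tensor R (adic_trunc R I k) M)
       (\<lambda>k. tensor_map R (adic_trunc R I k) M (\<lambda>X. ideal_power R I (k + 1) <+>\<^bsub>R\<^esub> X) id)"

definition to_completion :: "('a, 'r) ring_scheme \<Rightarrow> 'a set \<Rightarrow> ('a, 'm, 'x) module_scheme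
    \<Rightarrow> 'm \<Rightarrow> nat \<Rightarrow> ('a set \<times> 'm \<Rightarrow> 'a) set" where
  "to_completion R I M m =
     (\<lambda>k. pure_tensor R (adic_trunc R I k) M (ideal_power R I (k + 1) +>\<^bsub>R\<^esub> \<one>\<^bsub>R\<^esub>) m)"

definition adically_complete :: "('a, 'r) ring_scheme \<Rightarrow> 'a set \<Rightarrow> ('a, 'm, 'x) module_scheme \<Rightarrow> bool"
where
  "adically_complete R I M \<longleftrightarrow> module R M \<and>
     to_completion R I M \<in> mod_iso R M (adic_completion R I M)"


section \<open>Basic facts\<close>

lemma mod_homI:
  assumes "\<And>x. x \<in> carrier M \<Longrightarrow> f x \<in> carrier N"
    and "\<And>x y. x \<in> carrier M \<Longrightarrow> y \<in> carrier M \<Longrightarrow> f (x \<oplus>\<^bsub>M\<^esub> y) = f x \<oplus>\<^bsub>N\<^esub> f y"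
    and "\<And>r x. r \<in> carrier R \<Longrightarrow> x \<in> carrier M \<Longrightarrow> f (r \<odot>\<^bsub>M\<^esub> x) = r \<odot>\<^bsub>N\<^esub> f x"
  shows "f \<in> mod_hom R M N"
  using assms by (auto simp: mod_hom_def)

lemma mod_homD:
  assumes "f \<in> mod_hom R M N"
  shows "x \<in> carrier M \<Longrightarrow> f x \<in> carrier N"
    and "x \<in> carrier M \<Longrightarrow> y \<in> carrier M \<Longrightarrow> f (x \<oplus>\<^bsub>M\<^esub> y) = f x \<oplus>\<^bsub>N\<^esub> f y"
    and "r \<in> carrier R \<Longrightarrow> x \<in> carrier M \<Longrightarrow> f (r \<odot>\<^bsub>M\<^esub> x) = r \<odot>\<^bsub>N\<^esub> f x"
  using assms by (auto simp: mod_hom_def)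

lemma mod_hom_group_hom:
  assumes "module R M" "module R N" "f \<in> mod_hom R M N"
  shows "abelian_group_hom M N f"
proof -
  interpret M: module R M by fact
  interpret N: module R N by fact
  show ?thesis
  proof (rule abelian_group_homI)
    show "abelian_group M" "abelian_group N"
      by (rule M.M.abelian_group_axioms, rule N.M.abelian_group_axioms)
    show "group_hom (add_monoid M) (add_monoid N) f"
    proof (rule group_hom.intro)
      show "group (add_monoid M)" "group (add_monoid N)"
        by (rule M.M.a_group, rule N.M.a_group)
      show "group_hom_axioms (add_monoid M) (add_monoid N) f"
        using mod_homD(1,2)[OF assms(3)] by (simp add: group_hom_axioms_def hom_def)
    qed
  qed
qed

lemma mod_hom_zero:
  assumes "module R M" "module R N" "f \<in> mod_hom R M N"
  shows "f \<zero>\<^bsub>M\<^esub> = \<zero>\<^bsub>N\<^esub>"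
  using abelian_group_hom.hom_zero[OF mod_hom_group_hom[OF assms]] .

lemma mod_hom_kernel_submodule:
  assumes "module R M" "module R N" "f \<in> mod_hom R M N"
  shows "submodule (a_kernel M N f) R M"
proof -
  interpret M: module R M by fact
  interpret N: module R N by fact
  note h = abelian_group_hom.hom_a_inv[OF mod_hom_group_hom[OF assms]]
  note z = mod_hom_zero[OF assms]
  show ?thesis
  proof (rule M.submoduleI)
    show "a_kernel M N f \<subseteq> carrier M" by (auto simp: a_kernel_def')
    show "\<zero>\<^bsub>M\<^esub> \<in> a_kernel M N f" by (simp add: a_kernel_def' z)
  next
    fix a assume "a \<in> a_kernel M N f"
    hence "a \<in> carrier M" "f a = \<zero>\<^bsub>N\<^esub>" by (simp_all add: a_kernel_def')
    thus "\<ominus>\<^bsub>M\<^esub> a \<in> a_kernel M N f" by (simp add: a_kernel_def' h)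
  next
    fix a b assume "a \<in> a_kernel M N f" "b \<in> a_kernel M N f"
    thus "a \<oplus>\<^bsub>M\<^esub> b \<in> a_kernel M N f" by (simp add: a_kernel_def' mod_homD(2)[OF assms(3)])
  next
    fix r a assume "r \<in> carrier R" "a \<in> a_kernel M N f"
    thus "r \<odot>\<^bsub>M\<^esub> a \<in> a_kernel M N f" by (simp add: a_kernel_def' mod_homD(3)[OF assms(3)])
  qed
qed

lemma mod_span_submodule:
  assumes "module R M" "S \<subseteq> carrier M"
  shows "submodule (mod_span R M S) R M" "S \<subseteq> mod_span R M S"
    and "\<And>H. submodule H R M \<Longrightarrow> S \<subseteq> H \<Longrightarrow> mod_span R M S \<subseteq> H"
proof -
  interpret M: module R M by fact
  have c: "submodule (carrier M) R M" by (rule M.carrier_is_submodule)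
  have c: "mod_span R M S \<subseteq> carrier M"
    using c assms(2) by (auto simp: mod_span_def)
  have z: "\<zero>\<^bsub>M\<^esub> \<in> H" if "submodule H R M" for H
    using subgroup.one_closed[OF submodule.axioms(1)[OF that]] by simp
  show "submodule (mod_span R M S) R M"
    by (rule M.submoduleI[OF c])
       (auto simp: mod_span_def z dest: M.submoduleE)
  show "S \<subseteq> mod_span R M S" by (auto simp: mod_span_def)
  show "mod_span R M S \<subseteq> H" if "submodule H R M" "S \<subseteq> H" for H
    using that by (auto simp: mod_span_def)
qed

lemma submodule_abelian_subgroup:
  assumes "module R M" "submodule H R M"
  shows "abelian_subgroup H M"
proof -
  interpret M: module R M by fact
  show ?thesis
    by (rule abelian_subgroupI3)
       (auto intro: additive_subgroup.intro submodule.axioms(1)[OF assms(2)] M.abelian_group_axioms)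
qed

lemma quot_mod_simps:
  assumes "module R M" "submodule H R M"
  shows "carrier (quot_mod M H) = (\<lambda>x. H +>\<^bsub>M\<^esub> x) ` carrier M"
    and "\<zero>\<^bsub>quot_mod M H\<^esub> = H +>\<^bsub>M\<^esub> \<zero>\<^bsub>M\<^esub>"
    and "x \<in> carrier M \<Longrightarrow> y \<in> carrier M \<Longrightarrow>
          (H +>\<^bsub>M\<^esub> x) \<oplus>\<^bsub>quot_mod M H\<^esub> (H +>\<^bsub>M\<^esub> y) = H +>\<^bsub>M\<^esub> (x \<oplus>\<^bsub>M\<^esub> y)"
    and "r \<in> carrier R \<Longrightarrow> x \<in> carrier M \<Longrightarrow>
          r \<odot>\<^bsub>quot_mod M H\<^esub> (H +>\<^bsub>M\<^esub> x) = H +>\<^bsub>M\<^esub> (r \<odot>\<^bsub>M\<^esub> x)"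
proof -
  interpret M: module R M by fact
  interpret S: submodule H R M by fact
  interpret A: abelian_subgroup H M by (rule submodule_abelian_subgroup[OF assms])
  show "carrier (quot_mod M H) = (\<lambda>x. H +>\<^bsub>M\<^esub> x) ` carrier M"
    by (auto simp: quot_mod_def A_RCOSETS_def')
  show "\<zero>\<^bsub>quot_mod M H\<^esub> = H +>\<^bsub>M\<^esub> \<zero>\<^bsub>M\<^esub>"
    using A.a_subset by (simp add: quot_mod_def)
  show "(H +>\<^bsub>M\<^esub> x) \<oplus>\<^bsub>quot_mod M H\<^esub> (H +>\<^bsub>M\<^esub> y) = H +>\<^bsub>M\<^esub> (x \<oplus>\<^bsub>M\<^esub> y)"
    if "x \<in> carrier M" "y \<in> carrier M"
    using that by (simp add: quot_mod_def A.a_rcos_sum)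
  show "r \<odot>\<^bsub>quot_mod M H\<^esub> (H +>\<^bsub>M\<^esub> x) = H +>\<^bsub>M\<^esub> (r \<odot>\<^bsub>M\<^esub> x)"
    if r: "r \<in> carrier R" and x: "x \<in> carrier M"
  proof -
    have "H +>\<^bsub>M\<^esub> (r \<odot>\<^bsub>M\<^esub> y) = H +>\<^bsub>M\<^esub> (r \<odot>\<^bsub>M\<^esub> x)" if y: "y \<in> H +>\<^bsub>M\<^esub> x" for y
    proof -
      from y obtain h where h: "h \<in> H" and y: "y = h \<oplus>\<^bsub>M\<^esub> x" by (auto simp: a_r_coset_def')
      have hc: "h \<in> carrier M" using h A.a_subset by blast
      have "r \<odot>\<^bsub>M\<^esub> y = r \<odot>\<^bsub>M\<^esub> h \<oplus>\<^bsub>M\<^esub> r \<odot>\<^bsub>M\<^esub> x"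
        using hc r x y by (simp add: M.smult_r_distr)
      hence "r \<odot>\<^bsub>M\<^esub> y \<in> H +>\<^bsub>M\<^esub> (r \<odot>\<^bsub>M\<^esub> x)"
        using S.smult_closed[OF r h] by (auto simp: a_r_coset_def')
      thus ?thesis using A.a_repr_independence'[of "r \<odot>\<^bsub>M\<^esub> y" "r \<odot>\<^bsub>M\<^esub> x"] r x by simp
    qed
    moreover have "x \<in> H +>\<^bsub>M\<^esub> x" using A.a_rcos_self[OF x] .
    ultimately have "(\<Union>y\<in>H +>\<^bsub>M\<^esub> x. H +>\<^bsub>M\<^esub> (r \<odot>\<^bsub>M\<^esub> y)) = H +>\<^bsub>M\<^esub> (r \<odot>\<^bsub>M\<^esub> x)"
      by blast
    thus ?thesis by (simp only: quot_mod_def module.select_convs)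
  qed
qed

lemma quot_mod_module:
  assumes "module R M" "submodule H R M"
  shows "module R (quot_mod M H)"
proof -
  interpret M: module R M by fact
  interpret A: abelian_subgroup H M by (rule submodule_abelian_subgroup[OF assms])
  note s = quot_mod_simps[OF assms]
  show ?thesis
  proof (rule moduleI)
    show "cring R" by (rule M.R.cring_axioms)
    show "abelian_group (quot_mod M H)"
    proof (rule abelian_groupI)
      fix x assume "x \<in> carrier (quot_mod M H)"
      then obtain a where a: "a \<in> carrier M" "x = H +>\<^bsub>M\<^esub> a" by (auto simp: s)
      show "\<exists>y\<in>carrier (quot_mod M H). y \<oplus>\<^bsub>quot_mod M H\<^esub> x = \<zero>\<^bsub>quot_mod M H\<^esub>"
        using a by (intro bexI[of _ "H +>\<^bsub>M\<^esub> (\<ominus>\<^bsub>M\<^esub> a)"]) (auto simp: s M.M.l_neg)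
    qed (auto simp: s M.M.a_ac)
  qed (auto simp: s M.smult_l_distr M.smult_r_distr M.smult_assoc1)
qed

lemma quot_proj_hom:
  assumes "module R M" "submodule H R M"
  shows "(\<lambda>x. H +>\<^bsub>M\<^esub> x) \<in> mod_hom R M (quot_mod M H)"
  by (rule mod_homI) (auto simp: quot_mod_simps[OF assms])

lemma quot_eq_iff:
  assumes "module R M" "submodule H R M" "x \<in> carrier M" "y \<in> carrier M"
  shows "H +>\<^bsub>M\<^esub> x = H +>\<^bsub>M\<^esub> y \<longleftrightarrow> x \<ominus>\<^bsub>M\<^esub> y \<in> H"
proof -
  interpret M: module R M by fact
  interpret A: abelian_subgroup H M by (rule submodule_abelian_subgroup[OF assms(1,2)])
  show ?thesis
  proof
    assume "H +>\<^bsub>M\<^esub> x = H +>\<^bsub>M\<^esub> y"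
    hence "x \<in> H +>\<^bsub>M\<^esub> y" using A.a_rcos_self[OF assms(3)] by simp
    thus "x \<ominus>\<^bsub>M\<^esub> y \<in> H"
      using A.a_rcos_module[OF assms(4,3)] by (simp add: a_minus_def)
  next
    assume "x \<ominus>\<^bsub>M\<^esub> y \<in> H"
    hence "x \<in> H +>\<^bsub>M\<^esub> y"
      using A.a_rcos_module[OF assms(4,3)] by (simp add: a_minus_def)
    thus "H +>\<^bsub>M\<^esub> x = H +>\<^bsub>M\<^esub> y"
      using A.a_repr_independence'[of x y] assms(4) by simp
  qed
qed

lemma regular_mod_module:
  assumes "cring R"
  shows "module R (regular_mod R)"
proof -
  interpret cring R by fact
  show ?thesis
  proof (rule moduleI)
    show "abelian_group (regular_mod R)"
    proof (rule abelian_groupI)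
      fix x assume "x \<in> carrier (regular_mod R)"
      thus "\<exists>y\<in>carrier (regular_mod R). y \<oplus>\<^bsub>regular_mod R\<^esub> x = \<zero>\<^bsub>regular_mod R\<^esub>"
        by (intro bexI[of _ "\<ominus>\<^bsub>R\<^esub> x"]) (simp_all add: regular_mod_def l_neg)
    qed (simp_all add: regular_mod_def a_ac)
  qed (simp_all add: regular_mod_def cring_axioms l_distr r_distr m_assoc)
qed

lemma regular_mod_submodule:
  assumes "cring R" "ideal I R"
  shows "submodule I R (regular_mod R)"
proof -
  interpret R: cring R by fact
  interpret ideal I R by fact
  interpret module R "regular_mod R" by (rule regular_mod_module) fact
  show ?thesis
  proof (rule submoduleI)
    have inv: "\<ominus>\<^bsub>regular_mod R\<^esub> a \<in> I" if "a \<in> I" for a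
    proof -
      have a: "a \<in> carrier R" using that a_subset by blast
      have "\<ominus>\<^bsub>regular_mod R\<^esub> a = \<ominus>\<^bsub>R\<^esub> a"
        using a by (intro M.minus_equality) (simp_all add: regular_mod_def R.l_neg)
      thus ?thesis using that by simp
    qed
    show "I \<subseteq> carrier (regular_mod R)" using a_subset by (simp add: regular_mod_def)
    show "\<ominus>\<^bsub>regular_mod R\<^esub> a \<in> I" if "a \<in> I" for a using inv[OF that] .
  qed (simp_all add: regular_mod_def I_l_closed)
qed

lemma free_mod_module:
  assumes "cring R"
  shows "module R (free_mod R X)"
proof -
  interpret cring R by fact
  have add: "finite {x. f x \<oplus>\<^bsub>R\<^esub> g x \<noteq> \<zero>\<^bsub>R\<^esub>}" "{x. f x \<oplus>\<^bsub>R\<^esub> g x \<noteq> \<zero>\<^bsub>R\<^esub>} \<subseteq> X"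
    if "finite {x. f x \<noteq> \<zero>\<^bsub>R\<^esub>}" "finite {x. g x \<noteq> \<zero>\<^bsub>R\<^esub>}"
      "{x. f x \<noteq> \<zero>\<^bsub>R\<^esub>} \<subseteq> X" "{x. g x \<noteq> \<zero>\<^bsub>R\<^esub>} \<subseteq> X" for f g :: "'c \<Rightarrow> 'a"
  proof -
    have *: "{x. f x \<oplus>\<^bsub>R\<^esub> g x \<noteq> \<zero>\<^bsub>R\<^esub>} \<subseteq> {x. f x \<noteq> \<zero>\<^bsub>R\<^esub>} \<union> {x. g x \<noteq> \<zero>\<^bsub>R\<^esub>}" by auto
    show "finite {x. f x \<oplus>\<^bsub>R\<^esub> g x \<noteq> \<zero>\<^bsub>R\<^esub>}" using finite_subset[OF *] that by blast
    show "{x. f x \<oplus>\<^bsub>R\<^esub> g x \<noteq> \<zero>\<^bsub>R\<^esub>} \<subseteq> X" using * that by blast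
  qed
  have sm: "finite {x. r \<otimes>\<^bsub>R\<^esub> f x \<noteq> \<zero>\<^bsub>R\<^esub>}" "{x. r \<otimes>\<^bsub>R\<^esub> f x \<noteq> \<zero>\<^bsub>R\<^esub>} \<subseteq> X"
    if "finite {x. f x \<noteq> \<zero>\<^bsub>R\<^esub>}" "{x. f x \<noteq> \<zero>\<^bsub>R\<^esub>} \<subseteq> X" "r \<in> carrier R" for r and f :: "'c \<Rightarrow> 'a"
  proof -
    have *: "{x. r \<otimes>\<^bsub>R\<^esub> f x \<noteq> \<zero>\<^bsub>R\<^esub>} \<subseteq> {x. f x \<noteq> \<zero>\<^bsub>R\<^esub>}" using that by auto
    show "finite {x. r \<otimes>\<^bsub>R\<^esub> f x \<noteq> \<zero>\<^bsub>R\<^esub>}" using finite_subset[OF *] that by blast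
    show "{x. r \<otimes>\<^bsub>R\<^esub> f x \<noteq> \<zero>\<^bsub>R\<^esub>} \<subseteq> X" using * that by blast
  qed
  have rng: "f x \<in> carrier R" if "range f \<subseteq> carrier R" for f :: "'c \<Rightarrow> 'a" and x
    using that by blast
  show ?thesis
  proof (rule moduleI)
    show "abelian_group (free_mod R X)"
    proof (rule abelian_groupI)
      fix f assume f: "f \<in> carrier (free_mod R X)"
      define g where "g = (\<lambda>x. \<ominus>\<^bsub>R\<^esub> \<one>\<^bsub>R\<^esub> \<otimes>\<^bsub>R\<^esub> f x)"
      have "g \<in> carrier (free_mod R X)"
        using f sm[of f "\<ominus>\<^bsub>R\<^esub> \<one>\<^bsub>R\<^esub>"] by (auto simp: free_mod_def g_def rng)
      moreover have "g \<oplus>\<^bsub>free_mod R X\<^esub> f = \<zero>\<^bsub>free_mod R X\<^esub>"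
        using f by (auto simp: free_mod_def g_def l_minus l_neg rng)
      ultimately show "\<exists>g\<in>carrier (free_mod R X). g \<oplus>\<^bsub>free_mod R X\<^esub> f = \<zero>\<^bsub>free_mod R X\<^esub>" by blast
    next
      fix f g assume "f \<in> carrier (free_mod R X)" "g \<in> carrier (free_mod R X)"
      thus "f \<oplus>\<^bsub>free_mod R X\<^esub> g \<in> carrier (free_mod R X)"
        using add[of f g] by (auto simp: free_mod_def rng)
    qed (auto simp: free_mod_def a_ac rng)
  next
    fix r f assume "r \<in> carrier R" "f \<in> carrier (free_mod R X)"
    thus "r \<odot>\<^bsub>free_mod R X\<^esub> f \<in> carrier (free_mod R X)"
      using sm[of f r] by (auto simp: free_mod_def rng)
  qed (auto simp: free_mod_def cring_axioms l_distr r_distr m_assoc rng)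
qed

lemma basis_elt_closed:
  assumes "cring R" "x \<in> X"
  shows "basis_elt R x \<in> carrier (free_mod R X)"
proof -
  interpret cring R by fact
  have "{y. basis_elt R x y \<noteq> \<zero>\<^bsub>R\<^esub>} \<subseteq> {x}" by (auto simp: basis_elt_def)
  thus ?thesis using assms(2) finite_subset[of _ "{x}"]
    by (auto simp: free_mod_def basis_elt_def)
qed

lemma lin_ext_eq_sum:
  assumes "cring R" "module R N" "finite A" "f \<in> carrier (free_mod R X)"
    "{x. f x \<noteq> \<zero>\<^bsub>R\<^esub>} \<subseteq> A" "g \<in> A \<rightarrow> carrier N"
  shows "lin_ext R N g f = (\<Oplus>\<^bsub>N\<^esub>x\<in>A. f x \<odot>\<^bsub>N\<^esub> g x)"
proof -
  interpret N: module R N by fact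
  have fc: "f x \<in> carrier R" for x using assms(4) by (auto simp: free_mod_def)
  show ?thesis unfolding lin_ext_def
    by (rule N.M.add.finprod_mono_neutral_cong_left) (use assms fc in \<open>auto simp: Pi_iff\<close>)
qed

lemma lin_ext_hom:
  assumes "cring R" "module R N" "g \<in> X \<rightarrow> carrier N"
  shows "lin_ext R N g \<in> mod_hom R (free_mod R X) N"
proof -
  interpret N: module R N by fact
  interpret F: module R "free_mod R X" by (rule free_mod_module) fact
  have fc: "f x \<in> carrier R" "finite {x. f x \<noteq> \<zero>\<^bsub>R\<^esub>}" "f x \<noteq> \<zero>\<^bsub>R\<^esub> \<Longrightarrow> x \<in> X"
    if "f \<in> carrier (free_mod R X)" for x f
    using that by (auto simp: free_mod_def)
  show ?thesis
  proof (rule mod_homI)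
    fix f assume f: "f \<in> carrier (free_mod R X)"
    show "lin_ext R N g f \<in> carrier N" unfolding lin_ext_def
      by (rule N.M.finsum_closed) (use fc[OF f] assms(3) in auto)
  next
    fix f h assume f: "f \<in> carrier (free_mod R X)" and h: "h \<in> carrier (free_mod R X)"
    let ?A = "{x. f x \<noteq> \<zero>\<^bsub>R\<^esub>} \<union> {x. h x \<noteq> \<zero>\<^bsub>R\<^esub>}"
    have A: "finite ?A" "g \<in> ?A \<rightarrow> carrier N" using fc[OF f] fc[OF h] assms(3) by auto
    have fh: "f \<oplus>\<^bsub>free_mod R X\<^esub> h \<in> carrier (free_mod R X)" using f h by simp
    have "lin_ext R N g (f \<oplus>\<^bsub>free_mod R X\<^esub> h) =
        (\<Oplus>\<^bsub>N\<^esub>x\<in>?A. (f \<oplus>\<^bsub>free_mod R X\<^esub> h) x \<odot>\<^bsub>N\<^esub> g x)"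
      by (rule lin_ext_eq_sum[OF assms(1,2) A(1) fh _ A(2)]) (auto simp: free_mod_def)
    also have "\<dots> = (\<Oplus>\<^bsub>N\<^esub>x\<in>?A. f x \<odot>\<^bsub>N\<^esub> g x \<oplus>\<^bsub>N\<^esub> h x \<odot>\<^bsub>N\<^esub> g x)"
      by (rule N.M.finsum_cong') (use fc[OF f] fc[OF h] A(2) in
        \<open>auto simp: free_mod_def N.smult_l_distr Pi_iff\<close>)
    also have "\<dots> = (\<Oplus>\<^bsub>N\<^esub>x\<in>?A. f x \<odot>\<^bsub>N\<^esub> g x) \<oplus>\<^bsub>N\<^esub> (\<Oplus>\<^bsub>N\<^esub>x\<in>?A. h x \<odot>\<^bsub>N\<^esub> g x)"
      by (rule N.M.finsum_addf) (use fc[OF f] fc[OF h] A(2) in \<open>auto simp: Pi_iff\<close>)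
    also have "\<dots> = lin_ext R N g f \<oplus>\<^bsub>N\<^esub> lin_ext R N g h"
      using lin_ext_eq_sum[OF assms(1,2) A(1) f _ A(2)] lin_ext_eq_sum[OF assms(1,2) A(1) h _ A(2)]
      by auto
    finally show "lin_ext R N g (f \<oplus>\<^bsub>free_mod R X\<^esub> h) = lin_ext R N g f \<oplus>\<^bsub>N\<^esub> lin_ext R N g h" .
  next
    fix r f assume r: "r \<in> carrier R" and f: "f \<in> carrier (free_mod R X)"
    let ?A = "{x. f x \<noteq> \<zero>\<^bsub>R\<^esub>}"
    have A: "finite ?A" "g \<in> ?A \<rightarrow> carrier N" using fc[OF f] assms(3) by auto
    have rf: "r \<odot>\<^bsub>free_mod R X\<^esub> f \<in> carrier (free_mod R X)" using r f by simp
    have "lin_ext R N g (r \<odot>\<^bsub>free_mod R X\<^esub> f) = (\<Oplus>\<^bsub>N\<^esub>x\<in>?A. (r \<odot>\<^bsub>free_mod R X\<^esub> f) x \<odot>\<^bsub>N\<^esub> g x)"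
      by (rule lin_ext_eq_sum[OF assms(1,2) A(1) rf _ A(2)]) (use r in \<open>auto simp: free_mod_def\<close>)
    also have "\<dots> = (\<Oplus>\<^bsub>N\<^esub>x\<in>?A. r \<odot>\<^bsub>N\<^esub> (f x \<odot>\<^bsub>N\<^esub> g x))"
      by (rule N.M.finsum_cong') (use fc[OF f] A(2) r in
        \<open>auto simp: free_mod_def N.smult_assoc1 Pi_iff\<close>)
    also have "\<dots> = r \<odot>\<^bsub>N\<^esub> lin_ext R N g f" unfolding lin_ext_def
      by (rule N.finsum_smult_ldistr[symmetric]) (use fc[OF f] A r in \<open>auto simp: Pi_iff\<close>)
    finally show "lin_ext R N g (r \<odot>\<^bsub>free_mod R X\<^esub> f) = r \<odot>\<^bsub>N\<^esub> lin_ext R N g f" .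
  qed
qed

lemma lin_ext_basis_elt:
  assumes "cring R" "module R N" "g x \<in> carrier N"
  shows "lin_ext R N g (basis_elt R x) = g x"
proof -
  interpret N: module R N by fact
  have b: "basis_elt R x \<in> carrier (free_mod R {x})"
    by (rule basis_elt_closed[OF assms(1)]) simp
  have s: "{y. basis_elt R x y \<noteq> \<zero>\<^bsub>R\<^esub>} \<subseteq> {x}" by (auto simp: basis_elt_def)
  have g: "g \<in> {x} \<rightarrow> carrier N" using assms(3) by simp
  have "lin_ext R N g (basis_elt R x) = (\<Oplus>\<^bsub>N\<^esub>y\<in>{x}. basis_elt R x y \<odot>\<^bsub>N\<^esub> g y)"
    by (rule lin_ext_eq_sum[OF assms(1,2) _ b s g]) simp
  also have "\<dots> = g x"
    using N.M.finsum_insert[of "{}" x "\<lambda>y. basis_elt R x y \<odot>\<^bsub>N\<^esub> g y"] assms(3)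
    by (simp add: basis_elt_def)
  finally show ?thesis .
qed

lemma tensor_rels_subset:
  assumes "module R M" "module R N"
  shows "tensor_rels R M N \<subseteq> carrier (free_mod R (carrier M \<times> carrier N))"
proof -
  interpret M: module R M by fact
  interpret N: module R N by fact
  interpret F: module R "free_mod R (carrier M \<times> carrier N)" by (rule free_mod_module) (rule M.R.cring_axioms)
  note b = basis_elt_closed[OF M.R.cring_axioms]
  show ?thesis unfolding tensor_rels_def Let_def
    by (auto intro!: F.M.minus_closed F.M.a_closed F.smult_closed b)
qed

lemma tensor_null_submodule:
  assumes "module R M" "module R N"
  shows "submodule (tensor_null R M N) R (free_mod R (carrier M \<times> carrier N))"
  unfolding tensor_null_def
  by (intro mod_span_submodule free_mod_module tensor_rels_subset assms)
     (use assms(1) in \<open>auto simp: module_def\<close>)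

lemma tensor_module:
  assumes "module R M" "module R N"
  shows "module R (tensor R M N)"
  unfolding tensor_def
  by (intro quot_mod_module free_mod_module tensor_null_submodule assms)
     (use assms(1) in \<open>auto simp: module_def\<close>)

lemma pure_tensor_closed:
  assumes "module R M" "module R N" "m \<in> carrier M" "n \<in> carrier N"
  shows "pure_tensor R M N m n \<in> carrier (tensor R M N)"
proof -
  interpret M: module R M by fact
  show ?thesis
    unfolding tensor_def pure_tensor_def
      quot_mod_simps(1)[OF free_mod_module[OF M.R.cring_axioms] tensor_null_submodule[OF assms(1,2)]]
    by (intro imageI basis_elt_closed) (use assms(3,4) in \<open>simp_all add: M.R.cring_axioms\<close>)
qed

lemma pure_tensor_bilinear:
  assumes "module R M" "module R N"
  shows "m \<in> carrier M \<Longrightarrow> m' \<in> carrier M \<Longrightarrow> n \<in> carrier N \<Longrightarrow>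
      pure_tensor R M N (m \<oplus>\<^bsub>M\<^esub> m') n = pure_tensor R M N m n \<oplus>\<^bsub>tensor R M N\<^esub> pure_tensor R M N m' n"
    and "m \<in> carrier M \<Longrightarrow> n \<in> carrier N \<Longrightarrow> n' \<in> carrier N \<Longrightarrow>
      pure_tensor R M N m (n \<oplus>\<^bsub>N\<^esub> n') = pure_tensor R M N m n \<oplus>\<^bsub>tensor R M N\<^esub> pure_tensor R M N m n'"
    and "r \<in> carrier R \<Longrightarrow> m \<in> carrier M \<Longrightarrow> n \<in> carrier N \<Longrightarrow>
      pure_tensor R M N (r \<odot>\<^bsub>M\<^esub> m) n = r \<odot>\<^bsub>tensor R M N\<^esub> pure_tensor R M N m n"
    and "r \<in> carrier R \<Longrightarrow> m \<in> carrier M \<Longrightarrow> n \<in> carrier N \<Longrightarrow>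
      pure_tensor R M N m (r \<odot>\<^bsub>N\<^esub> n) = r \<odot>\<^bsub>tensor R M N\<^esub> pure_tensor R M N m n"
proof -
  interpret M: module R M by fact
  interpret N: module R N by fact
  let ?F = "free_mod R (carrier M \<times> carrier N)"
  have F: "module R ?F" by (rule free_mod_module) (rule M.R.cring_axioms)
  interpret F: module R ?F by fact
  have b: "m \<in> carrier M \<Longrightarrow> n \<in> carrier N \<Longrightarrow> basis_elt R (m, n) \<in> carrier ?F" for m n
    by (intro basis_elt_closed) (auto simp: M.R.cring_axioms)
  note H = tensor_null_submodule[OF assms]
  have rel: "x \<in> tensor_null R M N" if "x \<in> tensor_rels R M N" for x
    using that mod_span_submodule(2)[OF F tensor_rels_subset[OF assms]] by (auto simp: tensor_null_def)
  note s = quot_mod_simps[OF F H]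
  note e = quot_eq_iff[OF F H]
  { assume "m \<in> carrier M" "m' \<in> carrier M" "n \<in> carrier N"
    thus "pure_tensor R M N (m \<oplus>\<^bsub>M\<^esub> m') n = pure_tensor R M N m n \<oplus>\<^bsub>tensor R M N\<^esub> pure_tensor R M N m' n"
      unfolding pure_tensor_def tensor_def
      by (simp add: s b e, intro rel) (auto simp: tensor_rels_def Let_def) }
  { assume "m \<in> carrier M" "n \<in> carrier N" "n' \<in> carrier N"
    thus "pure_tensor R M N m (n \<oplus>\<^bsub>N\<^esub> n') = pure_tensor R M N m n \<oplus>\<^bsub>tensor R M N\<^esub> pure_tensor R M N m n'"
      unfolding pure_tensor_def tensor_def
      by (simp add: s b e, intro rel) (auto simp: tensor_rels_def Let_def) }
  { assume "r \<in> carrier R" "m \<in> carrier M" "n \<in> carrier N"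
    thus "pure_tensor R M N (r \<odot>\<^bsub>M\<^esub> m) n = r \<odot>\<^bsub>tensor R M N\<^esub> pure_tensor R M N m n"
      unfolding pure_tensor_def tensor_def
      by (simp add: s b e, intro rel) (auto simp: tensor_rels_def Let_def) }
  { assume "r \<in> carrier R" "m \<in> carrier M" "n \<in> carrier N"
    thus "pure_tensor R M N m (r \<odot>\<^bsub>N\<^esub> n) = r \<odot>\<^bsub>tensor R M N\<^esub> pure_tensor R M N m n"
      unfolding pure_tensor_def tensor_def
      by (simp add: s b e, intro rel) (auto simp: tensor_rels_def Let_def) }
qed

definition bilinear_map :: "('a, 'r) ring_scheme \<Rightarrow> ('a, 'm, 'x) module_scheme
    \<Rightarrow> ('a, 'n, 'y) module_scheme \<Rightarrow> ('a, 'p, 'z) module_scheme \<Rightarrow> ('m \<Rightarrow> 'n \<Rightarrow> 'p) \<Rightarrow> bool" where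
  "bilinear_map R M N P b \<longleftrightarrow>
     (\<forall>m\<in>carrier M. b m \<in> mod_hom R N P) \<and> (\<forall>n\<in>carrier N. (\<lambda>m. b m n) \<in> mod_hom R M P)"

text \<open>The universal property of the tensor product.\<close>

lemma tensor_universal:
  assumes "module R M" "module R N" "module R P" "bilinear_map R M N P b"
  defines "h \<equiv> \<lambda>X. the_elem (lin_ext R P (\<lambda>(m, n). b m n) ` X)"
  shows "h \<in> mod_hom R (tensor R M N) P"
    and "m \<in> carrier M \<Longrightarrow> n \<in> carrier N \<Longrightarrow> h (pure_tensor R M N m n) = b m n"
proof -
  interpret M: module R M by fact
  interpret N: module R N by fact
  interpret P: module R P by fact
  let ?F = "free_mod R (carrier M \<times> carrier N)" and ?b = "\<lambda>(m, n). b m n"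
  have F: "module R ?F" by (rule free_mod_module) (rule M.R.cring_axioms)
  interpret F: module R ?F by fact
  have be: "m \<in> carrier M \<Longrightarrow> n \<in> carrier N \<Longrightarrow> basis_elt R (m, n) \<in> carrier ?F" for m n
    by (intro basis_elt_closed) (auto simp: M.R.cring_axioms)
  note H = tensor_null_submodule[OF assms(1,2)]
  note s = quot_mod_simps[OF F H]
  have bc: "m \<in> carrier M \<Longrightarrow> n \<in> carrier N \<Longrightarrow> b m n \<in> carrier P" for m n
    using mod_homD(1)[of "b m" R N P n] assms(4) by (simp add: bilinear_map_def)
  have L: "lin_ext R P ?b \<in> mod_hom R ?F P"
    by (rule lin_ext_hom) (auto simp: bc M.R.cring_axioms assms)
  note Linv = abelian_group_hom.hom_a_inv[OF mod_hom_group_hom[OF F assms(3) L]]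
  have Lb: "lin_ext R P ?b (basis_elt R (m, n)) = b m n" if "m \<in> carrier M" "n \<in> carrier N" for m n
    using lin_ext_basis_elt[OF M.R.cring_axioms assms(3), of ?b "(m, n)"] bc that by simp
  have minus: "x \<ominus>\<^bsub>?F\<^esub> y \<in> a_kernel ?F P (lin_ext R P ?b)"
    if "x \<in> carrier ?F" "y \<in> carrier ?F" "lin_ext R P ?b x = lin_ext R P ?b y" for x y
  proof -
    have c: "lin_ext R P ?b y \<in> carrier P" using that(2) by (rule mod_homD(1)[OF L])
    have "lin_ext R P ?b (x \<ominus>\<^bsub>?F\<^esub> y) = lin_ext R P ?b x \<oplus>\<^bsub>P\<^esub> (\<ominus>\<^bsub>P\<^esub> lin_ext R P ?b y)"
      unfolding a_minus_def using that by (simp only: mod_homD(2)[OF L] F.M.a_inv_closed Linv)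
    also have "\<dots> = \<zero>\<^bsub>P\<^esub>" unfolding that(3) by (rule P.M.r_neg[OF c])
    finally show ?thesis using that(1,2) by (simp only: a_kernel_def' mem_Collect_eq F.M.minus_closed)
  qed
  have b1: "b (m \<oplus>\<^bsub>M\<^esub> m') n = b m n \<oplus>\<^bsub>P\<^esub> b m' n"
    if "m \<in> carrier M" "m' \<in> carrier M" "n \<in> carrier N" for m m' n
    using assms(4) that mod_homD(2)[of "\<lambda>m. b m n" R M P m m'] by (simp add: bilinear_map_def)
  have b2: "b m (n \<oplus>\<^bsub>N\<^esub> n') = b m n \<oplus>\<^bsub>P\<^esub> b m n'"
    if "m \<in> carrier M" "n' \<in> carrier N" "n \<in> carrier N" for m n' n
    using assms(4) that mod_homD(2)[of "b m" R N P n n'] by (simp add: bilinear_map_def)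
  have b3: "b (r \<odot>\<^bsub>M\<^esub> m) n = r \<odot>\<^bsub>P\<^esub> b m n"
    if "m \<in> carrier M" "r \<in> carrier R" "n \<in> carrier N" for m r n
    using assms(4) that mod_homD(3)[of "\<lambda>m. b m n" R M P r m] by (simp add: bilinear_map_def)
  have b4: "b m (r \<odot>\<^bsub>N\<^esub> n) = r \<odot>\<^bsub>P\<^esub> b m n"
    if "m \<in> carrier M" "r \<in> carrier R" "n \<in> carrier N" for m r n
    using assms(4) that mod_homD(3)[of "b m" R N P r n] by (simp add: bilinear_map_def)
  have "tensor_rels R M N \<subseteq> a_kernel ?F P (lin_ext R P ?b)"
    unfolding tensor_rels_def Let_def
    by (intro Un_least; clarify; intro minus; simp add: be Lb mod_homD[OF L] b1 b2 b3 b4)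
  hence null: "tensor_null R M N \<subseteq> a_kernel ?F P (lin_ext R P ?b)"
    unfolding tensor_null_def
    by (rule mod_span_submodule(3)[OF F tensor_rels_subset[OF assms(1,2)]
          mod_hom_kernel_submodule[OF F assms(3) L]])
  have hq: "h (tensor_null R M N +>\<^bsub>?F\<^esub> x) = lin_ext R P ?b x" if x: "x \<in> carrier ?F" for x
  proof -
    have "lin_ext R P ?b y = lin_ext R P ?b x" if "y \<in> tensor_null R M N +>\<^bsub>?F\<^esub> x" for y
    proof -
      from that obtain k where k: "k \<in> tensor_null R M N" "y = k \<oplus>\<^bsub>?F\<^esub> x"
        by (auto simp: a_r_coset_def')
      have "k \<in> carrier ?F" "lin_ext R P ?b k = \<zero>\<^bsub>P\<^esub>"
        using null k(1) by (auto simp: a_kernel_def')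
      thus ?thesis using x by (simp add: k(2) mod_homD[OF L])
    qed
    moreover have "x \<in> tensor_null R M N +>\<^bsub>?F\<^esub> x"
      using abelian_subgroup.a_rcos_self[OF submodule_abelian_subgroup[OF F H] x] .
    ultimately have "lin_ext R P ?b ` (tensor_null R M N +>\<^bsub>?F\<^esub> x) = {lin_ext R P ?b x}" by blast
    thus ?thesis by (simp add: h_def)
  qed
  show "h \<in> mod_hom R (tensor R M N) P" unfolding tensor_def
    by (rule mod_homI) (auto simp: s hq mod_homD[OF L])
  show "h (pure_tensor R M N m n) = b m n" if "m \<in> carrier M" "n \<in> carrier N"
    using that by (simp add: pure_tensor_def hq be Lb)
qed

lemma bilinear_map_tensor_map:
  assumes "module R M'" "module R N'" "f \<in> mod_hom R M M'" "g \<in> mod_hom R N N'"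
  shows "bilinear_map R M N (tensor R M' N') (\<lambda>m n. pure_tensor R M' N' (f m) (g n))"
  unfolding bilinear_map_def
  by (auto intro!: mod_homI pure_tensor_closed assms
    simp: mod_homD[OF assms(3)] mod_homD[OF assms(4)] pure_tensor_bilinear[OF assms(1,2)])

lemma tensor_map_hom:
  assumes "module R M" "module R N" "module R M'" "module R N'"
    "f \<in> mod_hom R M M'" "g \<in> mod_hom R N N'"
  shows "tensor_map R M' N' f g \<in> mod_hom R (tensor R M N) (tensor R M' N')"
  using tensor_universal(1)[OF assms(1,2) tensor_module[OF assms(3,4)]
    bilinear_map_tensor_map[OF assms(3-6)]]
  by (simp add: tensor_map_def[abs_def])

lemma tensor_map_pure:
  assumes "module R M" "module R N" "module R M'" "module R N'"
    "f \<in> mod_hom R M M'" "g \<in> mod_hom R N N'" "m \<in> carrier M" "n \<in> carrier N"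
  shows "tensor_map R M' N' f g (pure_tensor R M N m n) = pure_tensor R M' N' (f m) (g n)"
  using tensor_universal(2)[OF assms(1,2) tensor_module[OF assms(3,4)]
    bilinear_map_tensor_map[OF assms(3-6)] assms(7,8)]
  by (simp add: tensor_map_def[abs_def])

lemma formal_sum_closed:
  assumes "cring R" "l \<in> lists (carrier R \<times> X)"
  shows "formal_sum R l \<in> carrier (free_mod R X)"
    and "formal_sum R l x \<in> carrier R"
proof -
  interpret cring R by fact
  have c: "formal_sum R l x \<in> carrier R" for x
    using assms(2) by (induction l) (auto simp: formal_sum_def)
  show "formal_sum R l x \<in> carrier R" by (rule c)
  have "x \<in> snd ` set l" if "formal_sum R l x \<noteq> \<zero>\<^bsub>R\<^esub>" for x
  proof (rule ccontr)
    assume "x \<notin> snd ` set l"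
    hence "filter (\<lambda>p. snd p = x) l = []" by (auto simp: filter_empty_conv)
    thus False using that by (simp add: formal_sum_def)
  qed
  hence s: "{x. formal_sum R l x \<noteq> \<zero>\<^bsub>R\<^esub>} \<subseteq> snd ` set l" by blast
  moreover have "snd ` set l \<subseteq> X" using assms(2) by (auto simp: in_lists_conv_set)
  ultimately show "formal_sum R l \<in> carrier (free_mod R X)"
    using c finite_subset[OF s] by (auto simp: free_mod_def)
qed

lemma formal_sum_surj:
  assumes "cring R" "f \<in> carrier (free_mod R X)"
  obtains l where "l \<in> lists (carrier R \<times> X)" "formal_sum R l = f"
proof -
  interpret cring R by fact
  have fc: "f x \<in> carrier R" for x using assms(2) by (auto simp: free_mod_def)
  have fin: "finite {x. f x \<noteq> \<zero>\<^bsub>R\<^esub>}" "{x. f x \<noteq> \<zero>\<^bsub>R\<^esub>} \<subseteq> X"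
    using assms(2) by (simp_all add: free_mod_def)
  obtain xs where xs: "set xs = {x. f x \<noteq> \<zero>\<^bsub>R\<^esub>}" "distinct xs"
    using finite_distinct_list[OF fin(1)] by blast
  let ?l = "map (\<lambda>x. (f x, x)) xs"
  have "formal_sum R (map (\<lambda>x. (f x, x)) ys) y = (if y \<in> set ys then f y else \<zero>\<^bsub>R\<^esub>)"
    if "distinct ys" for ys y
    using that by (induction ys) (auto simp: formal_sum_def fc)
  hence "formal_sum R ?l = f" using xs by (auto simp: fun_eq_iff)
  moreover have "?l \<in> lists (carrier R \<times> X)" using xs fin fc by (auto simp: in_lists_conv_set)
  ultimately show ?thesis using that by blast
qed

lemma finsum_in_submodule:
  assumes "module R M" "submodule H R M" "finite A" "\<And>x. x \<in> A \<Longrightarrow> f x \<in> H"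
  shows "(\<Oplus>\<^bsub>M\<^esub>x\<in>A. f x) \<in> H"
proof -
  interpret M: module R M by fact
  note E = M.submoduleE[OF assms(2)]
  show ?thesis using assms(3,4)
  proof (induction A)
    case empty
    thus ?case using subgroup.one_closed[OF submodule.axioms(1)[OF assms(2)]] by simp
  next
    case (insert x A)
    hence "(\<Oplus>\<^bsub>M\<^esub>x\<in>insert x A. f x) = f x \<oplus>\<^bsub>M\<^esub> (\<Oplus>\<^bsub>M\<^esub>x\<in>A. f x)"
      using E(1) by (intro M.finsum_insert) auto
    thus ?case using insert E(5) by simp
  qed
qed

lemma syzygy_step_exact:
  assumes "cring R" "module R P" "d \<in> mod_hom R (free_mod R X) P"
  defines "B \<equiv> {Rel l | l. l \<in> lists (carrier R \<times> X) \<and> d (formal_sum R l) = \<zero>\<^bsub>P\<^esub>}"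
  shows "lin_ext R (free_mod R X) (\<lambda>s. formal_sum R (rel s)) \<in> mod_hom R (free_mod R B) (free_mod R X)"
    and "lin_ext R (free_mod R X) (\<lambda>s. formal_sum R (rel s)) ` carrier (free_mod R B)
           = a_kernel (free_mod R X) P d"
proof -
  interpret cring R by fact
  note F = free_mod_module[OF assms(1)]
  have b: "formal_sum R (rel s) \<in> a_kernel (free_mod R X) P d" if "s \<in> B" for s
  proof -
    from that obtain l where l: "s = Rel l" "l \<in> lists (carrier R \<times> X)" "d (formal_sum R l) = \<zero>\<^bsub>P\<^esub>"
      unfolding B_def by blast
    show ?thesis unfolding a_kernel_def' using l formal_sum_closed(1)[OF assms(1) l(2)] by simp
  qed
  hence b': "(\<lambda>s. formal_sum R (rel s)) \<in> B \<rightarrow> carrier (free_mod R X)"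
    by (auto simp: a_kernel_def')
  show "lin_ext R (free_mod R X) (\<lambda>s. formal_sum R (rel s)) \<in> mod_hom R (free_mod R B) (free_mod R X)"
    by (rule lin_ext_hom[OF assms(1) F b'])
  show "lin_ext R (free_mod R X) (\<lambda>s. formal_sum R (rel s)) ` carrier (free_mod R B)
           = a_kernel (free_mod R X) P d"
  proof (rule subset_antisym; rule subsetI)
    fix y assume "y \<in> lin_ext R (free_mod R X) (\<lambda>s. formal_sum R (rel s)) ` carrier (free_mod R B)"
    then obtain f where f: "f \<in> carrier (free_mod R B)"
      and y: "y = lin_ext R (free_mod R X) (\<lambda>s. formal_sum R (rel s)) f" by blast
    have K: "submodule (a_kernel (free_mod R X) P d) R (free_mod R X)"
      by (rule mod_hom_kernel_submodule[OF F assms(2,3)])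
    have fc: "f x \<in> carrier R" "finite {x. f x \<noteq> \<zero>\<^bsub>R\<^esub>}" "f x \<noteq> \<zero>\<^bsub>R\<^esub> \<Longrightarrow> x \<in> B" for x
      using f by (auto simp: free_mod_def)
    show "y \<in> a_kernel (free_mod R X) P d" unfolding y lin_ext_def
      by (rule finsum_in_submodule[OF F K fc(2)])
         (use b fc submodule.smult_closed[OF K] in blast)
  next
    fix y assume y: "y \<in> a_kernel (free_mod R X) P d"
    hence "y \<in> carrier (free_mod R X)" by (simp add: a_kernel_def')
    then obtain l where l: "l \<in> lists (carrier R \<times> X)" "formal_sum R l = y"
      using formal_sum_surj[OF assms(1)] by metis
    have "d y = \<zero>\<^bsub>P\<^esub>" using y by (simp add: a_kernel_def')
    hence "Rel l \<in> B" unfolding B_def using l by blast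
    hence "basis_elt R (Rel l) \<in> carrier (free_mod R B)" by (rule basis_elt_closed[OF assms(1)])
    moreover have "lin_ext R (free_mod R X) (\<lambda>s. formal_sum R (rel s)) (basis_elt R (Rel l)) = y"
      using lin_ext_basis_elt[OF assms(1) F, where x = "Rel l" and g = "\<lambda>s. formal_sum R (rel s)"]
        formal_sum_closed(1)[OF assms(1) l(1)] l(2) by simp
    ultimately show "y \<in> lin_ext R (free_mod R X) (\<lambda>s. formal_sum R (rel s)) ` carrier (free_mod R B)"
      by (metis imageI)
  qed
qed

text \<open>The sequence \<open>\<dots> \<rightarrow> F\<^sub>1 \<rightarrow> F\<^sub>0 \<rightarrow> N \<rightarrow> 0\<close> is a free resolution of \<open>N\<close>.\<close>

lemma res_mod_module: "cring R \<Longrightarrow> module R (res_mod R N n)"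
  unfolding res_mod_def by (rule free_mod_module)

lemma res_aug_hom:
  assumes "module R N"
  shows "res_aug R N \<in> mod_hom R (res_mod R N 0) N"
  unfolding res_aug_def res_mod_def
  by (rule lin_ext_hom) (use assms in \<open>auto simp: module_def\<close>)

lemma res_aug_surj:
  assumes "module R N"
  shows "res_aug R N ` carrier (res_mod R N 0) = carrier N"
proof -
  interpret module R N by fact
  have "y \<in> res_aug R N ` carrier (res_mod R N 0)" if "y \<in> carrier N" for y
  proof -
    have "res_aug R N (basis_elt R (Gen y)) = y"
      using lin_ext_basis_elt[OF R.cring_axioms assms, where x = "Gen y" and g = gen] that
      by (simp add: res_aug_def)
    moreover have "basis_elt R (Gen y) \<in> carrier (res_mod R N 0)"
      unfolding res_mod_def by (rule basis_elt_closed[OF R.cring_axioms]) (simp add: that)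
    ultimately show ?thesis by (metis imageI)
  qed
  thus ?thesis using mod_homD(1)[OF res_aug_hom[OF assms]] by blast
qed

lemma res_diff_aux:
  assumes "module R N"
  shows "res_diff R N n \<in> mod_hom R (res_mod R N (Suc n)) (res_mod R N n) \<and>
     res_diff R N (Suc n) ` carrier (res_mod R N (Suc (Suc n))) =
       a_kernel (res_mod R N (Suc n)) (res_mod R N n) (res_diff R N n)"
proof -
  interpret module R N by fact
  note R = R.cring_axioms
  have step: "res_diff R N (Suc n) \<in> mod_hom R (res_mod R N (Suc (Suc n))) (res_mod R N (Suc n)) \<and>
     res_diff R N (Suc n) ` carrier (res_mod R N (Suc (Suc n))) =
       a_kernel (res_mod R N (Suc n)) (res_mod R N n) (res_diff R N n)"
    if "res_diff R N n \<in> mod_hom R (res_mod R N (Suc n)) (res_mod R N n)" for n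
    using syzygy_step_exact[OF R res_mod_module[OF R] that[unfolded res_mod_def[of _ _ "Suc n"]]]
    by (simp add: res_mod_def res_diff_def)
  have "res_diff R N n \<in> mod_hom R (res_mod R N (Suc n)) (res_mod R N n)" for n
  proof (induction n)
    case 0
    show ?case
      using syzygy_step_exact(1)[OF R assms res_aug_hom[OF assms, unfolded res_mod_def]]
      by (simp add: res_mod_def res_diff_def res_aug_def)
  next
    case (Suc n)
    thus ?case using step by blast
  qed
  thus ?thesis using step by blast
qed

lemma res_diff_hom:
  assumes "module R N"
  shows "res_diff R N n \<in> mod_hom R (res_mod R N (Suc n)) (res_mod R N n)"
  using res_diff_aux[OF assms] by blast

lemma res_exact_0:
  assumes "module R N"
  shows "res_diff R N 0 ` carrier (res_mod R N (Suc 0)) = a_kernel (res_mod R N 0) N (res_aug R N)"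
proof -
  interpret module R N by fact
  show ?thesis
    using syzygy_step_exact(2)[OF R.cring_axioms assms res_aug_hom[OF assms, unfolded res_mod_def]]
    by (simp add: res_mod_def res_diff_def res_aug_def)
qed

lemma res_exact_Suc:
  assumes "module R N"
  shows "res_diff R N (Suc n) ` carrier (res_mod R N (Suc (Suc n))) =
    a_kernel (res_mod R N (Suc n)) (res_mod R N n) (res_diff R N n)"
  using res_diff_aux[OF assms] by blast

lemma mod_hom_id: "id \<in> mod_hom R M M"
  by (auto simp: mod_hom_def)

lemma tor_diff_hom:
  assumes "module R N" "module R M"
  shows "tor_diff R N M n \<in> mod_hom R (tor_chain R N M (Suc n)) (tor_chain R N M n)"
proof -
  interpret module R N by fact
  show ?thesis unfolding tor_diff_def tor_chain_def
    by (intro tensor_map_hom res_mod_module res_diff_hom mod_hom_id assms R.cring_axioms)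
qed

lemma ideal_power_ideal:
  assumes "cring R" "ideal I R"
  shows "ideal (ideal_power R I k) R" "ideal_power R I (Suc k) \<subseteq> ideal_power R I k"
proof -
  interpret cring R by fact
  interpret S: comm_monoid "ideals_set R" by (rule ideals_set_is_comm_monoid)
  have I: "I \<in> carrier (ideals_set R)" using assms(2) by (simp add: ideals_set_def)
  have id: "ideal (ideal_power R I k) R" for k
    using S.nat_pow_closed[OF I, of k] unfolding ideal_power_def by (simp add: ideals_set_def)
  show "ideal (ideal_power R I k) R" by (rule id)
  have "ideal_power R I (Suc k) = ideal_prod R (ideal_power R I k) I"
    unfolding ideal_power_def by (simp add: S.nat_pow_Suc) (simp add: ideals_set_def)
  thus "ideal_power R I (Suc k) \<subseteq> ideal_power R I k"
    using ideal_prod_inter[OF id[of k] assms(2)] by simp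
qed

lemma regular_mod_coset:
  "J +>\<^bsub>regular_mod R\<^esub> x = J +>\<^bsub>R\<^esub> x" "set_add (regular_mod R) J K = set_add R J K"
  by (simp_all add: a_r_coset_def' set_add_def' regular_mod_def)

lemma adic_trunc_module:
  assumes "cring R" "ideal I R"
  shows "module R (adic_trunc R I k)"
  unfolding adic_trunc_def
  by (intro quot_mod_module regular_mod_module regular_mod_submodule ideal_power_ideal assms)

lemma adic_trunc_simps:
  assumes "cring R" "ideal I R"
  shows "carrier (adic_trunc R I k) = (\<lambda>x. ideal_power R I (k + 1) +>\<^bsub>R\<^esub> x) ` carrier R"
    and "x \<in> carrier R \<Longrightarrow> y \<in> carrier R \<Longrightarrow>
          (ideal_power R I (k + 1) +>\<^bsub>R\<^esub> x) \<oplus>\<^bsub>adic_trunc R I k\<^esub> (ideal_power R I (k + 1) +>\<^bsub>R\<^esub> y)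
            = ideal_power R I (k + 1) +>\<^bsub>R\<^esub> (x \<oplus>\<^bsub>R\<^esub> y)"
    and "r \<in> carrier R \<Longrightarrow> x \<in> carrier R \<Longrightarrow>
          r \<odot>\<^bsub>adic_trunc R I k\<^esub> (ideal_power R I (k + 1) +>\<^bsub>R\<^esub> x) = ideal_power R I (k + 1) +>\<^bsub>R\<^esub> (r \<otimes>\<^bsub>R\<^esub> x)"
proof -
  note q = quot_mod_simps[OF regular_mod_module[OF assms(1)]
    regular_mod_submodule[OF assms(1) ideal_power_ideal(1)[OF assms, of "k + 1"]],
    unfolded regular_mod_coset]
  have s: "carrier (regular_mod R) = carrier R" "smult (regular_mod R) = monoid.mult R"
    "add (regular_mod R) = add R" by (simp_all add: regular_mod_def)
  show "carrier (adic_trunc R I k) = (\<lambda>x. ideal_power R I (k + 1) +>\<^bsub>R\<^esub> x) ` carrier R"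
    unfolding adic_trunc_def q(1) s ..
  show "(ideal_power R I (k + 1) +>\<^bsub>R\<^esub> x) \<oplus>\<^bsub>adic_trunc R I k\<^esub> (ideal_power R I (k + 1) +>\<^bsub>R\<^esub> y)
            = ideal_power R I (k + 1) +>\<^bsub>R\<^esub> (x \<oplus>\<^bsub>R\<^esub> y)" if "x \<in> carrier R" "y \<in> carrier R"
    using q(3) that unfolding adic_trunc_def s .
  show "r \<odot>\<^bsub>adic_trunc R I k\<^esub> (ideal_power R I (k + 1) +>\<^bsub>R\<^esub> x) = ideal_power R I (k + 1) +>\<^bsub>R\<^esub> (r \<otimes>\<^bsub>R\<^esub> x)"
    if "r \<in> carrier R" "x \<in> carrier R"
    using q(4) that unfolding adic_trunc_def s .
qed

lemma adic_proj_coset: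
  assumes "cring R" "ideal I R" "x \<in> carrier R"
  shows "ideal_power R I (k + 1) <+>\<^bsub>R\<^esub> (ideal_power R I (Suc k + 1) +>\<^bsub>R\<^esub> x)
    = ideal_power R I (k + 1) +>\<^bsub>R\<^esub> x"
proof -
  interpret cring R by fact
  let ?J = "ideal_power R I (k + 1)" and ?J' = "ideal_power R I (Suc k + 1)"
  interpret J: ideal ?J R by (rule ideal_power_ideal[OF assms(1,2)])
  interpret J': ideal ?J' R by (rule ideal_power_ideal[OF assms(1,2)])
  have sub: "?J' \<subseteq> ?J" using ideal_power_ideal(2)[OF assms(1,2), of "k + 1"] by simp
  show ?thesis
  proof (rule subset_antisym; rule subsetI)
    fix y assume "y \<in> ?J <+>\<^bsub>R\<^esub> (?J' +>\<^bsub>R\<^esub> x)"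
    then obtain a b where ab: "a \<in> ?J" "b \<in> ?J'" "y = a \<oplus>\<^bsub>R\<^esub> (b \<oplus>\<^bsub>R\<^esub> x)"
      by (auto simp: set_add_def' a_r_coset_def')
    moreover have "a \<oplus>\<^bsub>R\<^esub> b \<in> ?J" using ab sub by (intro J.a_closed) auto
    moreover have "a \<in> carrier R" "b \<in> carrier R" using ab J.a_subset J'.a_subset by auto
    ultimately have "y = (a \<oplus>\<^bsub>R\<^esub> b) \<oplus>\<^bsub>R\<^esub> x" "a \<oplus>\<^bsub>R\<^esub> b \<in> ?J"
      using assms(3) by (simp_all add: a_assoc)
    thus "y \<in> ?J +>\<^bsub>R\<^esub> x" by (auto simp: a_r_coset_def')
  next
    fix y assume "y \<in> ?J +>\<^bsub>R\<^esub> x"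
    then obtain a where a: "a \<in> ?J" "y = a \<oplus>\<^bsub>R\<^esub> (\<zero>\<^bsub>R\<^esub> \<oplus>\<^bsub>R\<^esub> x)"
      using assms(3) by (auto simp: a_r_coset_def')
    moreover have "\<zero>\<^bsub>R\<^esub> \<in> ?J'" by (rule J'.zero_closed)
    ultimately show "y \<in> ?J <+>\<^bsub>R\<^esub> (?J' +>\<^bsub>R\<^esub> x)"
      unfolding set_add_def' a_r_coset_def' by blast
  qed
qed

lemma adic_proj_hom:
  assumes "cring R" "ideal I R"
  shows "(\<lambda>X. ideal_power R I (k + 1) <+>\<^bsub>R\<^esub> X) \<in> mod_hom R (adic_trunc R I (Suc k)) (adic_trunc R I k)"
proof -
  interpret cring R by fact
  note s = adic_trunc_simps[OF assms] adic_proj_coset[OF assms]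
  show ?thesis
    by (rule mod_homI) (auto simp: s simp del: add_Suc One_nat_def Suc_eq_plus1 add_Suc_right)
qed

lemma inv_limit_module:
  assumes "cring R" "\<And>k. module R (T k)" "\<And>k. p k \<in> mod_hom R (T (Suc k)) (T k)"
  shows "module R (inv_limit T p)"
proof -
  interpret cring R by fact
  note am = abelian_group.axioms(1)[OF module.axioms(2)[OF assms(2)]]
  note ax = abelian_monoid.a_closed[OF am] abelian_monoid.zero_closed[OF am]
    abelian_monoid.a_assoc[OF am] abelian_monoid.a_comm[OF am] abelian_monoid.a_lcomm[OF am]
    abelian_monoid.l_zero[OF am] abelian_monoid.r_zero[OF am]
  note [simp] = mod_homD[OF assms(3)] mod_hom_zero[OF assms(2,2,3)]
  show ?thesis
  proof (rule moduleI)
    show "abelian_group (inv_limit T p)"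
    proof (rule abelian_groupI)
      fix x assume x: "x \<in> carrier (inv_limit T p)"
      hence xc: "x k \<in> carrier (T k)" and xp: "p k (x (Suc k)) = x k" for k
        by (simp_all add: inv_limit_def)
      define y where "y = (\<lambda>k. (\<ominus>\<^bsub>R\<^esub> \<one>\<^bsub>R\<^esub>) \<odot>\<^bsub>T k\<^esub> x k)"
      have "y k \<oplus>\<^bsub>T k\<^esub> x k = \<zero>\<^bsub>T k\<^esub>" for k
      proof -
        interpret T: module R "T k" by (rule assms(2))
        show ?thesis using xc[of k] by (simp add: y_def T.smult_l_minus T.M.l_neg)
      qed
      moreover have "y \<in> carrier (inv_limit T p)"
        using xc xp by (simp add: inv_limit_def y_def module.smult_closed[OF assms(2)])
      ultimately show "\<exists>y\<in>carrier (inv_limit T p). y \<oplus>\<^bsub>inv_limit T p\<^esub> x = \<zero>\<^bsub>inv_limit T p\<^esub>"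
        by (intro bexI[of _ y]) (simp_all add: inv_limit_def)
    qed (simp_all add: inv_limit_def ax fun_eq_iff)
  qed (simp_all add: inv_limit_def cring_axioms fun_eq_iff module.smult_closed[OF assms(2)]
        module.smult_l_distr[OF assms(2)] module.smult_r_distr[OF assms(2)]
        module.smult_assoc1[OF assms(2)] module.smult_one[OF assms(2)])
qed

lemma adic_completion_module:
  assumes "module R M" "ideal I R"
  shows "module R (adic_completion R I M)"
proof -
  interpret module R M by fact
  show ?thesis unfolding adic_completion_def
    by (intro inv_limit_module tensor_module tensor_map_hom adic_trunc_module adic_proj_hom mod_hom_id
        assms R.cring_axioms)
qed

lemma to_completion_hom:
  assumes "module R M" "ideal I R"
  shows "to_completion R I M \<in> mod_hom R M (adic_completion R I M)"
proof -
  interpret module R M by fact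
  note R = R.cring_axioms
  note T = adic_trunc_module[OF R assms(2)]
  have one: "ideal_power R I (k + 1) +>\<^bsub>R\<^esub> \<one>\<^bsub>R\<^esub> \<in> carrier (adic_trunc R I k)" for k
    by (simp add: adic_trunc_simps(1)[OF R assms(2)])
  have tr: "tensor_map R (adic_trunc R I k) M (\<lambda>X. ideal_power R I (k + 1) <+>\<^bsub>R\<^esub> X) id
      (pure_tensor R (adic_trunc R I (Suc k)) M (ideal_power R I (Suc k + 1) +>\<^bsub>R\<^esub> \<one>\<^bsub>R\<^esub>) m)
     = pure_tensor R (adic_trunc R I k) M (ideal_power R I (k + 1) +>\<^bsub>R\<^esub> \<one>\<^bsub>R\<^esub>) m"
    if "m \<in> carrier M" for k m
    by (subst tensor_map_pure[OF T assms(1) T assms(1) adic_proj_hom[OF R assms(2)] mod_hom_id one that])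
       (simp only: adic_proj_coset[OF R assms(2) R.one_closed] id_apply)
  show ?thesis
  proof (rule mod_homI)
    fix m assume m: "m \<in> carrier M"
    show "to_completion R I M m \<in> carrier (adic_completion R I M)"
      unfolding to_completion_def adic_completion_def inv_limit_def
      using tr[OF m] pure_tensor_closed[OF T assms(1) one m] by simp
  next
    fix m n assume "m \<in> carrier M" "n \<in> carrier M"
    thus "to_completion R I M (m \<oplus>\<^bsub>M\<^esub> n) =
        to_completion R I M m \<oplus>\<^bsub>adic_completion R I M\<^esub> to_completion R I M n"
      using pure_tensor_bilinear(2)[OF T assms(1) one]
      by (simp add: to_completion_def adic_completion_def inv_limit_def)
  next
    fix r m assume "r \<in> carrier R" "m \<in> carrier M"
    thus "to_completion R I M (r \<odot>\<^bsub>M\<^esub> m) = r \<odot>\<^bsub>adic_completion R I M\<^esub> to_completion R I M m"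
      using pure_tensor_bilinear(4)[OF T assms(1) _ one]
      by (simp add: to_completion_def adic_completion_def inv_limit_def)
  qed
qed

lemma fg_module_embeds:
  fixes R :: "('a, 'r) ring_scheme" and N :: "('a, 'n, 'x) module_scheme" and k :: nat
  assumes "module R N" "f \<in> mod_hom R (free_mod R {..<k}) N"
    "f ` carrier (free_mod R {..<k}) = carrier N"
  shows "\<exists>N' :: ('a, 'a list set) module. module R N' \<and> mod_iso R N N' \<noteq> {}"
proof -
  interpret N: module R N by fact
  let ?F = "free_mod R {..<k}"
  define j where "j = (\<lambda>y. {map h [0..<k] | h. h \<in> carrier ?F \<and> f h = y})"
  have inj: "inj_on j (carrier N)"
  proof (rule inj_onI)
    fix y z assume y: "y \<in> carrier N" and z: "z \<in> carrier N" and "j y = j z"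
    have "y \<in> f ` carrier ?F" using y assms(3) by simp
    then obtain h where h: "h \<in> carrier ?F" "f h = y" by (elim imageE) simp
    hence "map h [0..<k] \<in> j y" unfolding j_def by blast
    hence "map h [0..<k] \<in> j z" using \<open>j y = j z\<close> by simp
    then obtain h' where h': "h' \<in> carrier ?F" "f h' = z" "map h [0..<k] = map h' [0..<k]"
      unfolding j_def by blast
    have "h i = h' i" for i
    proof (cases "i < k")
      case True
      thus ?thesis using h'(3) by (auto simp: map_eq_conv)
    next
      case False
      hence "h i = \<zero>\<^bsub>R\<^esub>" "h' i = \<zero>\<^bsub>R\<^esub>" using h(1) h'(1) by (auto simp: free_mod_def)
      thus ?thesis by simp
    qed
    thus "y = z" using h(2) h'(2) by (metis ext)
  qed
  define g where "g = the_inv_into (carrier N) j"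
  have g: "g (j x) = x" if "x \<in> carrier N" for x
    using the_inv_into_f_f[OF inj that] by (simp add: g_def)
  define N' :: "('a, 'a list set) module" where "N' = \<lparr>carrier = j ` carrier N, monoid.mult = undefined, one = undefined,
    zero = j \<zero>\<^bsub>N\<^esub>, add = (\<lambda>u v. j (g u \<oplus>\<^bsub>N\<^esub> g v)), smult = (\<lambda>r u. j (r \<odot>\<^bsub>N\<^esub> g u))\<rparr>"
  have "module R N'"
  proof (rule moduleI)
    show "abelian_group N'"
    proof (rule abelian_groupI)
      fix u assume "u \<in> carrier N'"
      then obtain x where x: "x \<in> carrier N" "u = j x" by (auto simp: N'_def)
      show "\<exists>v\<in>carrier N'. v \<oplus>\<^bsub>N'\<^esub> u = \<zero>\<^bsub>N'\<^esub>"
        using x by (intro bexI[of _ "j (\<ominus>\<^bsub>N\<^esub> x)"]) (simp_all add: N'_def g N.M.l_neg)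
    qed (auto simp: N'_def g N.M.a_assoc N.M.a_comm N.M.a_lcomm)
  qed (auto simp: N'_def g N.R.cring_axioms N.smult_l_distr N.smult_r_distr N.smult_assoc1)
  moreover have "j \<in> mod_iso R N N'"
    using inj by (auto simp: mod_iso_def bij_betw_def N'_def g intro!: mod_homI)
  ultimately show ?thesis by blast
qed

end

theory Submission
  imports Defs
begin

text \<open>
  Write \<open>S M\<close> for the submodule of \<open>F \<otimes> M\<close> spanned by the tensors \<open>c \<otimes> m\<close> with \<open>c \<in> S\<close>, and \<open>R\<^sup>X\<close> for the free
  module on \<open>X\<close>. Flatness of \<open>M\<close> amounts to the statement that a finite system of linear equations over
  \<open>R\<close> has no other solutions in \<open>M\<close> than combinations of its solutions in \<open>R\<close>: for a map \<open>h : R\<^sup>X \<rightarrow> R\<^sup>Y\<close>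
  of finite free modules, the kernel of \<open>h \<otimes> M\<close> is \<open>(ker h) M\<close> (\<open>tensor_kernel_free\<close>).

  Adic flatness gives this modulo powers of \<open>I\<close>. The module \<open>R\<^sup>Y / (h(R\<^sup>X) + I\<^sup>l R\<^sup>Y)\<close> is torsion, and the
  vanishing of its first Tor says that an element which \<open>h \<otimes> M\<close> sends into \<open>(I\<^sup>l R\<^sup>Y) M\<close> lies in \<open>S M\<close>, where
  \<open>S\<close> is the preimage of \<open>I\<^sup>l R\<^sup>Y\<close> under \<open>h\<close> (\<open>tensor_kernel_of_tor_vanishing\<close>, \<open>adically_flat_relations\<close>).
  By the Artin-Rees property \<open>S\<close> is contained in \<open>I\<^sup>k R\<^sup>X + ker h\<close> when \<open>l\<close> is large. So such an element lies in
  \<open>(I\<^sup>k R\<^sup>X) M + (ker h) M\<close> (\<open>tensor_artin_rees\<close>).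

  This is used twice. For \<open>h\<close> itself, it shows that the kernel of \<open>h \<otimes> M\<close> is contained in the closure of
  \<open>(ker h) M\<close>. For a map \<open>B : R\<^sup>P \<rightarrow> R\<^sup>X\<close> from a finite free module onto \<open>ker h\<close>, it shows that \<open>B \<otimes> M\<close> is open
  onto its image \<open>(ker h) M\<close>. As \<open>R\<^sup>P \<otimes> M = M\<^sup>P\<close> is complete and \<open>R\<^sup>X \<otimes> M = M\<^sup>X\<close> is separated, successive
  approximation shows that the image is closed.

  The Artin-Rees property is needed only as a comparison of topologies, without a linear bound on the
  exponents. In this form it follows from the ascending chain condition by induction on the number of
  generators of \<open>I\<close> (\<open>artin_rees_list\<close>).
\<close>

section \<open>Submodules and homomorphisms\<close>

lemma submodule_criterion:
  assumes "module R M" "H \<subseteq> carrier M" "\<zero>\<^bsub>M\<^esub> \<in> H"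
    and "\<And>x y. x \<in> H \<Longrightarrow> y \<in> H \<Longrightarrow> x \<oplus>\<^bsub>M\<^esub> y \<in> H"
    and "\<And>r x. r \<in> carrier R \<Longrightarrow> x \<in> H \<Longrightarrow> r \<odot>\<^bsub>M\<^esub> x \<in> H"
  shows "submodule H R M"
proof -
  interpret module R M by fact
  show ?thesis
  proof (rule submoduleI)
    fix a assume a: "a \<in> H"
    have "\<ominus>\<^bsub>M\<^esub> a = (\<ominus>\<^bsub>R\<^esub> \<one>\<^bsub>R\<^esub>) \<odot>\<^bsub>M\<^esub> a"
      using a assms(2) by (simp add: subsetD smult_l_minus)
    thus "\<ominus>\<^bsub>M\<^esub> a \<in> H" using a assms(5) by simp
  qed (use assms in auto)
qed

lemma submoduleD:
  assumes "module R M" "submodule H R M"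
  shows "x \<in> H \<Longrightarrow> x \<in> carrier M" "\<zero>\<^bsub>M\<^esub> \<in> H"
    "x \<in> H \<Longrightarrow> y \<in> H \<Longrightarrow> x \<oplus>\<^bsub>M\<^esub> y \<in> H"
    "r \<in> carrier R \<Longrightarrow> x \<in> H \<Longrightarrow> r \<odot>\<^bsub>M\<^esub> x \<in> H"
    "x \<in> H \<Longrightarrow> \<ominus>\<^bsub>M\<^esub> x \<in> H"
    "x \<in> H \<Longrightarrow> y \<in> H \<Longrightarrow> x \<ominus>\<^bsub>M\<^esub> y \<in> H"
  using module.submoduleE[OF assms] subgroup.one_closed[OF submodule.axioms(1)[OF assms(2)]]
  by (auto simp: a_minus_def)

lemma submodule_cancel:
  assumes "module R M" "submodule H R M" "x \<in> H" "x \<oplus>\<^bsub>M\<^esub> y \<in> H" "y \<in> carrier M"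
  shows "y \<in> H"
proof -
  interpret M: module R M by fact
  have x: "x \<in> carrier M" using submoduleD(1)[OF assms(1,2,3)] .
  have "y = \<ominus>\<^bsub>M\<^esub> x \<oplus>\<^bsub>M\<^esub> (x \<oplus>\<^bsub>M\<^esub> y)" using x assms(5) by (simp add: M.M.r_neg1)
  thus ?thesis using submoduleD[OF assms(1,2)] assms(3,4) by metis
qed

lemma image_submodule:
  assumes "module R M" "module R N" "f \<in> mod_hom R M N" "submodule H R M"
  shows "submodule (f ` H) R N"
proof -
  interpret M: module R M by fact
  note h = mod_homD[OF assms(3)] and S = submoduleD[OF assms(1,4)]
  show ?thesis
  proof (rule submodule_criterion[OF assms(2)])
    show "f ` H \<subseteq> carrier N" using h S by auto
    show "\<zero>\<^bsub>N\<^esub> \<in> f ` H" using mod_hom_zero[OF assms(1-3)] S(2) by (metis imageI)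
  next
    fix x y assume "x \<in> f ` H" "y \<in> f ` H"
    then obtain a b where ab: "a \<in> H" "b \<in> H" "x = f a" "y = f b" by blast
    hence "x \<oplus>\<^bsub>N\<^esub> y = f (a \<oplus>\<^bsub>M\<^esub> b)" using h(2) S(1) by simp
    thus "x \<oplus>\<^bsub>N\<^esub> y \<in> f ` H" using ab S(3) by simp
  next
    fix r x assume "r \<in> carrier R" "x \<in> f ` H"
    then obtain a where ab: "a \<in> H" "x = f a" by blast
    hence "r \<odot>\<^bsub>N\<^esub> x = f (r \<odot>\<^bsub>M\<^esub> a)" using h(3) S(1) \<open>r \<in> carrier R\<close> by simp
    thus "r \<odot>\<^bsub>N\<^esub> x \<in> f ` H" using ab S(4) \<open>r \<in> carrier R\<close> by simp
  qed
qed

lemma vimage_submodule: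
  assumes "module R M" "module R N" "f \<in> mod_hom R M N" "submodule H R N"
  shows "submodule {x \<in> carrier M. f x \<in> H} R M"
proof -
  interpret M: module R M by fact
  show ?thesis
    by (rule submodule_criterion[OF assms(1)])
       (use submoduleD[OF assms(2,4)] mod_homD[OF assms(3)] mod_hom_zero[OF assms(1-3)] in auto)
qed

lemma equalizer_submodule:
  assumes "module R M" "module R N" "f \<in> mod_hom R M N" "g \<in> mod_hom R M N"
  shows "submodule {x \<in> carrier M. f x = g x} R M"
proof -
  interpret M: module R M by fact
  show ?thesis
    by (rule submodule_criterion[OF assms(1)])
       (use mod_homD[OF assms(3)] mod_homD[OF assms(4)] mod_hom_zero[OF assms(1-3)]
        mod_hom_zero[OF assms(1,2,4)] in auto)
qed

lemma sum_submodule: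
  assumes "module R M" "submodule H R M" "submodule K R M"
  shows "submodule {x \<oplus>\<^bsub>M\<^esub> y | x y. x \<in> H \<and> y \<in> K} R M"
proof -
  interpret M: module R M by fact
  note H = submoduleD[OF assms(1,2)] and K = submoduleD[OF assms(1,3)]
  show ?thesis
  proof (rule submodule_criterion[OF assms(1)])
    show "{x \<oplus>\<^bsub>M\<^esub> y | x y. x \<in> H \<and> y \<in> K} \<subseteq> carrier M" using H(1) K(1) by auto
    show "\<zero>\<^bsub>M\<^esub> \<in> {x \<oplus>\<^bsub>M\<^esub> y | x y. x \<in> H \<and> y \<in> K}"
      using H(2) K(2) M.M.r_zero[OF M.M.zero_closed] by force
  next
    fix a b assume "a \<in> {x \<oplus>\<^bsub>M\<^esub> y | x y. x \<in> H \<and> y \<in> K}" "b \<in> {x \<oplus>\<^bsub>M\<^esub> y | x y. x \<in> H \<and> y \<in> K}"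
    then obtain x y x' y' where *: "x \<in> H" "y \<in> K" "x' \<in> H" "y' \<in> K"
      "a = x \<oplus>\<^bsub>M\<^esub> y" "b = x' \<oplus>\<^bsub>M\<^esub> y'" by blast
    hence "a \<oplus>\<^bsub>M\<^esub> b = (x \<oplus>\<^bsub>M\<^esub> x') \<oplus>\<^bsub>M\<^esub> (y \<oplus>\<^bsub>M\<^esub> y')" using H(1) K(1) by (simp add: M.M.a_ac)
    thus "a \<oplus>\<^bsub>M\<^esub> b \<in> {x \<oplus>\<^bsub>M\<^esub> y | x y. x \<in> H \<and> y \<in> K}" using * H(3) K(3) by blast
  next
    fix r a assume r: "r \<in> carrier R" and "a \<in> {x \<oplus>\<^bsub>M\<^esub> y | x y. x \<in> H \<and> y \<in> K}"
    then obtain x y where *: "x \<in> H" "y \<in> K" "a = x \<oplus>\<^bsub>M\<^esub> y" by blast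
    hence "r \<odot>\<^bsub>M\<^esub> a = r \<odot>\<^bsub>M\<^esub> x \<oplus>\<^bsub>M\<^esub> r \<odot>\<^bsub>M\<^esub> y" using H(1) K(1) r by (simp add: M.smult_r_distr)
    thus "r \<odot>\<^bsub>M\<^esub> a \<in> {x \<oplus>\<^bsub>M\<^esub> y | x y. x \<in> H \<and> y \<in> K}" using * H(4) K(4) r by blast
  qed
qed

lemma zero_submodule:
  assumes "module R M"
  shows "submodule {\<zero>\<^bsub>M\<^esub>} R M"
proof -
  interpret M: module R M by fact
  show ?thesis by (rule submodule_criterion[OF assms]) auto
qed

lemma mod_hom_comp:
  assumes "f \<in> mod_hom R K L" "g \<in> mod_hom R L N"
  shows "(\<lambda>x. g (f x)) \<in> mod_hom R K N"
  by (rule mod_homI) (simp_all add: mod_homD[OF assms(1)] mod_homD[OF assms(2)])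

lemma mod_hom_minus:
  assumes "module R K" "module R N" "f \<in> mod_hom R K N" "x \<in> carrier K" "y \<in> carrier K"
  shows "f (x \<ominus>\<^bsub>K\<^esub> y) = f x \<ominus>\<^bsub>N\<^esub> f y"
proof -
  interpret K: module R K by fact
  show ?thesis
    using abelian_group_hom.hom_a_inv[OF mod_hom_group_hom[OF assms(1-3)]] assms(4,5)
    by (simp add: a_minus_def mod_homD[OF assms(3)])
qed

lemma minus_add_cancel:
  assumes "module R M" "x \<in> carrier M" "y \<in> carrier M"
  shows "(x \<ominus>\<^bsub>M\<^esub> y) \<oplus>\<^bsub>M\<^esub> y = x" "y \<oplus>\<^bsub>M\<^esub> (x \<ominus>\<^bsub>M\<^esub> y) = x" "x \<ominus>\<^bsub>M\<^esub> y = \<zero>\<^bsub>M\<^esub> \<longleftrightarrow> x = y"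
    "(x \<oplus>\<^bsub>M\<^esub> y) \<ominus>\<^bsub>M\<^esub> y = x" "(y \<oplus>\<^bsub>M\<^esub> x) \<ominus>\<^bsub>M\<^esub> y = x"
proof -
  interpret M: module R M by fact
  show 1: "(x \<ominus>\<^bsub>M\<^esub> y) \<oplus>\<^bsub>M\<^esub> y = x" using assms by (simp add: a_minus_def M.M.a_assoc M.M.l_neg)
  show "y \<oplus>\<^bsub>M\<^esub> (x \<ominus>\<^bsub>M\<^esub> y) = x" using 1 assms by (simp add: M.M.a_comm)
  show "x \<ominus>\<^bsub>M\<^esub> y = \<zero>\<^bsub>M\<^esub> \<longleftrightarrow> x = y" using assms by (metis 1 M.M.l_zero M.M.r_neg a_minus_def)
  show 2: "(x \<oplus>\<^bsub>M\<^esub> y) \<ominus>\<^bsub>M\<^esub> y = x" using assms by (simp add: a_minus_def M.M.a_assoc M.M.r_neg)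
  show "(y \<oplus>\<^bsub>M\<^esub> x) \<ominus>\<^bsub>M\<^esub> y = x" using 2 assms by (simp add: M.M.a_comm)
qed

section \<open>Free modules\<close>

lemma free_modD:
  assumes "f \<in> carrier (free_mod R X)"
  shows "f x \<in> carrier R" "finite {x. f x \<noteq> \<zero>\<^bsub>R\<^esub>}" "x \<notin> X \<Longrightarrow> f x = \<zero>\<^bsub>R\<^esub>"
  using assms by (auto simp: free_mod_def)

lemma free_modI:
  assumes "finite A" "A \<subseteq> X" "\<And>x. x \<in> A \<Longrightarrow> f x \<in> carrier R" "\<And>x. x \<notin> A \<Longrightarrow> f x = \<zero>\<^bsub>R\<^esub>" "cring R"
  shows "f \<in> carrier (free_mod R X)"
proof -
  interpret cring R by fact
  have "{x. f x \<noteq> \<zero>\<^bsub>R\<^esub>} \<subseteq> A" using assms(4) by blast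
  moreover have "f x \<in> carrier R" for x using assms(3,4) by (cases "x \<in> A") auto
  ultimately show ?thesis using assms(1,2) finite_subset[of "{x. f x \<noteq> \<zero>\<^bsub>R\<^esub>}" A]
    by (auto simp: free_mod_def)
qed

lemma free_mod_simps:
  "\<zero>\<^bsub>free_mod R X\<^esub> = (\<lambda>_. \<zero>\<^bsub>R\<^esub>)" "f \<oplus>\<^bsub>free_mod R X\<^esub> g = (\<lambda>x. f x \<oplus>\<^bsub>R\<^esub> g x)"
  "r \<odot>\<^bsub>free_mod R X\<^esub> f = (\<lambda>x. r \<otimes>\<^bsub>R\<^esub> f x)"
  by (simp_all add: free_mod_def)

lemma free_mod_mono:
  assumes "X \<subseteq> Y"
  shows "carrier (free_mod R X) \<subseteq> carrier (free_mod R Y)"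
  using assms by (auto simp: free_mod_def)

lemma free_mod_incl_hom:
  assumes "X \<subseteq> Y"
  shows "(\<lambda>c. c) \<in> mod_hom R (free_mod R X) (free_mod R Y)"
  using free_mod_mono[OF assms, of R] by (auto simp: mod_hom_def free_mod_simps)

lemma free_induct:
  assumes R: "cring R" and H: "submodule H R (free_mod R X)"
    and b: "\<And>x. x \<in> X \<Longrightarrow> basis_elt R x \<in> H" and c: "c \<in> carrier (free_mod R X)"
  shows "c \<in> H"
proof -
  interpret cring R by fact
  note F = free_mod_module[OF R] and S = submoduleD[OF free_mod_module[OF R] H]
  have *: "\<forall>c \<in> carrier (free_mod R X). {x. c x \<noteq> \<zero>\<^bsub>R\<^esub>} \<subseteq> A \<longrightarrow> c \<in> H"
    if "finite A" "A \<subseteq> X" for A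
    using that
  proof (induction A)
    case empty
    have "c \<in> H" if "{x. c x \<noteq> \<zero>\<^bsub>R\<^esub>} \<subseteq> {}" for c
    proof -
      have "c = \<zero>\<^bsub>free_mod R X\<^esub>" using that by (auto simp: free_mod_simps)
      thus ?thesis using S(2) by simp
    qed
    thus ?case by blast
  next
    case (insert a A)
    show ?case
    proof (intro ballI impI)
      fix c assume c: "c \<in> carrier (free_mod R X)" and s: "{x. c x \<noteq> \<zero>\<^bsub>R\<^esub>} \<subseteq> insert a A"
      let ?g = "c(a := \<zero>\<^bsub>R\<^esub>)"
      have "?g \<in> carrier (free_mod R X)"
        by (rule free_modI[where A = A]) (use insert s c free_modD(1)[OF c] R in auto)
      moreover have "{x. ?g x \<noteq> \<zero>\<^bsub>R\<^esub>} \<subseteq> A" using s by auto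
      ultimately have "?g \<in> H" using insert.IH insert.prems by blast
      moreover have "c a \<odot>\<^bsub>free_mod R X\<^esub> basis_elt R a \<in> H"
        using S(4) b insert.prems free_modD(1)[OF c] by simp
      ultimately have "?g \<oplus>\<^bsub>free_mod R X\<^esub> (c a \<odot>\<^bsub>free_mod R X\<^esub> basis_elt R a) \<in> H" using S(3) by blast
      moreover have "?g \<oplus>\<^bsub>free_mod R X\<^esub> (c a \<odot>\<^bsub>free_mod R X\<^esub> basis_elt R a) = c"
        using free_modD(1)[OF c] by (auto simp: free_mod_simps basis_elt_def)
      ultimately show "c \<in> H" by simp
    qed
  qed
  have "{x. c x \<noteq> \<zero>\<^bsub>R\<^esub>} \<subseteq> X" using free_modD(3)[OF c] by blast
  from bspec[OF *[OF free_modD(2)[OF c] this] c] show ?thesis by simp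
qed

lemma free_hom_ext:
  assumes "cring R" "module R N" "f \<in> mod_hom R (free_mod R X) N" "g \<in> mod_hom R (free_mod R X) N"
    and "\<And>x. x \<in> X \<Longrightarrow> f (basis_elt R x) = g (basis_elt R x)" "c \<in> carrier (free_mod R X)"
  shows "f c = g c"
proof -
  have "c \<in> {c \<in> carrier (free_mod R X). f c = g c}"
    by (rule free_induct[OF assms(1) equalizer_submodule[OF free_mod_module[OF assms(1)] assms(2-4)] _ assms(6)])
       (simp add: assms(5) basis_elt_closed[OF assms(1)])
  thus ?thesis by simp
qed

text \<open>Projectivity of free modules. All comparison maps with the canonical resolution come from here.\<close>

lemma free_lift:
  assumes R: "cring R" and F: "module R F" and N: "module R N"
    and f: "f \<in> mod_hom R (free_mod R X) N" and g: "g \<in> mod_hom R F N"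
    and im: "\<And>x. x \<in> X \<Longrightarrow> \<exists>y\<in>carrier F. g y = f (basis_elt R x)"
  obtains h where "h \<in> mod_hom R (free_mod R X) F"
    "\<And>c. c \<in> carrier (free_mod R X) \<Longrightarrow> g (h c) = f c"
proof -
  have "\<forall>x\<in>X. \<exists>y. y \<in> carrier F \<and> g y = f (basis_elt R x)" using im by blast
  from bchoice[OF this] obtain y where "\<forall>x\<in>X. y x \<in> carrier F \<and> g (y x) = f (basis_elt R x)" ..
  hence y: "y x \<in> carrier F" "g (y x) = f (basis_elt R x)" if "x \<in> X" for x using that by simp_all
  have h: "lin_ext R F y \<in> mod_hom R (free_mod R X) F"
    by (rule lin_ext_hom[OF R F]) (use y in auto)
  moreover have "g (lin_ext R F y c) = f c" if "c \<in> carrier (free_mod R X)" for c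
    by (rule free_hom_ext[OF R N mod_hom_comp[OF h g] f _ that]) (simp add: lin_ext_basis_elt[OF R F] y)
  ultimately show ?thesis by (rule that)
qed

section \<open>Submodules of tensor products\<close>

text \<open>The submodule \<open>S M\<close> of \<open>F \<otimes> M\<close> spanned by the \<open>c \<otimes> m\<close> with \<open>c \<in> S\<close>. Finite sums suffice, because a
  scalar can be absorbed by \<open>m\<close>. When \<open>S\<close> is a submodule, this is the image of \<open>S \<otimes> M\<close>, described
  without introducing \<open>S\<close> as a module of its own.\<close>

inductive_set tensor_part :: "('a, 'r) ring_scheme \<Rightarrow> ('a, 'f, 'x) module_scheme
    \<Rightarrow> ('a, 'm, 'y) module_scheme \<Rightarrow> 'f set \<Rightarrow> ('f \<times> 'm \<Rightarrow> 'a) set set"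
  for R F M S where
  zero: "\<zero>\<^bsub>tensor R F M\<^esub> \<in> tensor_part R F M S"
| add: "c \<in> S \<Longrightarrow> m \<in> carrier M \<Longrightarrow> t \<in> tensor_part R F M S \<Longrightarrow>
    pure_tensor R F M c m \<oplus>\<^bsub>tensor R F M\<^esub> t \<in> tensor_part R F M S"

lemma tensor_part_least:
  assumes "module R F" "module R M" "submodule H R (tensor R F M)"
    and "\<And>c m. c \<in> S \<Longrightarrow> m \<in> carrier M \<Longrightarrow> pure_tensor R F M c m \<in> H"
  shows "tensor_part R F M S \<subseteq> H"
proof
  note D = submoduleD[OF tensor_module[OF assms(1,2)] assms(3)]
  fix t assume "t \<in> tensor_part R F M S"
  thus "t \<in> H" by induction (auto intro: D assms(4))
qed

lemma tensor_part_submodule: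
  assumes F: "module R F" and M: "module R M" and S: "S \<subseteq> carrier F"
  shows "submodule (tensor_part R F M S) R (tensor R F M)"
proof -
  interpret M: module R M by fact
  interpret T: module R "tensor R F M" by (rule tensor_module[OF F M])
  note p = pure_tensor_closed[OF F M] and b = pure_tensor_bilinear[OF F M]
  have c: "t \<in> carrier (tensor R F M)" if "t \<in> tensor_part R F M S" for t
    using that by induction (use S in \<open>auto intro!: p\<close>)
  show ?thesis
  proof (rule submodule_criterion[OF tensor_module[OF F M]])
    show "tensor_part R F M S \<subseteq> carrier (tensor R F M)" using c by blast
    show "\<zero>\<^bsub>tensor R F M\<^esub> \<in> tensor_part R F M S" by (rule tensor_part.zero)
  next
    fix x y assume x: "x \<in> tensor_part R F M S" and y: "y \<in> tensor_part R F M S"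
    show "x \<oplus>\<^bsub>tensor R F M\<^esub> y \<in> tensor_part R F M S" using x
    proof induction
      case zero
      thus ?case using c[OF y] y by simp
    next
      case (add d m t)
      thus ?case using c[OF y] c[OF add(3)] p[of d m] S tensor_part.add[OF add(1,2,4)]
        by (auto simp: T.M.a_assoc)
    qed
  next
    fix r x assume r: "r \<in> carrier R" and x: "x \<in> tensor_part R F M S"
    show "r \<odot>\<^bsub>tensor R F M\<^esub> x \<in> tensor_part R F M S" using x
    proof induction
      case zero
      thus ?case using r tensor_part.zero by simp
    next
      case (add d m t)
      have d: "d \<in> carrier F" using add(1) S by blast
      have "r \<odot>\<^bsub>tensor R F M\<^esub> (pure_tensor R F M d m \<oplus>\<^bsub>tensor R F M\<^esub> t) =
        pure_tensor R F M d (r \<odot>\<^bsub>M\<^esub> m) \<oplus>\<^bsub>tensor R F M\<^esub> r \<odot>\<^bsub>tensor R F M\<^esub> t"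
        using r c[OF add(3)] p[OF d add(2)] by (simp add: T.smult_r_distr b(4) d add(2))
      thus ?case using tensor_part.add[OF add(1) M.smult_closed[OF r add(2)] add(4)] by simp
    qed
  qed
qed

lemma pure_in_tensor_part:
  assumes "module R F" "module R M" "S \<subseteq> carrier F" "c \<in> S" "m \<in> carrier M"
  shows "pure_tensor R F M c m \<in> tensor_part R F M S"
proof -
  interpret T: module R "tensor R F M" by (rule tensor_module[OF assms(1,2)])
  show ?thesis
    using tensor_part.add[OF assms(4,5) tensor_part.zero[of R F M S]] pure_tensor_closed[OF assms(1,2) _ assms(5), of c]
      assms(3,4) by auto
qed

lemma tensor_part_mono:
  assumes "S \<subseteq> S'"
  shows "tensor_part R F M S \<subseteq> tensor_part R F M S'"
proof
  fix t assume "t \<in> tensor_part R F M S"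
  thus "t \<in> tensor_part R F M S'" by induction (use assms in \<open>auto intro: tensor_part.intros\<close>)
qed

lemma tensor_part_carrier:
  assumes F: "module R F" and M: "module R M"
  shows "tensor_part R F M (carrier F) = carrier (tensor R F M)"
proof
  let ?A = "free_mod R (carrier F \<times> carrier M)" and ?T = "tensor R F M"
  let ?q = "\<lambda>x. tensor_null R F M +>\<^bsub>?A\<^esub> x"
  interpret M: module R M by fact
  note R = M.R.cring_axioms
  note sub = tensor_part_submodule[OF F M subset_refl]
  show "tensor_part R F M (carrier F) \<subseteq> carrier ?T"
    using submoduleD(1)[OF tensor_module[OF F M] sub] by blast
  have A: "module R ?A" by (rule free_mod_module[OF R])
  have q: "?q \<in> mod_hom R ?A ?T"
    unfolding tensor_def by (rule quot_proj_hom[OF A tensor_null_submodule[OF F M]])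
  show "carrier ?T \<subseteq> tensor_part R F M (carrier F)"
  proof
    fix t assume "t \<in> carrier ?T"
    then obtain x where x: "x \<in> carrier ?A" "t = ?q x"
      unfolding tensor_def quot_mod_simps(1)[OF A tensor_null_submodule[OF F M]] by blast
    have "x \<in> {x \<in> carrier ?A. ?q x \<in> tensor_part R F M (carrier F)}"
    proof (rule free_induct[OF R _ _ x(1)])
      show "submodule {x \<in> carrier ?A. ?q x \<in> tensor_part R F M (carrier F)} R ?A"
        by (rule vimage_submodule[OF A tensor_module[OF F M] q sub])
    next
      fix y assume "y \<in> carrier F \<times> carrier M"
      then obtain c m where y: "y = (c, m)" "c \<in> carrier F" "m \<in> carrier M" by blast
      show "basis_elt R y \<in> {x \<in> carrier ?A. ?q x \<in> tensor_part R F M (carrier F)}"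
        using pure_in_tensor_part[OF F M subset_refl y(2,3)] basis_elt_closed[OF R, of y] y
        by (simp add: pure_tensor_def)
    qed
    thus "t \<in> tensor_part R F M (carrier F)" using x by simp
  qed
qed

lemma tensor_induct:
  assumes "module R F" "module R M" "submodule H R (tensor R F M)"
    and "\<And>c m. c \<in> carrier F \<Longrightarrow> m \<in> carrier M \<Longrightarrow> pure_tensor R F M c m \<in> H"
    and "t \<in> carrier (tensor R F M)"
  shows "t \<in> H"
proof (rule subsetD[OF tensor_part_least[OF assms(1-3)]])
  show "t \<in> tensor_part R F M (carrier F)"
    using assms(5) unfolding tensor_part_carrier[OF assms(1,2)] .
qed (rule assms(4))

lemma tensor_hom_ext:
  assumes "module R F" "module R M" "module R N"
    "f \<in> mod_hom R (tensor R F M) N" "g \<in> mod_hom R (tensor R F M) N"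
    "\<And>c m. c \<in> carrier F \<Longrightarrow> m \<in> carrier M \<Longrightarrow> f (pure_tensor R F M c m) = g (pure_tensor R F M c m)"
    "t \<in> carrier (tensor R F M)"
  shows "f t = g t"
proof -
  have "t \<in> {t \<in> carrier (tensor R F M). f t = g t}"
    by (rule tensor_induct[OF assms(1,2) equalizer_submodule[OF tensor_module[OF assms(1,2)] assms(3-5)] _ assms(7)])
       (simp add: assms(6) pure_tensor_closed[OF assms(1,2)])
  thus ?thesis by simp
qed

lemma tensor_part_image:
  assumes F: "module R F" and M: "module R M" and G: "module R G" and h: "h \<in> mod_hom R F G"
    and S: "S \<subseteq> carrier F" "h ` S \<subseteq> S'" "S' \<subseteq> carrier G" and t: "t \<in> tensor_part R F M S"
  shows "tensor_map R G M h id t \<in> tensor_part R G M S'"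
proof -
  note hm = tensor_map_hom[OF F M G M h mod_hom_id]
  note vi = vimage_submodule[OF tensor_module[OF F M] tensor_module[OF G M] hm tensor_part_submodule[OF G M S(3)]]
  have "t \<in> {t \<in> carrier (tensor R F M). tensor_map R G M h id t \<in> tensor_part R G M S'}"
  proof (rule subsetD[OF tensor_part_least[OF F M vi] t])
    fix c m assume c: "c \<in> S" and m: "m \<in> carrier M"
    have c': "c \<in> carrier F" "h c \<in> S'" using c S by auto
    show "pure_tensor R F M c m \<in> {t \<in> carrier (tensor R F M). tensor_map R G M h id t \<in> tensor_part R G M S'}"
      using pure_in_tensor_part[OF G M S(3) c'(2) m] pure_tensor_closed[OF F M c'(1) m]
        tensor_map_pure[OF F M G M h mod_hom_id c'(1) m] by simp
  qed
  thus ?thesis by simp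
qed

lemma tensor_map_comp:
  assumes F: "module R F" and M: "module R M" and G: "module R G" and H: "module R H"
    and f: "f \<in> mod_hom R F G" and g: "g \<in> mod_hom R G H" and t: "t \<in> carrier (tensor R F M)"
  shows "tensor_map R H M g id (tensor_map R G M f id t) = tensor_map R H M (\<lambda>x. g (f x)) id t"
proof (rule tensor_hom_ext[OF F M tensor_module[OF H M] _ _ _ t])
  show "(\<lambda>t. tensor_map R H M g id (tensor_map R G M f id t)) \<in> mod_hom R (tensor R F M) (tensor R H M)"
    by (rule mod_hom_comp[OF tensor_map_hom[OF F M G M f mod_hom_id] tensor_map_hom[OF G M H M g mod_hom_id]])
  show "tensor_map R H M (\<lambda>x. g (f x)) id \<in> mod_hom R (tensor R F M) (tensor R H M)"
    by (rule tensor_map_hom[OF F M H M mod_hom_comp[OF f g] mod_hom_id])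
next
  fix c m assume "c \<in> carrier F" "m \<in> carrier M"
  thus "tensor_map R H M g id (tensor_map R G M f id (pure_tensor R F M c m)) =
      tensor_map R H M (\<lambda>x. g (f x)) id (pure_tensor R F M c m)"
    by (simp add: tensor_map_pure[OF F M G M f mod_hom_id] tensor_map_pure[OF G M H M g mod_hom_id]
        tensor_map_pure[OF F M H M mod_hom_comp[OF f g] mod_hom_id] mod_homD[OF f])
qed

lemma pure_tensor_zero:
  assumes F: "module R F" and M: "module R M" and m: "m \<in> carrier M"
  shows "pure_tensor R F M \<zero>\<^bsub>F\<^esub> m = \<zero>\<^bsub>tensor R F M\<^esub>"
proof -
  interpret F: module R F by fact
  interpret T: module R "tensor R F M" by (rule tensor_module[OF F M])
  show ?thesis
    using pure_tensor_bilinear(3)[OF F M F.R.zero_closed F.M.zero_closed m]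
    unfolding F.smult_l_null[OF F.M.zero_closed]
      T.smult_l_null[OF pure_tensor_closed[OF F M F.M.zero_closed m]] .
qed

section \<open>Submodules of finite free modules over noetherian rings\<close>

lemma eval_hom:
  assumes "cring R"
  shows "(\<lambda>c. c y) \<in> mod_hom R (free_mod R X) (regular_mod R)"
  by (rule mod_homI) (simp_all add: free_mod_simps regular_mod_def free_modD(1)[where X = X])

text \<open>The operations of \<open>free_mod R Y\<close> do not depend on \<open>Y\<close>. So submodules of free modules on different
  subsets of one type can be compared inside the free module on the whole type.\<close>

lemma submodule_free_UNIV:
  assumes "cring R"
  shows "submodule S R (free_mod R Y) \<longleftrightarrow>
    submodule S R (free_mod R UNIV) \<and> S \<subseteq> carrier (free_mod R Y)" (is "?L \<longleftrightarrow> ?R")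
proof
  note FY = free_mod_module[OF assms, of Y] and FU = free_mod_module[OF assms, of UNIV]
  { assume S: ?L
    note D = submoduleD[OF FY S, unfolded free_mod_simps]
    have sub: "S \<subseteq> carrier (free_mod R Y)" using D(1) by blast
    have "submodule S R (free_mod R UNIV)"
      by (rule submodule_criterion[OF FU])
         (use sub free_mod_mono[of Y UNIV R] D in \<open>auto simp: free_mod_simps\<close>)
    thus ?R using sub by simp }
  { assume S: ?R
    note D = submoduleD[OF FU conjunct1[OF S], unfolded free_mod_simps]
    show ?L
      by (rule submodule_criterion[OF FY]) (use S D in \<open>auto simp: free_mod_simps\<close>) }
qed

lemma regular_submodule_ideal:
  assumes "cring R" "submodule J R (regular_mod R)"
  shows "ideal J R"
proof -
  interpret cring R by fact
  note D = submoduleD[OF regular_mod_module[OF assms(1)] assms(2)]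
  have c: "x \<in> J \<Longrightarrow> x \<in> carrier R" for x using D(1)[of x] by (simp add: regular_mod_def)
  show ?thesis
  proof (rule idealI[OF ring_axioms])
    show "subgroup J (add_monoid R)"
      using submodule.axioms(1)[OF assms(2)]
      by (simp add: regular_mod_def subgroup_def m_inv_def)
  next
    fix a x assume a: "a \<in> J" and x: "x \<in> carrier R"
    show "x \<otimes>\<^bsub>R\<^esub> a \<in> J" using D(4)[OF x a] by (simp add: regular_mod_def)
    thus "a \<otimes>\<^bsub>R\<^esub> x \<in> J" using m_comm[OF c[OF a] x] by simp
  qed
qed

text \<open>Induction on the basis. The coefficients at a new basis element \<open>y\<close> of the members of \<open>S\<close> form an
  ideal. Lifts to \<open>S\<close> of finitely many generators of that ideal, together with generators of the part of
  \<open>S\<close> with vanishing coefficient at \<open>y\<close>, generate \<open>S\<close>. Generation is tested in the free module on the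
  whole type, so that the hypothesis for \<open>Y\<close> can be used for \<open>insert y Y\<close> as it stands.\<close>

lemma free_submodule_fg:
  assumes R: "cring R" and N: "noetherian_ring R" and "finite Y"
    and "submodule S R (free_mod R Y)"
  shows "\<exists>P. finite P \<and> P \<subseteq> S \<and> (\<forall>H. submodule H R (free_mod R UNIV) \<longrightarrow> P \<subseteq> H \<longrightarrow> S \<subseteq> H)"
  using assms(3,4)
proof (induction Y arbitrary: S)
  case empty
  have "S \<subseteq> H" if "submodule H R (free_mod R UNIV)" for H
  proof
    fix c assume "c \<in> S"
    hence "c \<in> carrier (free_mod R {})"
      using submoduleD(1)[OF free_mod_module[OF R] empty] by blast
    hence "c = \<zero>\<^bsub>free_mod R UNIV\<^esub>" by (auto simp: free_mod_def)
    thus "c \<in> H" using submoduleD(2)[OF free_mod_module[OF R] that] by simp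
  qed
  thus ?case by (intro exI[of _ "{}"]) simp
next
  case (insert y Y)
  let ?U = "free_mod R UNIV"
  interpret cring R by fact
  have U: "module R ?U" by (rule free_mod_module[OF R])
  interpret U: module R ?U by (rule U)
  have S: "submodule S R ?U" "S \<subseteq> carrier (free_mod R (insert y Y))"
    using insert.prems submodule_free_UNIV[OF R] by blast+
  note SD = submoduleD[OF U S(1)]
  have eJ: "ideal ((\<lambda>c. c y) ` H) R" if "submodule H R ?U" for H
    by (rule regular_submodule_ideal[OF R image_submodule[OF U regular_mod_module[OF R] eval_hom[OF R] that]])
  let ?S0 = "{c \<in> S. c y = \<zero>\<^bsub>R\<^esub>}"
  have "submodule ?S0 R (free_mod R Y)"
    by (rule submodule_criterion[OF free_mod_module[OF R]])
       (use SD S(2) in \<open>auto simp: free_mod_simps free_mod_def\<close>)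
  from insert.IH[OF this] obtain P0 where P0: "finite P0" "P0 \<subseteq> ?S0"
    "\<And>H. submodule H R ?U \<Longrightarrow> P0 \<subseteq> H \<Longrightarrow> ?S0 \<subseteq> H" by blast
  obtain A where A: "finite A" "A \<subseteq> carrier R" "(\<lambda>c. c y) ` S = Idl\<^bsub>R\<^esub> A"
    using noetherian_ring.finetely_gen[OF N eJ[OF S(1)]] by blast
  have "A \<subseteq> (\<lambda>c. c y) ` S" using genideal_self[OF A(2)] A(3) by simp
  then obtain P1 where P1: "finite P1" "P1 \<subseteq> S" "A = (\<lambda>c. c y) ` P1"
    using finite_subset_image[OF A(1)] by metis
  have "S \<subseteq> H" if H: "submodule H R ?U" and PH: "P0 \<union> P1 \<subseteq> H" for H
  proof
    fix c assume c: "c \<in> S"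
    have HS: "submodule (S \<inter> H) R ?U"
      by (rule submodule_criterion[OF U])
         (use SD submoduleD[OF U H] in auto)
    have "(\<lambda>c. c y) ` S \<subseteq> (\<lambda>c. c y) ` (S \<inter> H)"
      unfolding A(3) by (rule genideal_minimal[OF eJ[OF HS]]) (use P1 PH in blast)
    hence "c y \<in> (\<lambda>c. c y) ` (S \<inter> H)" by (rule subsetD) (rule imageI[OF c])
    then obtain d where "c y = d y" "d \<in> S \<inter> H" by (rule imageE)
    hence d: "d \<in> S" "d \<in> H" "d y = c y" by simp_all
    have cd: "c \<in> carrier ?U" "d \<in> carrier ?U" using c d(1) SD(1) by auto
    have "(c \<ominus>\<^bsub>?U\<^esub> d) y \<oplus>\<^bsub>R\<^esub> d y = ((c \<ominus>\<^bsub>?U\<^esub> d) \<oplus>\<^bsub>?U\<^esub> d) y" by (simp add: free_mod_simps)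
    also have "\<dots> = d y" unfolding minus_add_cancel(1)[OF U cd] d(3) ..
    finally have "(c \<ominus>\<^bsub>?U\<^esub> d) y = \<zero>\<^bsub>R\<^esub>"
      by (rule iffD1[OF add.r_cancel_one[OF free_modD(1)[OF cd(2)] free_modD(1)[OF U.M.minus_closed[OF cd]]]])
    hence "c \<ominus>\<^bsub>?U\<^esub> d \<in> ?S0" using SD(6)[OF c d(1)] by simp
    hence "c \<ominus>\<^bsub>?U\<^esub> d \<in> H" using P0(3)[OF H] PH by blast
    hence "(c \<ominus>\<^bsub>?U\<^esub> d) \<oplus>\<^bsub>?U\<^esub> d \<in> H" using submoduleD(3)[OF U H] d(2) by blast
    thus "c \<in> H" unfolding minus_add_cancel(1)[OF U cd] .
  qed
  thus ?case using P0 P1 by (intro exI[of _ "P0 \<union> P1"]) auto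
qed

text \<open>The generators themselves serve as the basis of a finite free module that covers \<open>S\<close>.\<close>

lemma free_submodule_image:
  assumes R: "cring R" and N: "noetherian_ring R" and Y: "finite Y"
    and S: "submodule S R (free_mod R Y)"
  obtains P where "finite P" "P \<subseteq> S"
    "lin_ext R (free_mod R Y) (\<lambda>c. c) \<in> mod_hom R (free_mod R P) (free_mod R Y)"
    "lin_ext R (free_mod R Y) (\<lambda>c. c) ` carrier (free_mod R P) = S"
proof -
  let ?e = "lin_ext R (free_mod R Y) (\<lambda>c. c)"
  note FY = free_mod_module[OF R, of Y]
  obtain P where P: "finite P" "P \<subseteq> S"
    "\<And>H. submodule H R (free_mod R UNIV) \<Longrightarrow> P \<subseteq> H \<Longrightarrow> S \<subseteq> H"
    using free_submodule_fg[OF assms] by blast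
  note FP = free_mod_module[OF R, of P]
  have c: "c \<in> carrier (free_mod R Y)" if "c \<in> P" for c
    using P(2) that submoduleD(1)[OF FY S] by blast
  have e: "?e \<in> mod_hom R (free_mod R P) (free_mod R Y)"
    by (rule lin_ext_hom[OF R FY]) (use c in auto)
  have b: "?e (basis_elt R c) = c" if "c \<in> P" for c
    by (rule lin_ext_basis_elt[OF R FY]) (use c that in auto)
  interpret P: module R "free_mod R P" by (rule FP)
  have im: "submodule (?e ` carrier (free_mod R P)) R (free_mod R Y)"
    by (rule image_submodule[OF FP FY e P.carrier_is_submodule])
  have "P \<subseteq> ?e ` carrier (free_mod R P)"
  proof
    fix c assume "c \<in> P"
    thus "c \<in> ?e ` carrier (free_mod R P)"
      using b[of c] basis_elt_closed[OF R, of c P] by (metis imageI)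
  qed
  hence 1: "S \<subseteq> ?e ` carrier (free_mod R P)"
    by (rule P(3)[OF conjunct1[OF submodule_free_UNIV[OF R, THEN iffD1, OF im]]])
  have "c \<in> {c \<in> carrier (free_mod R P). ?e c \<in> S}" if "c \<in> carrier (free_mod R P)" for c
    by (rule free_induct[OF R vimage_submodule[OF FP FY e S] _ that])
       (use b P(2) basis_elt_closed[OF R] in auto)
  hence "?e ` carrier (free_mod R P) \<subseteq> S" by blast
  thus ?thesis using that[OF P(1,2) e] 1 by blast
qed

lemma free_acc:
  assumes R: "cring R" and N: "noetherian_ring R" and Y: "finite Y"
    and S: "\<And>n. submodule (S n) R (free_mod R Y)" "\<And>n. S n \<subseteq> S (Suc n)"
  shows "\<exists>n. \<forall>m\<ge>n. S m = S n"
proof -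
  note FY = free_mod_module[OF R, of Y]
  note D = submoduleD[OF FY S(1)]
  have mono: "S m \<subseteq> S n" if "m \<le> n" for m n
    using that S(2) by (rule lift_Suc_mono_le[rotated])
  have "submodule (\<Union>n. S n) R (free_mod R Y)"
  proof (rule submodule_criterion[OF FY])
    show "(\<Union>n. S n) \<subseteq> carrier (free_mod R Y)" using D(1) by blast
    show "\<zero>\<^bsub>free_mod R Y\<^esub> \<in> (\<Union>n. S n)" using D(2) by blast
  next
    fix x y assume "x \<in> (\<Union>n. S n)" "y \<in> (\<Union>n. S n)"
    then obtain m n where "x \<in> S m" "y \<in> S n" by blast
    hence "x \<in> S (max m n)" "y \<in> S (max m n)" using mono[of m "max m n"] mono[of n "max m n"] by auto
    thus "x \<oplus>\<^bsub>free_mod R Y\<^esub> y \<in> (\<Union>n. S n)" using D(3) by blast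
  qed (use D(4) in blast)
  from free_submodule_fg[OF R N Y this] obtain P where P: "finite P" "P \<subseteq> (\<Union>n. S n)"
    "\<And>H. submodule H R (free_mod R UNIV) \<Longrightarrow> P \<subseteq> H \<Longrightarrow> (\<Union>n. S n) \<subseteq> H" by blast
  have "\<exists>n. P \<subseteq> S n" using P(1,2)
  proof (induction P)
    case (insert c P)
    then obtain n k where "P \<subseteq> S n" "c \<in> S k" by auto
    hence "insert c P \<subseteq> S (max n k)" using mono[of n "max n k"] mono[of k "max n k"] by auto
    thus ?case by blast
  qed simp
  then obtain n where "P \<subseteq> S n" by blast
  hence "(\<Union>n. S n) \<subseteq> S n"
    using P(3) submodule_free_UNIV[OF R] S(1) by blast
  hence "\<forall>m\<ge>n. S m = S n" using mono by blast
  thus ?thesis by blast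
qed

section \<open>The Artin-Rees property for finitely many elements\<close>

lemma smult_hom:
  assumes "module R M" "r \<in> carrier R"
  shows "(\<lambda>x. r \<odot>\<^bsub>M\<^esub> x) \<in> mod_hom R M M"
proof -
  interpret module R M by fact
  show ?thesis
    by (rule mod_homI) (use assms(2) in \<open>simp_all add: smult_r_distr smult_assoc1[symmetric] R.m_comm\<close>)
qed

text \<open>The submodules \<open>{v. r\<^sup>n v \<in> h(F) + Q}\<close> increase with \<open>n\<close>, hence are constant from some \<open>c\<close> on. If
  \<open>r\<^sup>c\<^sup>+\<^sup>k v\<close> lies in \<open>h(F) + Q\<close>, then already \<open>r\<^sup>c v\<close> does, and \<open>k\<close> factors \<open>r\<close> remain.\<close>

lemma artin_rees_principal:
  assumes F: "module R F" and V: "module R V" and h: "h \<in> mod_hom R F V" and Q: "submodule Q R V"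
    and acc: "\<And>S. (\<And>n. submodule (S n) R V) \<Longrightarrow> (\<And>n. S n \<subseteq> S (Suc n)) \<Longrightarrow> \<exists>n::nat. \<forall>m\<ge>n. S m = S n"
    and r: "r \<in> carrier R"
  shows "\<exists>l. \<forall>u\<in>carrier F. \<forall>v\<in>carrier V. \<forall>q\<in>Q. h u = (r [^]\<^bsub>R\<^esub> (l::nat)) \<odot>\<^bsub>V\<^esub> v \<oplus>\<^bsub>V\<^esub> q \<longrightarrow>
    (\<exists>f\<in>carrier F. \<exists>w\<in>carrier F. u = (r [^]\<^bsub>R\<^esub> (k::nat)) \<odot>\<^bsub>F\<^esub> f \<oplus>\<^bsub>F\<^esub> w \<and> h w \<in> Q)"
proof -
  interpret F: module R F by fact
  interpret V: module R V by fact
  note QD = submoduleD[OF V Q] and hD = mod_homD[OF h]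
  let ?p = "\<lambda>n::nat. r [^]\<^bsub>R\<^esub> n"
  have pc: "?p n \<in> carrier R" for n using r by simp
  define B where "B = {x \<oplus>\<^bsub>V\<^esub> y | x y. x \<in> h ` carrier F \<and> y \<in> Q}"
  have B: "submodule B R V"
    unfolding B_def by (rule sum_submodule[OF V image_submodule[OF F V h F.carrier_is_submodule] Q])
  define S where "S = (\<lambda>n. {v \<in> carrier V. ?p n \<odot>\<^bsub>V\<^esub> v \<in> B})"
  have S1: "submodule (S n) R V" for n
    unfolding S_def by (rule vimage_submodule[OF V V smult_hom[OF V pc] B])
  have S2: "S n \<subseteq> S (Suc n)" for n
  proof
    fix v assume v: "v \<in> S n"
    hence "r \<odot>\<^bsub>V\<^esub> (?p n \<odot>\<^bsub>V\<^esub> v) \<in> B" using submoduleD(4)[OF V B r] by (simp add: S_def)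
    moreover have "r \<odot>\<^bsub>V\<^esub> (?p n \<odot>\<^bsub>V\<^esub> v) = ?p (Suc n) \<odot>\<^bsub>V\<^esub> v"
      using v r by (simp add: S_def V.smult_assoc1[symmetric] F.R.m_comm)
    ultimately show "v \<in> S (Suc n)" using v by (simp add: S_def)
  qed
  obtain c where c: "\<forall>m\<ge>c. S m = S c" using acc[of S, OF S1 S2] by blast
  show ?thesis
  proof (intro exI[of _ "c + k"] ballI impI)
    fix u v q assume u: "u \<in> carrier F" and v: "v \<in> carrier V" and q: "q \<in> Q"
      and eq: "h u = ?p (c + k) \<odot>\<^bsub>V\<^esub> v \<oplus>\<^bsub>V\<^esub> q"
    have qc: "q \<in> carrier V" using QD(1) q by blast
    have vc: "?p (c + k) \<odot>\<^bsub>V\<^esub> v \<in> carrier V" using pc v by (rule V.smult_closed)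
    have "?p (c + k) \<odot>\<^bsub>V\<^esub> v = h u \<oplus>\<^bsub>V\<^esub> (\<ominus>\<^bsub>V\<^esub> q)"
      using vc qc by (simp add: eq V.M.a_assoc V.M.r_neg)
    moreover have "h u \<oplus>\<^bsub>V\<^esub> (\<ominus>\<^bsub>V\<^esub> q) \<in> B"
      unfolding B_def by (intro CollectI exI conjI) (rule refl, rule imageI[OF u], rule QD(5)[OF q])
    ultimately have "?p (c + k) \<odot>\<^bsub>V\<^esub> v \<in> B" by simp
    hence "v \<in> S (c + k)" using v by (simp add: S_def)
    hence "v \<in> S c" unfolding c[rule_format, OF le_add1] .
    hence "?p c \<odot>\<^bsub>V\<^esub> v \<in> B" by (simp add: S_def)
    then obtain f q1 where f: "f \<in> carrier F" and q1: "q1 \<in> Q" and fq: "?p c \<odot>\<^bsub>V\<^esub> v = h f \<oplus>\<^bsub>V\<^esub> q1"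
      unfolding B_def by blast
    have q1c: "q1 \<in> carrier V" using QD(1) q1 by blast
    have "?p (c + k) \<odot>\<^bsub>V\<^esub> v = ?p k \<odot>\<^bsub>V\<^esub> (?p c \<odot>\<^bsub>V\<^esub> v)"
      using r v by (simp add: V.smult_assoc1[symmetric] F.R.nat_pow_mult F.R.m_comm)
    also have "\<dots> = h (?p k \<odot>\<^bsub>F\<^esub> f) \<oplus>\<^bsub>V\<^esub> ?p k \<odot>\<^bsub>V\<^esub> q1"
      using pc hD f q1c by (simp add: fq V.smult_r_distr)
    finally have "h u = h (?p k \<odot>\<^bsub>F\<^esub> f) \<oplus>\<^bsub>V\<^esub> (?p k \<odot>\<^bsub>V\<^esub> q1 \<oplus>\<^bsub>V\<^esub> q)"
      using eq pc hD f q1c qc by (simp add: V.M.a_assoc)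
    moreover have qq: "?p k \<odot>\<^bsub>V\<^esub> q1 \<oplus>\<^bsub>V\<^esub> q \<in> Q" by (intro QD(3,4) pc q q1)
    ultimately have "h (u \<ominus>\<^bsub>F\<^esub> ?p k \<odot>\<^bsub>F\<^esub> f) = ?p k \<odot>\<^bsub>V\<^esub> q1 \<oplus>\<^bsub>V\<^esub> q"
      using u f pc hD QD(1)[OF qq] by (simp add: mod_hom_minus[OF F V h] minus_add_cancel(5)[OF V])
    hence "h (u \<ominus>\<^bsub>F\<^esub> ?p k \<odot>\<^bsub>F\<^esub> f) \<in> Q" using qq by simp
    moreover have "u = ?p k \<odot>\<^bsub>F\<^esub> f \<oplus>\<^bsub>F\<^esub> (u \<ominus>\<^bsub>F\<^esub> ?p k \<odot>\<^bsub>F\<^esub> f)"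
      using u f pc by (simp add: minus_add_cancel(2)[OF F])
    ultimately show "\<exists>f\<in>carrier F. \<exists>w\<in>carrier F. u = ?p k \<odot>\<^bsub>F\<^esub> f \<oplus>\<^bsub>F\<^esub> w \<and> h w \<in> Q"
      using f F.M.minus_closed[OF u F.smult_closed[OF pc f]] by (intro bexI conjI)
  qed
qed

text \<open>The submodule \<open>r\<^sub>1\<^sup>k F + \<dots> + r\<^sub>n\<^sup>k F\<close>. These submodules define the same topology as the powers of the
  ideal generated by the \<open>r\<^sub>i\<close>, but they allow induction on the list of generators.\<close>

primrec powers_part :: "('a, 'r) ring_scheme \<Rightarrow> ('a, 'm, 'x) module_scheme \<Rightarrow> 'a list \<Rightarrow> nat \<Rightarrow> 'm set"
where
  "powers_part R F [] k = {\<zero>\<^bsub>F\<^esub>}"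
| "powers_part R F (r # rs) k =
    {x \<oplus>\<^bsub>F\<^esub> y | x y. x \<in> (\<lambda>f. (r [^]\<^bsub>R\<^esub> k) \<odot>\<^bsub>F\<^esub> f) ` carrier F \<and> y \<in> powers_part R F rs k}"

lemma powers_part_submodule:
  assumes F: "module R F" and rs: "set rs \<subseteq> carrier R"
  shows "submodule (powers_part R F rs k) R F"
  using rs
proof (induction rs)
  case Nil
  show ?case using zero_submodule[OF F] by simp
next
  case (Cons r rs)
  interpret F: module R F by fact
  show ?case unfolding powers_part.simps
    by (rule sum_submodule[OF F image_submodule[OF F F smult_hom[OF F] F.carrier_is_submodule]])
       (use Cons in simp_all)
qed

lemma powers_part_antimono:
  assumes F: "module R F" and "set rs \<subseteq> carrier R" and kl: "k \<le> l"
  shows "powers_part R F rs l \<subseteq> powers_part R F rs k"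
  using assms(2)
proof (induction rs)
  case (Cons r rs)
  interpret F: module R F by fact
  have r: "r \<in> carrier R" using Cons by simp
  have "r [^]\<^bsub>R\<^esub> l \<odot>\<^bsub>F\<^esub> f = r [^]\<^bsub>R\<^esub> k \<odot>\<^bsub>F\<^esub> (r [^]\<^bsub>R\<^esub> (l - k) \<odot>\<^bsub>F\<^esub> f)" if "f \<in> carrier F" for f
    using r that kl by (simp add: F.smult_assoc1[symmetric] F.R.nat_pow_mult)
  hence "(\<lambda>f. r [^]\<^bsub>R\<^esub> l \<odot>\<^bsub>F\<^esub> f) ` carrier F \<subseteq> (\<lambda>f. r [^]\<^bsub>R\<^esub> k \<odot>\<^bsub>F\<^esub> f) ` carrier F"
    using r by auto
  moreover have "powers_part R F rs l \<subseteq> powers_part R F rs k" using Cons by simp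
  ultimately show ?case unfolding powers_part.simps by blast
qed simp

text \<open>Only the comparison of topologies is claimed, without the linear bound on \<open>l\<close> of the classical lemma.
  This weaker form follows from the case of one element by induction on the list. The submodule \<open>Q\<close>
  drives the induction: the first element is treated modulo \<open>Q\<close> and the contribution of the
  others, whose exponent has been fixed before.\<close>

lemma artin_rees_list:
  assumes F: "module R F" and V: "module R V" and h: "h \<in> mod_hom R F V" and Q: "submodule Q R V"
    and acc: "\<And>S. (\<And>n. submodule (S n) R V) \<Longrightarrow> (\<And>n. S n \<subseteq> S (Suc n)) \<Longrightarrow> \<exists>n::nat. \<forall>m\<ge>n. S m = S n"
    and rs: "set rs \<subseteq> carrier R"
  shows "\<exists>l. \<forall>u\<in>carrier F. \<forall>v\<in>powers_part R V rs l. \<forall>q\<in>Q. h u = v \<oplus>\<^bsub>V\<^esub> q \<longrightarrow>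
    (\<exists>f\<in>powers_part R F rs k. \<exists>w\<in>carrier F. u = f \<oplus>\<^bsub>F\<^esub> w \<and> h w \<in> Q)"
  using rs
proof (induction rs)
  case Nil
  interpret F: module R F by fact
  interpret V: module R V by fact
  show ?case using submoduleD(1)[OF V Q] by simp
next
  case (Cons r rs)
  interpret F: module R F by fact
  interpret V: module R V by fact
  have r: "r \<in> carrier R" and rs: "set rs \<subseteq> carrier R" using Cons.prems by simp_all
  have pc: "r [^]\<^bsub>R\<^esub> (n::nat) \<in> carrier R" for n using r by simp
  obtain l2 where l2: "\<And>u v q. u \<in> carrier F \<Longrightarrow> v \<in> powers_part R V rs l2 \<Longrightarrow> q \<in> Q \<Longrightarrow> h u = v \<oplus>\<^bsub>V\<^esub> q \<Longrightarrow>
    (\<exists>f\<in>powers_part R F rs k. \<exists>w\<in>carrier F. u = f \<oplus>\<^bsub>F\<^esub> w \<and> h w \<in> Q)"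
    using Cons.IH[OF rs] by blast
  let ?Q = "{x \<oplus>\<^bsub>V\<^esub> y | x y. x \<in> powers_part R V rs l2 \<and> y \<in> Q}"
  have Q': "submodule ?Q R V" by (rule sum_submodule[OF V powers_part_submodule[OF V rs] Q])
  from artin_rees_principal[OF F V h Q' acc r, of k]
  obtain l1 where l1: "\<forall>u\<in>carrier F. \<forall>v\<in>carrier V. \<forall>q\<in>?Q.
      h u = (r [^]\<^bsub>R\<^esub> (l1::nat)) \<odot>\<^bsub>V\<^esub> v \<oplus>\<^bsub>V\<^esub> q \<longrightarrow>
      (\<exists>f\<in>carrier F. \<exists>w\<in>carrier F. u = (r [^]\<^bsub>R\<^esub> k) \<odot>\<^bsub>F\<^esub> f \<oplus>\<^bsub>F\<^esub> w \<and> h w \<in> ?Q)" ..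
  show ?case
  proof (intro exI[of _ "l1 + l2"] ballI impI)
    fix u v q assume u: "u \<in> carrier F" and v: "v \<in> powers_part R V (r # rs) (l1 + l2)" and q: "q \<in> Q"
      and eq: "h u = v \<oplus>\<^bsub>V\<^esub> q"
    from v obtain v1 v2 where v1: "v1 \<in> carrier V" and v2: "v2 \<in> powers_part R V rs (l1 + l2)"
      and vv: "v = r [^]\<^bsub>R\<^esub> (l1 + l2) \<odot>\<^bsub>V\<^esub> v1 \<oplus>\<^bsub>V\<^esub> v2" by auto
    have v2': "v2 \<in> powers_part R V rs l2" using powers_part_antimono[OF V rs, of l2 "l1 + l2"] v2 by auto
    have v2c: "v2 \<in> carrier V" using submoduleD(1)[OF V powers_part_submodule[OF V rs] v2'] .
    have qc: "q \<in> carrier V" using submoduleD(1)[OF V Q q] .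
    have "h u = r [^]\<^bsub>R\<^esub> l1 \<odot>\<^bsub>V\<^esub> (r [^]\<^bsub>R\<^esub> l2 \<odot>\<^bsub>V\<^esub> v1) \<oplus>\<^bsub>V\<^esub> (v2 \<oplus>\<^bsub>V\<^esub> q)"
      using eq v1 v2c qc r unfolding vv
      by (simp add: V.smult_assoc1[symmetric] F.R.nat_pow_mult V.M.a_assoc)
    moreover have "v2 \<oplus>\<^bsub>V\<^esub> q \<in> ?Q" using v2' q by blast
    ultimately obtain f w where f: "f \<in> carrier F" and w: "w \<in> carrier F"
      and uf: "u = (r [^]\<^bsub>R\<^esub> k) \<odot>\<^bsub>F\<^esub> f \<oplus>\<^bsub>F\<^esub> w" and hw: "h w \<in> ?Q"
      using l1[rule_format, OF u V.smult_closed[OF pc v1]] by blast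
    from hw obtain v' q' where "v' \<in> powers_part R V rs l2" "q' \<in> Q" "h w = v' \<oplus>\<^bsub>V\<^esub> q'" by blast
    from l2[OF w this] obtain g x where g: "g \<in> powers_part R F rs k" and x: "x \<in> carrier F"
      and wg: "w = g \<oplus>\<^bsub>F\<^esub> x" and hx: "h x \<in> Q" by blast
    have gc: "g \<in> carrier F" using submoduleD(1)[OF F powers_part_submodule[OF F rs] g] .
    have "u = ((r [^]\<^bsub>R\<^esub> k) \<odot>\<^bsub>F\<^esub> f \<oplus>\<^bsub>F\<^esub> g) \<oplus>\<^bsub>F\<^esub> x"
      using f gc x pc unfolding uf wg by (simp add: F.M.a_assoc)
    moreover have "(r [^]\<^bsub>R\<^esub> k) \<odot>\<^bsub>F\<^esub> f \<oplus>\<^bsub>F\<^esub> g \<in> powers_part R F (r # rs) k"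
      unfolding powers_part.simps using f g by blast
    ultimately show "\<exists>f\<in>powers_part R F (r # rs) k. \<exists>w\<in>carrier F. u = f \<oplus>\<^bsub>F\<^esub> w \<and> h w \<in> Q"
      using x hx by blast
  qed
qed

section \<open>Powers of ideals\<close>

lemma ideal_power_simps:
  assumes "cring R" "ideal I R"
  shows "ideal_power R I 0 = carrier R"
    and "ideal_power R I (Suc k) = ideal_prod R (ideal_power R I k) I"
proof -
  interpret cring R by fact
  interpret S: comm_monoid "ideals_set R" by (rule ideals_set_is_comm_monoid)
  have I: "I \<in> carrier (ideals_set R)" using assms(2) by (simp add: ideals_set_def)
  show "ideal_power R I 0 = carrier R"
    unfolding ideal_power_def by simp (simp add: ideals_set_def)
  show "ideal_power R I (Suc k) = ideal_prod R (ideal_power R I k) I"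
    unfolding ideal_power_def by simp (simp add: ideals_set_def)
qed

lemma idealD:
  assumes "ideal J R"
  shows "x \<in> J \<Longrightarrow> x \<in> carrier R" "\<zero>\<^bsub>R\<^esub> \<in> J" "x \<in> J \<Longrightarrow> y \<in> J \<Longrightarrow> x \<oplus>\<^bsub>R\<^esub> y \<in> J"
    "r \<in> carrier R \<Longrightarrow> x \<in> J \<Longrightarrow> r \<otimes>\<^bsub>R\<^esub> x \<in> J" "r \<in> carrier R \<Longrightarrow> x \<in> J \<Longrightarrow> x \<otimes>\<^bsub>R\<^esub> r \<in> J"
  using ideal.Icarr[OF assms] additive_subgroup.zero_closed[OF ideal.axioms(1)[OF assms]]
    additive_subgroup.a_closed[OF ideal.axioms(1)[OF assms]] ideal.I_l_closed[OF assms]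
    ideal.I_r_closed[OF assms] by blast+

lemma ideal_power_antimono:
  assumes "cring R" "ideal I R" "k \<le> l"
  shows "ideal_power R I l \<subseteq> ideal_power R I k"
  using assms(3) by (rule lift_Suc_antimono_le[rotated]) (rule ideal_power_ideal(2)[OF assms(1,2)])

text \<open>A product of \<open>p + q\<close> sums \<open>u + v\<close> with \<open>u \<in> P\<close> and \<open>v \<in> Q\<close> expands into products which have at least \<open>p\<close>
  factors from \<open>P\<close> or at least \<open>q\<close> factors from \<open>Q\<close>. The induction splits off one factor.\<close>

lemma ideal_power_sum:
  assumes R: "cring R" and P: "ideal P R" and Q: "ideal Q R"
  shows "ideal_power R (P <+>\<^bsub>R\<^esub> Q) (p + q) \<subseteq> ideal_power R P p <+>\<^bsub>R\<^esub> ideal_power R Q q"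
proof (induction "p + q" arbitrary: p q)
  case 0
  interpret cring R by fact
  have "x \<in> carrier R <+>\<^bsub>R\<^esub> carrier R" if "x \<in> carrier R" for x
    unfolding set_add_def' using that r_zero[OF that] by fastforce
  thus ?case using 0 by (auto simp: ideal_power_simps[OF R] add_ideals P Q)
next
  case (Suc n)
  interpret cring R by fact
  note H = add_ideals[OF P Q]
  note iP = ideal_power_ideal(1)[OF R P] and iQ = ideal_power_ideal(1)[OF R Q]
  note iH = ideal_power_ideal(1)[OF R H]
  note iS = add_ideals[OF iP[of p] iQ[of q]]
  have add: "x \<oplus>\<^bsub>R\<^esub> y \<in> A <+>\<^bsub>R\<^esub> B" if "x \<in> A" "y \<in> B" for x y A B
    using that unfolding set_add_def' by blast
  consider "p = 0" | "q = 0" | p' q' where "p = Suc p'" "q = Suc q'" by (cases p; cases q) auto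
  thus ?case
  proof cases
    case 1
    have "x \<in> ideal_power R P p <+>\<^bsub>R\<^esub> ideal_power R Q q" if "x \<in> carrier R" for x
      using add[of x "ideal_power R P p" "\<zero>\<^bsub>R\<^esub>" "ideal_power R Q q"] idealD(2)[OF iQ] that
      by (simp add: 1 ideal_power_simps[OF R P])
    thus ?thesis using idealD(1)[OF iH] by blast
  next
    case 2
    have "x \<in> ideal_power R P p <+>\<^bsub>R\<^esub> ideal_power R Q q" if "x \<in> carrier R" for x
      using add[of "\<zero>\<^bsub>R\<^esub>" "ideal_power R P p" x "ideal_power R Q q"] idealD(2)[OF iP] that
      by (simp add: 2 ideal_power_simps[OF R Q])
    thus ?thesis using idealD(1)[OF iH] by blast
  next
    case 3
    have n: "n = p' + q" "n = p + q'" "p + q = Suc n" using Suc.hyps(2) 3 by simp_all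
    have ih1: "ideal_power R (P <+>\<^bsub>R\<^esub> Q) n \<subseteq> ideal_power R P p' <+>\<^bsub>R\<^esub> ideal_power R Q q"
      using Suc.hyps(1)[OF n(1)] n(1) by simp
    have ih2: "ideal_power R (P <+>\<^bsub>R\<^esub> Q) n \<subseteq> ideal_power R P p <+>\<^bsub>R\<^esub> ideal_power R Q q'"
      using Suc.hyps(1)[OF n(2)] n(2) by simp
    show ?thesis unfolding n(3) ideal_power_simps(2)[OF R H]
    proof
      fix x assume "x \<in> ideal_prod R (ideal_power R (P <+>\<^bsub>R\<^esub> Q) n) (P <+>\<^bsub>R\<^esub> Q)"
      thus "x \<in> ideal_power R P p <+>\<^bsub>R\<^esub> ideal_power R Q q"
      proof induction
        case (prod i j)
        from prod(2) obtain u v where uv: "u \<in> P" "v \<in> Q" "j = u \<oplus>\<^bsub>R\<^esub> v" unfolding set_add_def' by blast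
        have uvc: "u \<in> carrier R" "v \<in> carrier R" using uv idealD(1)[OF P] idealD(1)[OF Q] by blast+
        have ic: "i \<in> carrier R" using prod(1) idealD(1)[OF iH] by blast
        from prod(1) ih1 obtain a b where ab: "a \<in> ideal_power R P p'" "b \<in> ideal_power R Q q" "i = a \<oplus>\<^bsub>R\<^esub> b"
          unfolding set_add_def' by blast
        have abc: "a \<in> carrier R" "b \<in> carrier R" using ab idealD(1)[OF iP] idealD(1)[OF iQ] by blast+
        have "a \<otimes>\<^bsub>R\<^esub> u \<in> ideal_power R P p"
          unfolding 3 ideal_power_simps(2)[OF R P] by (rule ideal_prod.prod[OF ab(1) uv(1)])
        moreover have "b \<otimes>\<^bsub>R\<^esub> u \<in> ideal_power R Q q" by (rule idealD(5)[OF iQ uvc(1) ab(2)])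
        ultimately have iu: "i \<otimes>\<^bsub>R\<^esub> u \<in> ideal_power R P p <+>\<^bsub>R\<^esub> ideal_power R Q q"
          unfolding ab(3) using add uvc abc by (simp add: l_distr)
        from prod(1) ih2 obtain a' b' where ab': "a' \<in> ideal_power R P p" "b' \<in> ideal_power R Q q'" "i = a' \<oplus>\<^bsub>R\<^esub> b'"
          unfolding set_add_def' by blast
        have abc': "a' \<in> carrier R" "b' \<in> carrier R" using ab' idealD(1)[OF iP] idealD(1)[OF iQ] by blast+
        have "b' \<otimes>\<^bsub>R\<^esub> v \<in> ideal_power R Q q"
          unfolding 3 ideal_power_simps(2)[OF R Q] by (rule ideal_prod.prod[OF ab'(2) uv(2)])
        moreover have "a' \<otimes>\<^bsub>R\<^esub> v \<in> ideal_power R P p" by (rule idealD(5)[OF iP uvc(2) ab'(1)])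
        ultimately have iv: "i \<otimes>\<^bsub>R\<^esub> v \<in> ideal_power R P p <+>\<^bsub>R\<^esub> ideal_power R Q q"
          unfolding ab'(3) using add uvc abc' by (simp add: l_distr)
        show ?case using idealD(3)[OF iS iu iv] ic uvc by (simp add: uv(3) r_distr)
      next
        case (sum s t)
        thus ?case by (intro idealD(3)[OF iS])
      qed
    qed
  qed
qed

lemma ideal_power_mono:
  assumes R: "cring R" and P: "ideal P R" and Q: "ideal Q R" and "P \<subseteq> Q"
  shows "ideal_power R P k \<subseteq> ideal_power R Q k"
proof (induction k)
  case 0
  show ?case by (simp add: ideal_power_simps[OF R] P Q)
next
  case (Suc k)
  interpret cring R by fact
  note iQ = ideal_power_ideal(1)[OF R Q, of "Suc k"]
  show ?case
  proof
    fix x assume "x \<in> ideal_power R P (Suc k)"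
    hence "x \<in> ideal_prod R (ideal_power R P k) P" by (simp only: ideal_power_simps(2)[OF R P])
    thus "x \<in> ideal_power R Q (Suc k)"
    proof induction
      case (prod i j)
      thus ?case unfolding ideal_power_simps(2)[OF R Q] using Suc assms(4) by (blast intro: ideal_prod.prod)
    next
      case (sum s t)
      thus ?case by (intro idealD(3)[OF iQ])
    qed
  qed
qed

lemma pow_in_ideal_power:
  assumes R: "cring R" and I: "ideal I R" and r: "r \<in> I"
  shows "r [^]\<^bsub>R\<^esub> (k::nat) \<in> ideal_power R I k"
proof (induction k)
  case 0
  interpret cring R by fact
  show ?case by (simp add: ideal_power_simps[OF R I])
next
  case (Suc k)
  interpret cring R by fact
  show ?case unfolding ideal_power_simps(2)[OF R I] using ideal_prod.prod[OF Suc r] by simp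
qed

lemma principal_ideal_power:
  assumes R: "cring R" and r: "r \<in> carrier R" and J: "ideal J R" and rl: "r [^]\<^bsub>R\<^esub> (l::nat) \<in> J"
  shows "ideal_power R (PIdl\<^bsub>R\<^esub> r) l \<subseteq> J"
proof -
  interpret cring R by fact
  note P = cgenideal_ideal[OF r]
  have "ideal_power R (PIdl\<^bsub>R\<^esub> r) n \<subseteq> PIdl\<^bsub>R\<^esub> (r [^]\<^bsub>R\<^esub> n)" for n :: nat
  proof (induction n)
    case 0
    have "x \<in> PIdl\<^bsub>R\<^esub> \<one>\<^bsub>R\<^esub>" if "x \<in> carrier R" for x
      unfolding cgenideal_def using r_one[OF that] that by force
    thus ?case by (auto simp: ideal_power_simps[OF R P])
  next
    case (Suc n)
    note PS = cgenideal_ideal[of "r [^]\<^bsub>R\<^esub> Suc n"]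
    show ?case
    proof
      fix x assume "x \<in> ideal_power R (PIdl\<^bsub>R\<^esub> r) (Suc n)"
      hence "x \<in> ideal_prod R (ideal_power R (PIdl\<^bsub>R\<^esub> r) n) (PIdl\<^bsub>R\<^esub> r)"
        by (simp only: ideal_power_simps(2)[OF R P])
      thus "x \<in> PIdl\<^bsub>R\<^esub> (r [^]\<^bsub>R\<^esub> Suc n)"
      proof induction
        case (prod i j)
        then obtain a b where ab: "a \<in> carrier R" "b \<in> carrier R" "i = a \<otimes>\<^bsub>R\<^esub> r [^]\<^bsub>R\<^esub> n" "j = b \<otimes>\<^bsub>R\<^esub> r"
          using Suc unfolding cgenideal_def by blast
        hence "i \<otimes>\<^bsub>R\<^esub> j = (a \<otimes>\<^bsub>R\<^esub> b) \<otimes>\<^bsub>R\<^esub> r [^]\<^bsub>R\<^esub> Suc n" using r by (simp add: m_ac)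
        moreover have "a \<otimes>\<^bsub>R\<^esub> b \<in> carrier R" using ab by simp
        ultimately show ?case unfolding cgenideal_def by blast
      next
        case (sum s t)
        thus ?case using r by (intro idealD(3)[OF PS]) simp_all
      qed
    qed
  qed
  thus ?thesis using cgenideal_minimal[OF J rl] by blast
qed

lemma pow_smult_in_powers_part:
  assumes F: "module R F" and rs: "set rs \<subseteq> carrier R" "r \<in> set rs" and f: "f \<in> carrier F"
  shows "r [^]\<^bsub>R\<^esub> k \<odot>\<^bsub>F\<^esub> f \<in> powers_part R F rs k"
  using rs
proof (induction rs)
  case (Cons s rs)
  interpret F: module R F by fact
  have sub: "submodule (powers_part R F rs k) R F"
    using powers_part_submodule[OF F, of rs] Cons.prems by simp
  have s: "s \<in> carrier R" "r \<in> carrier R" using Cons.prems by auto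
  show ?case
  proof (cases "r = s")
    case True
    have "r [^]\<^bsub>R\<^esub> k \<odot>\<^bsub>F\<^esub> f = s [^]\<^bsub>R\<^esub> k \<odot>\<^bsub>F\<^esub> f \<oplus>\<^bsub>F\<^esub> \<zero>\<^bsub>F\<^esub>" using True s f by simp
    thus ?thesis unfolding powers_part.simps
      by (intro CollectI exI conjI) (assumption, rule imageI[OF f], rule submoduleD(2)[OF F sub])
  next
    case False
    hence *: "r [^]\<^bsub>R\<^esub> k \<odot>\<^bsub>F\<^esub> f \<in> powers_part R F rs k" using Cons by simp
    have "r [^]\<^bsub>R\<^esub> k \<odot>\<^bsub>F\<^esub> f = s [^]\<^bsub>R\<^esub> k \<odot>\<^bsub>F\<^esub> \<zero>\<^bsub>F\<^esub> \<oplus>\<^bsub>F\<^esub> r [^]\<^bsub>R\<^esub> k \<odot>\<^bsub>F\<^esub> f" using s f by simp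
    thus ?thesis unfolding powers_part.simps
      by (intro CollectI exI conjI) (assumption, rule imageI[OF F.M.zero_closed], rule *)
  qed
qed simp

text \<open>Adding one generator at a time, \<open>ideal_power_sum\<close> bounds a power of the ideal by powers of
  the single generators.\<close>

lemma ideal_power_subset_of_generators:
  assumes R: "cring R" and J: "ideal J R" and A: "finite A" "A \<subseteq> carrier R"
    and pow: "\<And>r. r \<in> A \<Longrightarrow> \<exists>l::nat. r [^]\<^bsub>R\<^esub> l \<in> J"
  shows "\<exists>L. ideal_power R (Idl\<^bsub>R\<^esub> A) L \<subseteq> J"
  using A pow
proof (induction A)
  case empty
  interpret cring R by fact
  have "Idl\<^bsub>R\<^esub> {} \<subseteq> J" by (rule genideal_minimal[OF J]) simp
  moreover have "ideal_power R (Idl\<^bsub>R\<^esub> {}) 1 \<subseteq> Idl\<^bsub>R\<^esub> {}"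
    using ideal_prod_inter[OF ideal_power_ideal(1)[OF R genideal_ideal] genideal_ideal, of "{}" "{}" 0]
    by (simp add: ideal_power_simps[OF R genideal_ideal])
  ultimately show ?case by blast
next
  case (insert r A)
  interpret cring R by fact
  have r: "r \<in> carrier R" and A: "A \<subseteq> carrier R" using insert.prems by simp_all
  note IA = genideal_ideal[OF A] and Ir = cgenideal_ideal[OF r]
  obtain L where L: "ideal_power R (Idl\<^bsub>R\<^esub> A) L \<subseteq> J" using insert by blast
  obtain l where l: "r [^]\<^bsub>R\<^esub> (l::nat) \<in> J" using insert.prems by blast
  let ?K = "Idl\<^bsub>R\<^esub> A <+>\<^bsub>R\<^esub> PIdl\<^bsub>R\<^esub> r"
  have K: "ideal ?K R" by (rule add_ideals[OF IA Ir])
  have "insert r A \<subseteq> ?K"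
    unfolding union_genideal[OF IA Ir, symmetric]
    using genideal_self[of "Idl\<^bsub>R\<^esub> A \<union> PIdl\<^bsub>R\<^esub> r"] genideal_self[OF A] cgenideal_self[OF r]
      idealD(1)[OF IA] idealD(1)[OF Ir] by blast
  hence "Idl\<^bsub>R\<^esub> (insert r A) \<subseteq> ?K" by (rule genideal_minimal[OF K])
  hence "ideal_power R (Idl\<^bsub>R\<^esub> (insert r A)) (L + l) \<subseteq> ideal_power R ?K (L + l)"
    by (intro ideal_power_mono[OF R _ K] genideal_ideal) (use r A in simp_all)
  also have "\<dots> \<subseteq> ideal_power R (Idl\<^bsub>R\<^esub> A) L <+>\<^bsub>R\<^esub> ideal_power R (PIdl\<^bsub>R\<^esub> r) l"
    by (rule ideal_power_sum[OF R IA Ir])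
  also have "\<dots> \<subseteq> J"
    using L principal_ideal_power[OF R r J l] idealD(3)[OF J] unfolding set_add_def' by blast
  finally show ?case by blast
qed

text \<open>For an ideal \<open>J\<close> this is the submodule \<open>J R\<^sup>X\<close> of the free module \<open>R\<^sup>X\<close>.\<close>

definition coord_part :: "('a, 'r) ring_scheme \<Rightarrow> 'a set \<Rightarrow> 'x set \<Rightarrow> ('x \<Rightarrow> 'a) set" where
  "coord_part R J X = {c \<in> carrier (free_mod R X). \<forall>x. c x \<in> J}"

lemma coord_part_submodule:
  assumes "cring R" "ideal J R"
  shows "submodule (coord_part R J X) R (free_mod R X)"
proof -
  interpret F: module R "free_mod R X" by (rule free_mod_module[OF assms(1)])
  note D = idealD[OF assms(2)]
  show ?thesis
  proof (rule submodule_criterion[OF free_mod_module[OF assms(1)]])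
    show "coord_part R J X \<subseteq> carrier (free_mod R X)" unfolding coord_part_def by blast
    show "\<zero>\<^bsub>free_mod R X\<^esub> \<in> coord_part R J X"
      using F.M.zero_closed D(2) unfolding coord_part_def by (simp add: free_mod_simps)
  next
    fix c d assume "c \<in> coord_part R J X" "d \<in> coord_part R J X"
    thus "c \<oplus>\<^bsub>free_mod R X\<^esub> d \<in> coord_part R J X"
      using F.M.a_closed[of c d] D(3) unfolding coord_part_def by (simp add: free_mod_simps)
  next
    fix r c assume "r \<in> carrier R" "c \<in> coord_part R J X"
    thus "r \<odot>\<^bsub>free_mod R X\<^esub> c \<in> coord_part R J X"
      using F.smult_closed[of r c] D(4) unfolding coord_part_def by (simp add: free_mod_simps)
  qed
qed

lemma powers_part_free_subset:
  assumes R: "cring R" and I: "ideal I R" and rs: "set rs \<subseteq> I"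
  shows "powers_part R (free_mod R X) rs k \<subseteq> coord_part R (ideal_power R I k) X"
  using rs
proof (induction rs)
  case Nil
  show ?case
    using submoduleD(2)[OF free_mod_module[OF R] coord_part_submodule[OF R ideal_power_ideal(1)[OF R I]]]
    by simp
next
  case (Cons r rs)
  interpret F: module R "free_mod R X" by (rule free_mod_module[OF R])
  note J = ideal_power_ideal(1)[OF R I, of k]
  note D = submoduleD[OF free_mod_module[OF R] coord_part_submodule[OF R J, of X]]
  have r: "r [^]\<^bsub>R\<^esub> k \<in> ideal_power R I k" using pow_in_ideal_power[OF R I] Cons.prems by simp
  have "r [^]\<^bsub>R\<^esub> k \<odot>\<^bsub>free_mod R X\<^esub> f \<in> coord_part R (ideal_power R I k) X" if f: "f \<in> carrier (free_mod R X)" for f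
    using F.smult_closed[OF idealD(1)[OF J r] f] idealD(5)[OF J free_modD(1)[OF f] r]
    unfolding coord_part_def by (simp add: free_mod_simps)
  moreover have "powers_part R (free_mod R X) rs k \<subseteq> coord_part R (ideal_power R I k) X" using Cons by simp
  ultimately show ?case unfolding powers_part.simps using D(3) by blast
qed

lemma coord_part_subset_powers_part:
  assumes R: "cring R" and rs: "set rs \<subseteq> carrier R"
  shows "coord_part R (powers_part R (regular_mod R) rs k) X \<subseteq> powers_part R (free_mod R X) rs k"
  using rs
proof (induction rs)
  case Nil
  show ?case by (auto simp: coord_part_def free_mod_simps regular_mod_def)
next
  case (Cons r rs)
  interpret cring R by fact
  let ?J = "powers_part R (regular_mod R) rs k"
  have r: "r \<in> carrier R" and rs: "set rs \<subseteq> carrier R" using Cons.prems by simp_all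
  have J: "ideal ?J R"
    by (rule regular_submodule_ideal[OF R powers_part_submodule[OF regular_mod_module[OF R] rs]])
  show ?case
  proof
    fix c assume c: "c \<in> coord_part R (powers_part R (regular_mod R) (r # rs) k) X"
    hence cc: "c \<in> carrier (free_mod R X)" unfolding coord_part_def by blast
    have "\<forall>x. \<exists>t g. t \<in> carrier R \<and> g \<in> ?J \<and> c x = r [^]\<^bsub>R\<^esub> k \<otimes>\<^bsub>R\<^esub> t \<oplus>\<^bsub>R\<^esub> g"
      using c unfolding coord_part_def by (auto simp: regular_mod_def)
    then obtain t g where tg: "\<And>x. t x \<in> carrier R" "\<And>x. g x \<in> ?J"
      "\<And>x. c x = r [^]\<^bsub>R\<^esub> k \<otimes>\<^bsub>R\<^esub> t x \<oplus>\<^bsub>R\<^esub> g x" by metis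
    let ?z = "\<lambda>f x. if c x = \<zero>\<^bsub>R\<^esub> then \<zero>\<^bsub>R\<^esub> else f x"
    have fin: "?z f \<in> carrier (free_mod R X)" if "\<And>x. f x \<in> carrier R" for f
      by (rule free_modI[where A = "{x. c x \<noteq> \<zero>\<^bsub>R\<^esub>}"])
         (use free_modD(2)[OF cc] free_modD(3)[OF cc] that R in auto)
    have gc: "g x \<in> carrier R" for x by (rule idealD(1)[OF J tg(2)])
    have "?z g \<in> coord_part R ?J X"
      using fin[of g, OF gc] tg(2) idealD(2)[OF J] unfolding coord_part_def by simp
    hence "?z g \<in> powers_part R (free_mod R X) rs k" using Cons.IH[OF rs] by blast
    moreover have "?z t \<in> carrier (free_mod R X)" by (rule fin[of t, OF tg(1)])
    moreover have "c = r [^]\<^bsub>R\<^esub> k \<odot>\<^bsub>free_mod R X\<^esub> ?z t \<oplus>\<^bsub>free_mod R X\<^esub> ?z g"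
      using tg(3) r by (auto simp: free_mod_simps fun_eq_iff)
    ultimately show "c \<in> powers_part R (free_mod R X) (r # rs) k"
      unfolding powers_part.simps by (intro CollectI exI conjI) (assumption, rule imageI)
  qed
qed

section \<open>The Artin-Rees property of ideals\<close>

text \<open>The \<open>I\<close>-adic topology of \<open>R\<^sup>Y\<close> induces on the image of \<open>h\<close> the quotient topology from \<open>R\<^sup>X\<close>. Both
  sides are translated to powers of finitely many generators of \<open>I\<close>.\<close>

theorem artin_rees:
  assumes R: "cring R" and N: "noetherian_ring R" and I: "ideal I R" and Y: "finite Y"
    and h: "h \<in> mod_hom R (free_mod R X) (free_mod R Y)"
  shows "\<exists>l. \<forall>u\<in>carrier (free_mod R X). h u \<in> coord_part R (ideal_power R I l) Y \<longrightarrow>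
    (\<exists>f\<in>coord_part R (ideal_power R I k) X. \<exists>w\<in>carrier (free_mod R X).
      u = f \<oplus>\<^bsub>free_mod R X\<^esub> w \<and> h w = \<zero>\<^bsub>free_mod R Y\<^esub>)"
proof -
  interpret cring R by fact
  note FX = free_mod_module[OF R, of X] and FY = free_mod_module[OF R, of Y]
  interpret FY: module R "free_mod R Y" by (rule FY)
  obtain A where A: "A \<subseteq> carrier R" "finite A" "I = Idl\<^bsub>R\<^esub> A"
    using noetherian_ring.finetely_gen[OF N I] by blast
  obtain rs where rs: "set rs = A" using finite_list[OF A(2)] by blast
  have rs': "set rs \<subseteq> I" "set rs \<subseteq> carrier R" using rs A genideal_self[OF A(1)] by auto
  from artin_rees_list[OF FX FY h zero_submodule[OF FY] _ rs'(2), of k]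
  obtain l where l: "\<forall>u\<in>carrier (free_mod R X). \<forall>v\<in>powers_part R (free_mod R Y) rs l.
      \<forall>q\<in>{\<zero>\<^bsub>free_mod R Y\<^esub>}. h u = v \<oplus>\<^bsub>free_mod R Y\<^esub> q \<longrightarrow>
      (\<exists>f\<in>powers_part R (free_mod R X) rs k. \<exists>w\<in>carrier (free_mod R X).
        u = f \<oplus>\<^bsub>free_mod R X\<^esub> w \<and> h w \<in> {\<zero>\<^bsub>free_mod R Y\<^esub>})"
    using free_acc[OF R N Y] by blast
  let ?J = "powers_part R (regular_mod R) rs l"
  have J: "ideal ?J R"
    by (rule regular_submodule_ideal[OF R powers_part_submodule[OF regular_mod_module[OF R] rs'(2)]])
  have "r [^]\<^bsub>R\<^esub> l \<in> ?J" if "r \<in> set rs" for r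
    using pow_smult_in_powers_part[OF regular_mod_module[OF R] rs'(2) that, of "\<one>\<^bsub>R\<^esub>" l] rs'(2) that
    by (auto simp: regular_mod_def)
  hence "\<exists>L. ideal_power R (Idl\<^bsub>R\<^esub> A) L \<subseteq> ?J"
    using rs by (intro ideal_power_subset_of_generators[OF R J A(2,1)]) blast
  then obtain L where L: "ideal_power R I L \<subseteq> ?J" unfolding A(3) by blast
  show ?thesis
  proof (intro exI[of _ L] ballI impI)
    fix u assume u: "u \<in> carrier (free_mod R X)" and hu: "h u \<in> coord_part R (ideal_power R I L) Y"
    hence "h u \<in> coord_part R ?J Y" using L unfolding coord_part_def by blast
    hence hl: "h u \<in> powers_part R (free_mod R Y) rs l"
      using coord_part_subset_powers_part[OF R rs'(2)] by blast
    have "h u = h u \<oplus>\<^bsub>free_mod R Y\<^esub> \<zero>\<^bsub>free_mod R Y\<^esub>" using mod_homD(1)[OF h u] by simp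
    from l[rule_format, OF u hl singletonI this]
    obtain f w where "f \<in> powers_part R (free_mod R X) rs k" "w \<in> carrier (free_mod R X)"
      "u = f \<oplus>\<^bsub>free_mod R X\<^esub> w" "h w = \<zero>\<^bsub>free_mod R Y\<^esub>" by blast
    thus "\<exists>f\<in>coord_part R (ideal_power R I k) X. \<exists>w\<in>carrier (free_mod R X).
      u = f \<oplus>\<^bsub>free_mod R X\<^esub> w \<and> h w = \<zero>\<^bsub>free_mod R Y\<^esub>"
      using powers_part_free_subset[OF R I rs'(1), of X k] by blast
  qed
qed

section \<open>Vanishing of Tor in terms of free modules\<close>

lemma mod_hom_diff:
  assumes "module R N" "f \<in> mod_hom R K N" "g \<in> mod_hom R K N"
  shows "(\<lambda>x. f x \<ominus>\<^bsub>N\<^esub> g x) \<in> mod_hom R K N"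
proof -
  interpret N: module R N by fact
  show ?thesis
    by (rule mod_homI)
       (simp_all add: mod_homD[OF assms(2)] mod_homD[OF assms(3)] N.M.a_ac N.smult_r_distr
         a_minus_def N.M.minus_add N.smult_r_minus)
qed

lemma tor_one_exact:
  assumes N: "module R N" and M: "module R M"
    and van: "carrier (Tor R 1 N M) = {\<zero>\<^bsub>Tor R 1 N M\<^esub>}"
    and z: "z \<in> carrier (tor_chain R N M (Suc 0))" "tor_diff R N M 0 z = \<zero>\<^bsub>tor_chain R N M 0\<^esub>"
  shows "\<exists>t\<in>carrier (tor_chain R N M (Suc (Suc 0))). z = tor_diff R N M (Suc 0) t"
proof -
  interpret N: module R N by fact
  have C: "module R (tor_chain R N M n)" for n
    unfolding tor_chain_def by (intro tensor_module res_mod_module N.R.cring_axioms M)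
  interpret C1: module R "tor_chain R N M (Suc 0)" by (rule C)
  let ?B = "tor_boundaries R N M (Suc 0)"
  have B0: "\<zero>\<^bsub>tor_chain R N M (Suc 0)\<^esub> \<in> ?B"
    unfolding tor_boundaries_def
    using mod_hom_zero[OF C C tor_diff_hom[OF N M]] abelian_monoid.zero_closed[OF abelian_group.axioms(1)[OF module.axioms(2)[OF C]]]
    by (metis imageI)
  let ?C = "(tor_chain R N M (Suc 0))\<lparr>carrier := tor_cycles R N M (Suc 0)\<rparr>"
  have "z \<in> tor_cycles R N M (Suc 0)" using z by (simp add: a_kernel_def')
  hence "?B +>\<^bsub>?C\<^esub> z \<in> carrier (Tor R 1 N M)"
    unfolding Tor_def quot_mod_def by (auto simp: A_RCOSETS_def')
  hence "?B +>\<^bsub>?C\<^esub> z = ?B" using van by (simp add: Tor_def quot_mod_def)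
  moreover have "\<zero>\<^bsub>tor_chain R N M (Suc 0)\<^esub> \<oplus>\<^bsub>?C\<^esub> z \<in> ?B +>\<^bsub>?C\<^esub> z"
    unfolding a_r_coset_def' using B0 by blast
  ultimately have "z \<in> ?B" using z(1) by simp
  thus ?thesis unfolding tor_boundaries_def by blast
qed

text \<open>This is the form in which vanishing of \<open>Tor\<^sub>1\<close> is used. Put \<open>G = R\<^sup>Y\<close> and \<open>U = ker p\<close>, so that
  \<open>N = G / (h(F) + U)\<close>: a relation with coefficients in \<open>M\<close> between elements of \<open>G / U\<close> comes from relations
  with coefficients in \<open>R\<close>. The proof compares \<open>F \<rightarrow> G \<rightarrow> N\<close> with the canonical resolution
  \<open>F\<^sub>2 \<rightarrow> F\<^sub>1 \<rightarrow> F\<^sub>0 \<rightarrow> N\<close>. There are lifts of the identity of \<open>N\<close> in both directions, \<open>a0 : G \<rightarrow> F\<^sub>0\<close> and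
  \<open>b0 : F\<^sub>0 \<rightarrow> G\<close>, and \<open>b1 : F\<^sub>1 \<rightarrow> F\<close> is compatible with \<open>b0\<close> modulo \<open>U\<close>. The difference \<open>e = b0 \<circ> a0 - 1\<close> factors
  modulo \<open>U\<close> through a homotopy \<open>k : G \<rightarrow> F\<close>. Transporting \<open>t\<close> to \<open>F\<^sub>1 \<otimes> M\<close>, where cycles are boundaries, and
  back returns \<open>t\<close> up to members of \<open>(ker (p \<circ> h)) M\<close>.\<close>

lemma tensor_kernel_of_tor_vanishing:
  assumes F: "module R F" and M: "module R M" and Q: "module R Q" and N: "module R N"
    and p: "p \<in> mod_hom R (free_mod R Y) Q" and h: "h \<in> mod_hom R F (free_mod R Y)"
    and q: "q \<in> mod_hom R (free_mod R Y) N" and surj: "q ` carrier (free_mod R Y) = carrier N"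
    and ker: "\<And>g. g \<in> carrier (free_mod R Y) \<Longrightarrow> q g = \<zero>\<^bsub>N\<^esub> \<longleftrightarrow> (\<exists>x\<in>carrier F. p g = p (h x))"
    and van: "carrier (Tor R 1 N M) = {\<zero>\<^bsub>Tor R 1 N M\<^esub>}"
    and t: "t \<in> carrier (tensor R F M)"
    and ht: "tensor_map R (free_mod R Y) M h id t \<in>
      tensor_part R (free_mod R Y) M {g \<in> carrier (free_mod R Y). p g = \<zero>\<^bsub>Q\<^esub>}"
  shows "t \<in> tensor_part R F M {x \<in> carrier F. p (h x) = \<zero>\<^bsub>Q\<^esub>}"
proof -
  interpret F: module R F by fact
  interpret Q: module R Q by fact
  interpret N: module R N by fact
  note R = F.R.cring_axioms
  let ?G = "free_mod R Y" and ?F0 = "res_mod R N 0" and ?F1 = "res_mod R N (Suc 0)"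
    and ?F2 = "res_mod R N (Suc (Suc 0))" and ?d1 = "res_diff R N 0" and ?d2 = "res_diff R N (Suc 0)"
    and ?aug = "res_aug R N"
  have G: "module R ?G" by (rule free_mod_module[OF R])
  have Fn: "module R (res_mod R N n)" for n by (rule res_mod_module[OF R])
  interpret G: module R ?G by (rule G)
  note d1 = res_diff_hom[OF N, of 0] and d2 = res_diff_hom[OF N, of "Suc 0"] and aug = res_aug_hom[OF N]
  note pD = mod_homD[OF p] and hD = mod_homD[OF h] and qD = mod_homD[OF q]
  have aug_d1: "?aug (?d1 b) = \<zero>\<^bsub>N\<^esub>" if "b \<in> carrier ?F1" for b
    using imageI[OF that, of ?d1] unfolding res_exact_0[OF N] a_kernel_def' by simp
  have d1_d2: "?d1 (?d2 b) = \<zero>\<^bsub>?F0\<^esub>" if "b \<in> carrier ?F2" for b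
    using imageI[OF that, of ?d2] unfolding res_exact_Suc[OF N] a_kernel_def' by simp
  obtain a0 where a0: "a0 \<in> mod_hom R ?G ?F0"
    and aug_a0: "\<And>g. g \<in> carrier ?G \<Longrightarrow> ?aug (a0 g) = q g"
  proof (rule free_lift[OF R Fn[of 0] N q aug])
    fix y assume "y \<in> Y"
    hence "q (basis_elt R y) \<in> ?aug ` carrier ?F0"
      unfolding res_aug_surj[OF N] by (intro qD(1) basis_elt_closed[OF R])
    thus "\<exists>c\<in>carrier ?F0. ?aug c = q (basis_elt R y)" by (elim imageE) auto
  qed (rule that)
  obtain b0 where b0: "b0 \<in> mod_hom R ?F0 ?G"
    and q_b0: "\<And>c. c \<in> carrier ?F0 \<Longrightarrow> q (b0 c) = ?aug c"
  proof (rule free_lift[OF R G N aug[unfolded res_mod_def] q, folded res_mod_def])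
    fix s assume "s \<in> res_basis R N 0"
    hence "?aug (basis_elt R s) \<in> q ` carrier ?G"
      unfolding surj using basis_elt_closed[OF R, of s "res_basis R N 0"]
      by (intro mod_homD(1)[OF aug]) (simp add: res_mod_def)
    thus "\<exists>c\<in>carrier ?G. q c = ?aug (basis_elt R s)" by (elim imageE) auto
  qed (rule that)
  note a0D = mod_homD[OF a0] and b0D = mod_homD[OF b0]
  define e where "e = (\<lambda>g. b0 (a0 g) \<ominus>\<^bsub>?G\<^esub> g)"
  have e: "e \<in> mod_hom R ?G ?G"
    unfolding e_def by (rule mod_hom_diff[OF G mod_hom_comp[OF a0 b0]]) (simp add: mod_hom_def)
  have q_e: "q (e g) = \<zero>\<^bsub>N\<^esub>" if g: "g \<in> carrier ?G" for g
    unfolding e_def using mod_hom_minus[OF G N q b0D(1)[OF a0D(1)[OF g]] g]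
    by (simp add: q_b0 aug_a0 a0D g qD a_minus_def N.M.r_neg)
  obtain k where k: "k \<in> mod_hom R ?G F" and pk: "\<And>g. g \<in> carrier ?G \<Longrightarrow> p (h (k g)) = p (e g)"
  proof (rule free_lift[OF R F Q mod_hom_comp[OF e p] mod_hom_comp[OF h p]])
    fix y assume "y \<in> Y"
    hence y: "basis_elt R y \<in> carrier ?G" by (rule basis_elt_closed[OF R])
    show "\<exists>x\<in>carrier F. p (h x) = p (e (basis_elt R y))"
      using iffD1[OF ker[OF mod_homD(1)[OF e y]] q_e[OF y]] by (elim bexE) auto
  qed (rule that)
  obtain b1 where b1: "b1 \<in> mod_hom R ?F1 F"
    and pb1: "\<And>c. c \<in> carrier ?F1 \<Longrightarrow> p (h (b1 c)) = p (b0 (?d1 c))"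
  proof (rule free_lift[OF R F Q mod_hom_comp[OF mod_hom_comp[OF d1 b0] p, unfolded res_mod_def[of _ _ "Suc 0"]]
          mod_hom_comp[OF h p], folded res_mod_def])
    fix s assume "s \<in> res_basis R N (Suc 0)"
    hence s: "basis_elt R s \<in> carrier ?F1" unfolding res_mod_def by (rule basis_elt_closed[OF R])
    note ds = mod_homD(1)[OF d1 s]
    have "q (b0 (?d1 (basis_elt R s))) = \<zero>\<^bsub>N\<^esub>" using q_b0[OF ds] aug_d1[OF s] by simp
    from iffD1[OF ker[OF b0D(1)[OF ds]] this]
    show "\<exists>x\<in>carrier F. p (h x) = p (b0 (?d1 (basis_elt R s)))" by (elim bexE) auto
  qed (rule that)
  note kD = mod_homD[OF k] and b1D = mod_homD[OF b1]
  let ?W = "{x \<in> carrier F. p (h x) = \<zero>\<^bsub>Q\<^esub>}" and ?U = "{g \<in> carrier ?G. p g = \<zero>\<^bsub>Q\<^esub>}"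
  let ?TF = "tensor R F M" and ?T0 = "tensor R ?F0 M" and ?T1 = "tensor R ?F1 M" and ?T2 = "tensor R ?F2 M"
    and ?TG = "tensor R ?G M"
  have TM: "module R ?TF" "module R ?T0" "module R ?T1" "module R ?T2" "module R ?TG"
    by (intro tensor_module F Fn G M)+
  interpret T: module R ?TF by (rule TM)
  interpret T0: module R ?T0 by (rule TM)
  interpret T1: module R ?T1 by (rule TM)
  interpret TG: module R ?TG by (rule TM)
  have W: "?W \<subseteq> carrier F" by blast
  note WM = tensor_part_submodule[OF F M W]
  note WD = submoduleD[OF TM(1) WM]
  let ?d1M = "tensor_map R ?F0 M ?d1 id" and ?d2M = "tensor_map R ?F1 M ?d2 id"
    and ?aM = "tensor_map R ?F0 M a0 id" and ?bM = "tensor_map R F M b1 id"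
    and ?kM = "tensor_map R F M k id" and ?hM = "tensor_map R ?G M h id"
  note d1M = tensor_map_hom[OF Fn M Fn M d1 mod_hom_id]
    and d2M = tensor_map_hom[OF Fn M Fn M d2 mod_hom_id]
    and aM = tensor_map_hom[OF G M Fn M a0 mod_hom_id]
    and bM = tensor_map_hom[OF Fn M F M b1 mod_hom_id]
    and kM = tensor_map_hom[OF G M F M k mod_hom_id]
    and hM = tensor_map_hom[OF F M G M h mod_hom_id]
  \<comment> \<open>\<open>D s g\<close>: some chain over \<open>g\<close> is sent by \<open>b1\<close> to \<open>s\<close>, up to the homotopy and \<open>(ker (p \<circ> h)) M\<close>. The
    relation is additive, so it can be checked on pure tensors.\<close>
  define D where "D = (\<lambda>s g. \<exists>z\<in>carrier ?T1. ?d1M z = ?aM g \<and>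
    (\<exists>w\<in>tensor_part R F M ?W. ?bM z = (s \<oplus>\<^bsub>?TF\<^esub> ?kM g) \<oplus>\<^bsub>?TF\<^esub> w))"
  have D_zero: "D \<zero>\<^bsub>?TF\<^esub> \<zero>\<^bsub>?TG\<^esub>"
    unfolding D_def
    by (intro bexI[of _ "\<zero>\<^bsub>?T1\<^esub>"] bexI[of _ "\<zero>\<^bsub>?TF\<^esub>"] conjI)
       (simp_all add: mod_hom_zero[OF _ _ d1M] mod_hom_zero[OF _ _ aM] mod_hom_zero[OF _ _ bM]
         mod_hom_zero[OF _ _ kM] TM tensor_part.zero)
  have D_add: "D (s \<oplus>\<^bsub>?TF\<^esub> s') (g \<oplus>\<^bsub>?TG\<^esub> g')"
    if "D s g" "D s' g'" and c: "s \<in> carrier ?TF" "s' \<in> carrier ?TF" "g \<in> carrier ?TG" "g' \<in> carrier ?TG"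
    for s s' g g'
  proof -
    from that(1) obtain z w where z: "z \<in> carrier ?T1" "?d1M z = ?aM g" "w \<in> tensor_part R F M ?W"
      "?bM z = (s \<oplus>\<^bsub>?TF\<^esub> ?kM g) \<oplus>\<^bsub>?TF\<^esub> w" unfolding D_def by blast
    from that(2) obtain z' w' where z': "z' \<in> carrier ?T1" "?d1M z' = ?aM g'" "w' \<in> tensor_part R F M ?W"
      "?bM z' = (s' \<oplus>\<^bsub>?TF\<^esub> ?kM g') \<oplus>\<^bsub>?TF\<^esub> w'" unfolding D_def by blast
    note ww = WD(1)[OF z(3)] WD(1)[OF z'(3)] WD(3)[OF z(3) z'(3)]
    show ?thesis unfolding D_def
    proof (intro bexI[of _ "z \<oplus>\<^bsub>?T1\<^esub> z'"] bexI[of _ "w \<oplus>\<^bsub>?TF\<^esub> w'"] conjI)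
      show "?d1M (z \<oplus>\<^bsub>?T1\<^esub> z') = ?aM (g \<oplus>\<^bsub>?TG\<^esub> g')"
        using z z' c by (simp add: mod_homD[OF d1M] mod_homD[OF aM])
      show "?bM (z \<oplus>\<^bsub>?T1\<^esub> z') = ((s \<oplus>\<^bsub>?TF\<^esub> s') \<oplus>\<^bsub>?TF\<^esub> ?kM (g \<oplus>\<^bsub>?TG\<^esub> g')) \<oplus>\<^bsub>?TF\<^esub> (w \<oplus>\<^bsub>?TF\<^esub> w')"
        using z z' c ww by (simp add: mod_homD[OF bM] mod_homD[OF kM] T.M.a_ac)
    qed (use z z' ww in simp_all)
  qed
  have D_pure: "D (pure_tensor R F M x m) (pure_tensor R ?G M u m)"
    if x: "x \<in> carrier F" and u: "u \<in> carrier ?G" and px: "p u = p (h x)" and m: "m \<in> carrier M" for x u m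
  proof -
    have "q u = \<zero>\<^bsub>N\<^esub>" using ker[OF u] x px by blast
    hence "a0 u \<in> a_kernel ?F0 N ?aug" using aug_a0[OF u] a0D(1)[OF u] by (simp add: a_kernel_def')
    then obtain b where b: "b \<in> carrier ?F1" "?d1 b = a0 u" unfolding res_exact_0[OF N, symmetric] by (elim imageE) simp
    define w where "w = b1 b \<ominus>\<^bsub>F\<^esub> (x \<oplus>\<^bsub>F\<^esub> k u)"
    have xk: "x \<oplus>\<^bsub>F\<^esub> k u \<in> carrier F" and b1b: "b1 b \<in> carrier F" using x kD(1)[OF u] b1D(1)[OF b(1)] by auto
    have wc: "w \<in> carrier F" unfolding w_def using xk b1b by simp
    have sum: "b1 b = (x \<oplus>\<^bsub>F\<^esub> k u) \<oplus>\<^bsub>F\<^esub> w"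
      unfolding w_def using minus_add_cancel(2)[OF F b1b xk] by simp
    have "p (h (b1 b)) = p (h x \<oplus>\<^bsub>?G\<^esub> h (k u))"
    proof -
      have "p (h (b1 b)) = p (b0 (a0 u))" using pb1[OF b(1)] b(2) by simp
      also have "b0 (a0 u) = u \<oplus>\<^bsub>?G\<^esub> e u"
        unfolding e_def by (rule minus_add_cancel(2)[OF G b0D(1)[OF a0D(1)[OF u]] u, symmetric])
      also have "p \<dots> = p (h x \<oplus>\<^bsub>?G\<^esub> h (k u))"
        using pD hD x u kD(1)[OF u] mod_homD(1)[OF e u] px pk[OF u] by simp
      finally show ?thesis .
    qed
    hence "p (h w) = \<zero>\<^bsub>Q\<^esub>"
      unfolding w_def using x kD(1)[OF u] b1b xk pD hD
      by (simp add: mod_hom_minus[OF F G h] mod_hom_minus[OF G Q p] minus_add_cancel(3)[OF Q])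
    hence w: "w \<in> ?W" using wc by simp
    show ?thesis unfolding D_def
    proof (intro bexI[of _ "pure_tensor R ?F1 M b m"] bexI[of _ "pure_tensor R F M w m"] conjI)
      show "?d1M (pure_tensor R ?F1 M b m) = ?aM (pure_tensor R ?G M u m)"
        by (simp add: tensor_map_pure[OF Fn M Fn M d1 mod_hom_id b(1) m] tensor_map_pure[OF G M Fn M a0 mod_hom_id u m] b(2))
      show "?bM (pure_tensor R ?F1 M b m) =
          (pure_tensor R F M x m \<oplus>\<^bsub>?TF\<^esub> ?kM (pure_tensor R ?G M u m)) \<oplus>\<^bsub>?TF\<^esub> pure_tensor R F M w m"
        using pure_tensor_bilinear(1)[OF F M] x kD(1)[OF u] wc xk m
        by (simp add: tensor_map_pure[OF Fn M F M b1 mod_hom_id b(1) m] tensor_map_pure[OF G M F M k mod_hom_id u m] sum)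
    qed (simp_all add: pure_in_tensor_part[OF F M W w m] pure_tensor_closed[OF Fn M b(1) m])
  qed
  define H where "H = ?hM"
  note H = hM[folded H_def]
  have D1: "s \<in> carrier ?TF \<and> D s (H s)" if "s \<in> tensor_part R F M (carrier F)" for s
    using that
  proof induction
    case zero
    show ?case using D_zero by (simp add: mod_hom_zero[OF TM(1,5) H])
  next
    case (add c m s)
    have pc: "pure_tensor R F M c m \<in> carrier ?TF" by (rule pure_tensor_closed[OF F M add(1,2)])
    have "D (pure_tensor R F M c m) (H (pure_tensor R F M c m))"
      unfolding H_def tensor_map_pure[OF F M G M h mod_hom_id add(1,2)]
      using D_pure[OF add(1) hD(1)[OF add(1)] refl add(2)] by simp
    thus ?case using D_add[OF _ conjunct2[OF add(4)] pc _ mod_homD(1)[OF H pc]] add(4) pc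
      by (simp add: mod_homD[OF H])
  qed
  have U: "?U \<subseteq> carrier ?G" by blast
  have D2: "g \<in> carrier ?TG \<and> D \<zero>\<^bsub>?TF\<^esub> g" if "g \<in> tensor_part R ?G M ?U" for g
    using that
  proof induction
    case zero
    show ?case using D_zero by simp
  next
    case (add c m g)
    hence c: "c \<in> carrier ?G" "p c = \<zero>\<^bsub>Q\<^esub>" by simp_all
    have "p c = p (h \<zero>\<^bsub>F\<^esub>)" using c mod_hom_zero[OF F G h] mod_hom_zero[OF G Q p] by simp
    from D_pure[OF F.M.zero_closed c(1) this add(2)]
    have "D \<zero>\<^bsub>?TF\<^esub> (pure_tensor R ?G M c m)" unfolding pure_tensor_zero[OF F M add(2)] .
    thus ?case using D_add[of "\<zero>\<^bsub>?TF\<^esub>" "pure_tensor R ?G M c m" "\<zero>\<^bsub>?TF\<^esub>" g] add(4)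
        pure_tensor_closed[OF G M c(1) add(2)] by simp
  qed
  \<comment> \<open>the image \<open>g\<close> of \<open>t\<close> is related to \<open>t\<close>, as \<open>g\<close> is in \<open>h(F) M\<close>, and to \<open>0\<close>, as \<open>g\<close> is in \<open>U M\<close>; the two
    chains over \<open>g\<close> differ by a cycle, hence by a boundary, which \<open>b1\<close> sends into \<open>(ker (p \<circ> h)) M\<close>\<close>
  let ?g = "?hM t"
  have "D t ?g" using D1[unfolded H_def] t unfolding tensor_part_carrier[OF F M] by blast
  then obtain z w where z: "z \<in> carrier ?T1" "?d1M z = ?aM ?g" "w \<in> tensor_part R F M ?W"
      "?bM z = (t \<oplus>\<^bsub>?TF\<^esub> ?kM ?g) \<oplus>\<^bsub>?TF\<^esub> w" unfolding D_def by blast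
  have "D \<zero>\<^bsub>?TF\<^esub> ?g" using D2[OF ht] by blast
  then obtain z' w' where z': "z' \<in> carrier ?T1" "?d1M z' = ?aM ?g" "w' \<in> tensor_part R F M ?W"
      "?bM z' = (\<zero>\<^bsub>?TF\<^esub> \<oplus>\<^bsub>?TF\<^esub> ?kM ?g) \<oplus>\<^bsub>?TF\<^esub> w'" unfolding D_def by blast
  have zz: "z \<ominus>\<^bsub>?T1\<^esub> z' \<in> carrier ?T1" using z z' by simp
  have "?d1M (z \<ominus>\<^bsub>?T1\<^esub> z') = \<zero>\<^bsub>?T0\<^esub>"
    using z z' mod_homD(1)[OF d1M z'(1)] by (simp add: mod_hom_minus[OF TM(3,2) d1M] minus_add_cancel(3)[OF TM(2)])
  from tor_one_exact[OF N M van, unfolded tor_chain_def tor_diff_def, OF zz this]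
  obtain x where x: "x \<in> carrier ?T2" "z \<ominus>\<^bsub>?T1\<^esub> z' = ?d2M x" by blast
  have "?bM (?d2M x) \<in> tensor_part R F M ?W"
    unfolding tensor_map_comp[OF Fn M Fn F d2 b1 x(1)]
  proof (rule tensor_part_image[OF Fn M F mod_hom_comp[OF d2 b1] subset_refl _ W])
    show "x \<in> tensor_part R ?F2 M (carrier ?F2)" using x(1) by (simp add: tensor_part_carrier[OF Fn M])
    show "(\<lambda>c. b1 (?d2 c)) ` carrier ?F2 \<subseteq> ?W"
    proof
      fix y assume "y \<in> (\<lambda>c. b1 (?d2 c)) ` carrier ?F2"
      then obtain c where c: "c \<in> carrier ?F2" "y = b1 (?d2 c)" by blast
      note dc = mod_homD(1)[OF d2 c(1)]
      have "p (h y) = p (b0 \<zero>\<^bsub>?F0\<^esub>)" using pb1[OF dc] d1_d2[OF c(1)] c(2) by simp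
      thus "y \<in> ?W" using b1D(1)[OF dc] c(2) mod_hom_zero[OF Fn G b0] mod_hom_zero[OF G Q p] by simp
    qed
  qed
  then obtain w3 where w3: "w3 \<in> tensor_part R F M ?W" "?bM (z \<ominus>\<^bsub>?T1\<^esub> z') = w3" using x(2) by simp
  have kg: "?kM ?g \<in> carrier ?TF" using mod_homD(1)[OF kM mod_homD(1)[OF hM t]] .
  note cc = WD(1)[OF z(3)] WD(1)[OF z'(3)] WD(1)[OF w3(1)] kg t
  have "?bM z = ?bM (z' \<oplus>\<^bsub>?T1\<^esub> (z \<ominus>\<^bsub>?T1\<^esub> z'))" using minus_add_cancel(2)[OF TM(3) z(1) z'(1)] by simp
  also have "\<dots> = ?bM z' \<oplus>\<^bsub>?TF\<^esub> w3" using mod_homD(2)[OF bM z'(1) zz] w3(2) by simp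
  finally have "?kM ?g \<oplus>\<^bsub>?TF\<^esub> (w \<oplus>\<^bsub>?TF\<^esub> t) = ?kM ?g \<oplus>\<^bsub>?TF\<^esub> (w' \<oplus>\<^bsub>?TF\<^esub> w3)"
    unfolding z(4) z'(4) using cc by (simp add: T.M.a_ac)
  hence "w \<oplus>\<^bsub>?TF\<^esub> t = w' \<oplus>\<^bsub>?TF\<^esub> w3" using cc 
    using T.M.add.l_cancel[of "?kM ?g" "w \<oplus>\<^bsub>?TF\<^esub> t" "w' \<oplus>\<^bsub>?TF\<^esub> w3"] by simp
  hence "w \<oplus>\<^bsub>?TF\<^esub> t \<in> tensor_part R F M ?W" using WD(3)[OF z'(3) w3(1)] by simp
  thus ?thesis by (rule submodule_cancel[OF TM(1) WM z(3) _ t])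
qed

section \<open>Relations over an adically flat module\<close>

lemma sum_in_submodule_iff:
  assumes "module R M" "submodule U R M" "g \<in> carrier M" "y \<in> carrier M"
  shows "g \<ominus>\<^bsub>M\<^esub> y \<in> U \<longleftrightarrow> (\<exists>u\<in>U. g = y \<oplus>\<^bsub>M\<^esub> u)"
proof
  assume "g \<ominus>\<^bsub>M\<^esub> y \<in> U"
  moreover have "g = y \<oplus>\<^bsub>M\<^esub> (g \<ominus>\<^bsub>M\<^esub> y)" by (rule minus_add_cancel(2)[OF assms(1,3,4), symmetric])
  ultimately show "\<exists>u\<in>U. g = y \<oplus>\<^bsub>M\<^esub> u" by (rule bexI[rotated])
next
  assume "\<exists>u\<in>U. g = y \<oplus>\<^bsub>M\<^esub> u"
  then obtain u where u: "u \<in> U" "g = y \<oplus>\<^bsub>M\<^esub> u" by (elim bexE)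
  have "g \<ominus>\<^bsub>M\<^esub> y = u"
    unfolding u(2) by (rule minus_add_cancel(5)[OF assms(1) submoduleD(1)[OF assms(1,2) u(1)] assms(4)])
  thus "g \<ominus>\<^bsub>M\<^esub> y \<in> U" using u(1) by simp
qed

lemma quot_eq_zero_iff:
  assumes "module R M" "submodule H R M" "g \<in> carrier M"
  shows "H +>\<^bsub>M\<^esub> g = \<zero>\<^bsub>quot_mod M H\<^esub> \<longleftrightarrow> g \<in> H"
proof -
  interpret M: module R M by fact
  have "g \<ominus>\<^bsub>M\<^esub> \<zero>\<^bsub>M\<^esub> = g"
    using minus_add_cancel(1)[OF assms(1,3) M.M.zero_closed] assms(3) by simp
  thus ?thesis
    unfolding quot_mod_simps(2)[OF assms(1,2)] quot_eq_iff[OF assms M.M.zero_closed] by simp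
qed

text \<open>Adic flatness is tested on modules with elements in \<^typ>\<open>'a list set\<close>. Quotients of finite free modules
  have isomorphic copies there.\<close>

lemma small_quotient_map:
  fixes R :: "('a, 'r) ring_scheme" and Y :: "'y set"
  assumes R: "cring R" and Y: "finite Y" and W: "submodule W R (free_mod R Y)"
  obtains N :: "('a, 'a list set) module" and q where "module R N" "q \<in> mod_hom R (free_mod R Y) N"
    "q ` carrier (free_mod R Y) = carrier N"
    "\<And>g. g \<in> carrier (free_mod R Y) \<Longrightarrow> q g = \<zero>\<^bsub>N\<^esub> \<longleftrightarrow> g \<in> W"
proof -
  let ?G = "free_mod R Y" and ?N = "quot_mod (free_mod R Y) W"
  have G: "module R ?G" by (rule free_mod_module[OF R])
  interpret G: module R ?G by (rule G)
  have N: "module R ?N" by (rule quot_mod_module[OF G W])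
  let ?p = "\<lambda>g. W +>\<^bsub>?G\<^esub> g"
  have p: "?p \<in> mod_hom R ?G ?N" by (rule quot_proj_hom[OF G W])
  have psurj: "?p ` carrier ?G = carrier ?N" by (rule quot_mod_simps(1)[OF G W, symmetric])
  have p0: "?p g = \<zero>\<^bsub>?N\<^esub> \<longleftrightarrow> g \<in> W" if "g \<in> carrier ?G" for g
    by (rule quot_eq_zero_iff[OF G W that])
  obtain b where b: "bij_betw b {..<card Y} Y"
    using ex_bij_betw_nat_finite[OF Y] by (auto simp: atLeast0LessThan)
  let ?E = "free_mod R {..<card Y}"
  have E: "module R ?E" by (rule free_mod_module[OF R])
  have bY: "b i \<in> Y" if "i \<in> {..<card Y}" for i using bij_betwE[OF b] that by blast
  let ?g = "\<lambda>i. ?p (basis_elt R (b i))"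
  have gc: "?g i \<in> carrier ?N" if "i \<in> {..<card Y}" for i
    by (rule mod_homD(1)[OF p basis_elt_closed[OF R bY[OF that]]])
  have f: "lin_ext R ?N ?g \<in> mod_hom R ?E ?N" by (rule lin_ext_hom[OF R N]) (use gc in blast)
  have im: "submodule (lin_ext R ?N ?g ` carrier ?E) R ?N"
    by (rule image_submodule[OF E N f module.carrier_is_submodule[OF E]])
  have "?p g \<in> lin_ext R ?N ?g ` carrier ?E" if "g \<in> carrier ?G" for g
  proof -
    have "g \<in> {g \<in> carrier ?G. ?p g \<in> lin_ext R ?N ?g ` carrier ?E}"
    proof (rule free_induct[OF R vimage_submodule[OF G N p im] _ that])
      fix y assume y: "y \<in> Y"
      then obtain i where i: "i \<in> {..<card Y}" "y = b i" using bij_betw_imp_surj_on[OF b] by blast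
      have "lin_ext R ?N ?g (basis_elt R i) = ?p (basis_elt R y)"
        unfolding i(2) by (rule lin_ext_basis_elt[OF R N, of ?g]) (rule gc[OF i(1)])
      hence "?p (basis_elt R y) \<in> lin_ext R ?N ?g ` carrier ?E"
        using imageI[OF basis_elt_closed[OF R i(1)], of "lin_ext R ?N ?g"] by simp
      thus "basis_elt R y \<in> {g \<in> carrier ?G. ?p g \<in> lin_ext R ?N ?g ` carrier ?E}"
        using basis_elt_closed[OF R y] by simp
    qed
    thus ?thesis by simp
  qed
  hence "carrier ?N \<subseteq> lin_ext R ?N ?g ` carrier ?E" unfolding psurj[symmetric] by (rule image_subsetI)
  moreover have "lin_ext R ?N ?g ` carrier ?E \<subseteq> carrier ?N" by (rule image_subsetI) (rule mod_homD(1)[OF f])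
  ultimately have "lin_ext R ?N ?g ` carrier ?E = carrier ?N" by simp
  from fg_module_embeds[OF N f this] obtain N' :: "('a, 'a list set) module" and j
    where N': "module R N'" and j: "j \<in> mod_iso R ?N N'" by blast
  have jh: "j \<in> mod_hom R ?N N'" and jb: "bij_betw j (carrier ?N) (carrier N')"
    using j unfolding mod_iso_def by simp_all
  let ?q = "\<lambda>g. j (?p g)"
  show ?thesis
  proof (rule that[OF N', of ?q])
    show "?q \<in> mod_hom R ?G N'" by (rule mod_hom_comp[OF p jh])
    have "?q ` carrier ?G = j ` (?p ` carrier ?G)" by (rule image_image[symmetric])
    thus "?q ` carrier ?G = carrier N'" unfolding psurj bij_betw_imp_surj_on[OF jb] .
  next
    fix g assume g: "g \<in> carrier ?G"
    have "j (?p g) = \<zero>\<^bsub>N'\<^esub> \<longleftrightarrow> j (?p g) = j \<zero>\<^bsub>?N\<^esub>" unfolding mod_hom_zero[OF N N' jh] ..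
    also have "\<dots> \<longleftrightarrow> ?p g = \<zero>\<^bsub>?N\<^esub>"
      by (rule inj_on_eq_iff[OF bij_betw_imp_inj_on[OF jb] mod_homD(1)[OF p g]])
         (rule abelian_monoid.zero_closed[OF abelian_group.axioms(1)[OF module.axioms(2)[OF N]]])
    finally show "?q g = \<zero>\<^bsub>N'\<^esub> \<longleftrightarrow> g \<in> W" unfolding p0[OF g] .
  qed
qed

text \<open>With \<open>U = I\<^sup>l R\<^sup>Y\<close> the module \<open>N = R\<^sup>Y / (h(R\<^sup>X) + U)\<close> is annihilated by \<open>I\<^sup>l\<close>, so that adic flatness makes
  \<open>Tor\<^sub>1(N, M)\<close> vanish.\<close>

lemma adically_flat_relations:
  fixes R :: "('a, 'r) ring_scheme" and Y :: "'y set"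
  assumes R: "cring R" and I: "ideal I R" and M: "module R M"
    and flat: "adically_flat TYPE('a list set) R I M"
    and Y: "finite Y" and h: "h \<in> mod_hom R (free_mod R X) (free_mod R Y)"
    and t: "t \<in> carrier (tensor R (free_mod R X) M)"
    and ht: "tensor_map R (free_mod R Y) M h id t
      \<in> tensor_part R (free_mod R Y) M (coord_part R (ideal_power R I l) Y)"
  shows "t \<in> tensor_part R (free_mod R X) M
    {x \<in> carrier (free_mod R X). h x \<in> coord_part R (ideal_power R I l) Y}"
proof -
  let ?F = "free_mod R X" and ?G = "free_mod R Y" and ?J = "ideal_power R I l"
  let ?U = "coord_part R ?J Y"
  have F: "module R ?F" and G: "module R ?G" by (rule free_mod_module[OF R])+
  interpret F: module R ?F by (rule F)
  interpret G: module R ?G by (rule G)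
  note J = ideal_power_ideal(1)[OF R I, of l]
  have U: "submodule ?U R ?G" by (rule coord_part_submodule[OF R J])
  define W where "W = {x \<oplus>\<^bsub>?G\<^esub> y | x y. x \<in> h ` carrier ?F \<and> y \<in> ?U}"
  have W: "submodule W R ?G"
    unfolding W_def by (rule sum_submodule[OF G image_submodule[OF F G h F.carrier_is_submodule] U])
  let ?p = "\<lambda>g. ?U +>\<^bsub>?G\<^esub> g" and ?Q = "quot_mod ?G ?U"
  have Q: "module R ?Q" and p: "?p \<in> mod_hom R ?G ?Q" by (rule quot_mod_module[OF G U], rule quot_proj_hom[OF G U])
  have p0: "?p g = \<zero>\<^bsub>?Q\<^esub> \<longleftrightarrow> g \<in> ?U" if "g \<in> carrier ?G" for g
    by (rule quot_eq_zero_iff[OF G U that])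
  obtain N :: "('a, 'a list set) module" and q where N: "module R N" and q: "q \<in> mod_hom R ?G N"
    and surj: "q ` carrier ?G = carrier N" and q0: "\<And>g. g \<in> carrier ?G \<Longrightarrow> q g = \<zero>\<^bsub>N\<^esub> \<longleftrightarrow> g \<in> W"
    using small_quotient_map[OF R Y W] by blast
  have "r \<odot>\<^bsub>N\<^esub> y = \<zero>\<^bsub>N\<^esub>" if y: "y \<in> carrier N" and r: "r \<in> ?J" for r y
  proof -
    from y obtain g where g: "g \<in> carrier ?G" "y = q g" unfolding surj[symmetric] by (elim imageE)
    note rc = idealD(1)[OF J r]
    have rg: "r \<odot>\<^bsub>?G\<^esub> g \<in> carrier ?G" by (rule G.smult_closed[OF rc g(1)])
    have "r \<odot>\<^bsub>?G\<^esub> g \<in> ?U"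
      using rg idealD(5)[OF J free_modD(1)[OF g(1)] r] unfolding coord_part_def by (simp add: free_mod_simps)
    moreover have "r \<odot>\<^bsub>?G\<^esub> g = h \<zero>\<^bsub>?F\<^esub> \<oplus>\<^bsub>?G\<^esub> r \<odot>\<^bsub>?G\<^esub> g" using rg by (simp add: mod_hom_zero[OF F G h])
    ultimately have "r \<odot>\<^bsub>?G\<^esub> g \<in> W"
      unfolding W_def by (intro CollectI exI conjI) (assumption, rule imageI[OF F.M.zero_closed])
    thus ?thesis using q0[OF rg] mod_homD(3)[OF q rc g(1)] g(2) by simp
  qed
  hence "torsion_module R I N" unfolding torsion_module_def using N by (intro conjI ballI exI[of _ l]) auto
  hence van: "carrier (Tor R 1 N M) = {\<zero>\<^bsub>Tor R 1 N M\<^esub>}" using flat unfolding adically_flat_def by simp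
  have ker: "q g = \<zero>\<^bsub>N\<^esub> \<longleftrightarrow> (\<exists>x\<in>carrier ?F. ?p g = ?p (h x))" if g: "g \<in> carrier ?G" for g
  proof -
    have "(\<exists>x\<in>carrier ?F. ?p g = ?p (h x)) \<longleftrightarrow> (\<exists>x\<in>carrier ?F. \<exists>u\<in>?U. g = h x \<oplus>\<^bsub>?G\<^esub> u)"
      by (rule bex_cong[OF refl])
         (simp only: quot_eq_iff[OF G U g mod_homD(1)[OF h]] sum_in_submodule_iff[OF G U g mod_homD(1)[OF h]])
    also have "\<dots> \<longleftrightarrow> g \<in> W" unfolding W_def by blast
    finally show ?thesis using q0[OF g] by simp
  qed
  have sub: "{g \<in> carrier ?G. ?p g = \<zero>\<^bsub>?Q\<^esub>} = ?U"
    using p0 submoduleD(1)[OF G U] by blast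
  have sub': "{x \<in> carrier ?F. ?p (h x) = \<zero>\<^bsub>?Q\<^esub>} = {x \<in> carrier ?F. h x \<in> ?U}"
    using p0[OF mod_homD(1)[OF h]] by blast
  have "tensor_map R ?G M h id t \<in> tensor_part R ?G M {g \<in> carrier ?G. ?p g = \<zero>\<^bsub>?Q\<^esub>}"
    unfolding sub by (rule ht)
  from tensor_kernel_of_tor_vanishing[OF F M Q N p h q surj ker van t this]
  show ?thesis unfolding sub' .
qed

text \<open>The Artin-Rees property survives tensoring with \<open>M\<close>: the preimage of \<open>I\<^sup>l R\<^sup>Y\<close> under \<open>h\<close> is contained in
  \<open>I\<^sup>k R\<^sup>X + ker h\<close>, and by adic flatness the preimage of \<open>(I\<^sup>l R\<^sup>Y) M\<close> is spanned by the former.\<close>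

theorem tensor_artin_rees:
  fixes R :: "('a, 'r) ring_scheme" and Y :: "'y set"
  assumes R: "cring R" and No: "noetherian_ring R" and I: "ideal I R" and M: "module R M"
    and flat: "adically_flat TYPE('a list set) R I M"
    and Y: "finite Y" and h: "h \<in> mod_hom R (free_mod R X) (free_mod R Y)"
  shows "\<exists>l. \<forall>t\<in>carrier (tensor R (free_mod R X) M).
    tensor_map R (free_mod R Y) M h id t
      \<in> tensor_part R (free_mod R Y) M (coord_part R (ideal_power R I l) Y) \<longrightarrow>
    (\<exists>s\<in>tensor_part R (free_mod R X) M (coord_part R (ideal_power R I k) X).
     \<exists>w\<in>tensor_part R (free_mod R X) M {x \<in> carrier (free_mod R X). h x = \<zero>\<^bsub>free_mod R Y\<^esub>}.
       t = s \<oplus>\<^bsub>tensor R (free_mod R X) M\<^esub> w)"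
proof -
  let ?F = "free_mod R X" and ?G = "free_mod R Y" and ?TF = "tensor R (free_mod R X) M"
  let ?C = "coord_part R (ideal_power R I k) X" and ?K = "{x \<in> carrier ?F. h x = \<zero>\<^bsub>?G\<^esub>}"
  have F: "module R ?F" and G: "module R ?G" by (rule free_mod_module[OF R])+
  note TF = tensor_module[OF F M]
  obtain l where l: "\<forall>u\<in>carrier ?F. h u \<in> coord_part R (ideal_power R I l) Y \<longrightarrow>
    (\<exists>f\<in>?C. \<exists>w\<in>carrier ?F. u = f \<oplus>\<^bsub>?F\<^esub> w \<and> h w = \<zero>\<^bsub>?G\<^esub>)"
    using artin_rees[OF R No I Y h, of k] by (elim exE)
  have Cc: "?C \<subseteq> carrier ?F" unfolding coord_part_def by blast
  have Kc: "?K \<subseteq> carrier ?F" by blast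
  let ?S = "{x \<oplus>\<^bsub>?TF\<^esub> y | x y. x \<in> tensor_part R ?F M ?C \<and> y \<in> tensor_part R ?F M ?K}"
  have S: "submodule ?S R ?TF"
    by (rule sum_submodule[OF TF tensor_part_submodule[OF F M Cc] tensor_part_submodule[OF F M Kc]])
  have sub: "tensor_part R ?F M {x \<in> carrier ?F. h x \<in> coord_part R (ideal_power R I l) Y} \<subseteq> ?S"
  proof (rule tensor_part_least[OF F M S])
    fix c m assume c: "c \<in> {x \<in> carrier ?F. h x \<in> coord_part R (ideal_power R I l) Y}" and m: "m \<in> carrier M"
    from c have "c \<in> carrier ?F" "h c \<in> coord_part R (ideal_power R I l) Y" by simp_all
    from l[rule_format, OF this]
    obtain f w where fw: "f \<in> ?C" "w \<in> carrier ?F" "c = f \<oplus>\<^bsub>?F\<^esub> w" "h w = \<zero>\<^bsub>?G\<^esub>"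
      by (elim bexE conjE)
    have "f \<in> carrier ?F" using fw(1) Cc by (rule subsetD[rotated])
    hence "pure_tensor R ?F M c m = pure_tensor R ?F M f m \<oplus>\<^bsub>?TF\<^esub> pure_tensor R ?F M w m"
      unfolding fw(3) using pure_tensor_bilinear(1)[OF F M _ fw(2) m] by simp
    moreover have "pure_tensor R ?F M f m \<in> tensor_part R ?F M ?C"
      by (rule pure_in_tensor_part[OF F M Cc fw(1) m])
    moreover have "pure_tensor R ?F M w m \<in> tensor_part R ?F M ?K"
      by (rule pure_in_tensor_part[OF F M Kc _ m]) (simp add: fw)
    ultimately show "pure_tensor R ?F M c m \<in> ?S" by (intro CollectI exI conjI)
  qed
  show ?thesis
  proof (intro exI[of _ l] ballI impI)
    fix t assume "t \<in> carrier ?TF" "tensor_map R ?G M h id t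
      \<in> tensor_part R ?G M (coord_part R (ideal_power R I l) Y)"
    from adically_flat_relations[OF R I M flat Y h this] have "t \<in> ?S" by (rule subsetD[OF sub])
    thus "\<exists>s\<in>tensor_part R ?F M ?C. \<exists>w\<in>tensor_part R ?F M ?K. t = s \<oplus>\<^bsub>?TF\<^esub> w"
      by (elim CollectE exE conjE) (intro bexI)
  qed
qed

section \<open>Convergence in adically complete modules\<close>

definition ideal_smult :: "('a, 'r) ring_scheme \<Rightarrow> 'a set \<Rightarrow> ('a, 'm, 'x) module_scheme \<Rightarrow> 'm set" where
  "ideal_smult R J M = mod_span R M {r \<odot>\<^bsub>M\<^esub> m | r m. r \<in> J \<and> m \<in> carrier M}"

lemma ideal_smult_submodule:
  assumes M: "module R M" and J: "ideal J R"
  shows "submodule (ideal_smult R J M) R M"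
    and "r \<in> J \<Longrightarrow> m \<in> carrier M \<Longrightarrow> r \<odot>\<^bsub>M\<^esub> m \<in> ideal_smult R J M"
    and "submodule H R M \<Longrightarrow> (\<And>r m. r \<in> J \<Longrightarrow> m \<in> carrier M \<Longrightarrow> r \<odot>\<^bsub>M\<^esub> m \<in> H) \<Longrightarrow>
      ideal_smult R J M \<subseteq> H"
proof -
  interpret module R M by fact
  have sub: "{r \<odot>\<^bsub>M\<^esub> m | r m. r \<in> J \<and> m \<in> carrier M} \<subseteq> carrier M"
    using idealD(1)[OF J] by auto
  show "submodule (ideal_smult R J M) R M"
    unfolding ideal_smult_def by (rule mod_span_submodule(1)[OF M sub])
  show "r \<odot>\<^bsub>M\<^esub> m \<in> ideal_smult R J M" if "r \<in> J" "m \<in> carrier M"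
    unfolding ideal_smult_def by (rule subsetD[OF mod_span_submodule(2)[OF M sub]]) (use that in blast)
  show "ideal_smult R J M \<subseteq> H" if "submodule H R M" "\<And>r m. r \<in> J \<Longrightarrow> m \<in> carrier M \<Longrightarrow> r \<odot>\<^bsub>M\<^esub> m \<in> H"
    unfolding ideal_smult_def by (rule mod_span_submodule(3)[OF M sub that(1)]) (use that(2) in blast)
qed

lemma pure_tensor_right_hom:
  assumes "module R F" "module R M" "c \<in> carrier F"
  shows "pure_tensor R F M c \<in> mod_hom R M (tensor R F M)"
  by (rule mod_homI)
     (simp_all add: pure_tensor_closed pure_tensor_bilinear assms)

text \<open>This is the isomorphism of \<open>R/J \<otimes> M\<close> with \<open>M / J M\<close> for \<open>J = I\<^sup>k\<^sup>+\<^sup>1\<close>. One direction is bilinearity; the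
  other needs the map from the tensor product to \<open>M / J M\<close>.\<close>

lemma adic_trunc_tensor_eq_zero_iff:
  assumes R: "cring R" and I: "ideal I R" and M: "module R M" and m: "m \<in> carrier M"
  shows "pure_tensor R (adic_trunc R I k) M (ideal_power R I (k + 1) +>\<^bsub>R\<^esub> \<one>\<^bsub>R\<^esub>) m
      = \<zero>\<^bsub>tensor R (adic_trunc R I k) M\<^esub> \<longleftrightarrow> m \<in> ideal_smult R (ideal_power R I (k + 1)) M"
    (is "?L = \<zero>\<^bsub>?T\<^esub> \<longleftrightarrow> _")
proof -
  interpret cring R by fact
  interpret M: module R M by fact
  let ?A = "adic_trunc R I k" and ?J = "ideal_power R I (k + 1)"
  let ?JM = "ideal_smult R ?J M" and ?c = "\<lambda>x. ideal_power R I (k + 1) +>\<^bsub>R\<^esub> x"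
  note J = ideal_power_ideal(1)[OF R I, of "k + 1"]
  have A: "module R ?A" by (rule adic_trunc_module[OF R I])
  interpret A: module R ?A by (rule A)
  note T = tensor_module[OF A M]
  interpret T: module R ?T by (rule T)
  note s = adic_trunc_simps[OF R I, where k = k]
  note JM = ideal_smult_submodule[OF M J]
  have c1: "?c \<one>\<^bsub>R\<^esub> \<in> carrier ?A" unfolding s(1) by (rule imageI[OF one_closed])
  show ?thesis
  proof
    assume mJ: "m \<in> ?JM"
    have K: "submodule {m \<in> carrier M. pure_tensor R ?A M (?c \<one>\<^bsub>R\<^esub>) m \<in> {\<zero>\<^bsub>?T\<^esub>}} R M"
      by (rule vimage_submodule[OF M T pure_tensor_right_hom[OF A M c1] zero_submodule[OF T]])
    have "m \<in> {m \<in> carrier M. pure_tensor R ?A M (?c \<one>\<^bsub>R\<^esub>) m \<in> {\<zero>\<^bsub>?T\<^esub>}}"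
    proof (rule subsetD[OF JM(3)[OF K] mJ])
      fix r n assume r: "r \<in> ?J" and n: "n \<in> carrier M"
      have rc: "r \<in> carrier R" by (rule idealD(1)[OF J r])
      have "?c r = ?c \<zero>\<^bsub>R\<^esub>"
        using a_rcos_zero[OF J r] a_rcos_zero[OF J idealD(2)[OF J]] by simp
      also have "\<dots> = ?c (\<zero>\<^bsub>R\<^esub> \<otimes>\<^bsub>R\<^esub> \<one>\<^bsub>R\<^esub>)" by simp
      also have "\<dots> = \<zero>\<^bsub>R\<^esub> \<odot>\<^bsub>?A\<^esub> ?c \<one>\<^bsub>R\<^esub>" by (rule s(3)[symmetric]) simp_all
      also have "\<dots> = \<zero>\<^bsub>?A\<^esub>" by (rule A.smult_l_null[OF c1])
      finally have cr: "r \<odot>\<^bsub>?A\<^esub> ?c \<one>\<^bsub>R\<^esub> = \<zero>\<^bsub>?A\<^esub>" using s(3)[OF rc one_closed] rc by simp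
      have "pure_tensor R ?A M (?c \<one>\<^bsub>R\<^esub>) (r \<odot>\<^bsub>M\<^esub> n) = pure_tensor R ?A M (r \<odot>\<^bsub>?A\<^esub> ?c \<one>\<^bsub>R\<^esub>) n"
        using pure_tensor_bilinear(3,4)[OF A M rc c1 n] by simp
      also have "\<dots> = \<zero>\<^bsub>?T\<^esub>" unfolding cr by (rule pure_tensor_zero[OF A M n])
      finally show "r \<odot>\<^bsub>M\<^esub> n \<in> {m \<in> carrier M. pure_tensor R ?A M (?c \<one>\<^bsub>R\<^esub>) m \<in> {\<zero>\<^bsub>?T\<^esub>}}"
        using rc n by simp
    qed
    thus "?L = \<zero>\<^bsub>?T\<^esub>" by simp
  next
    assume L: "?L = \<zero>\<^bsub>?T\<^esub>"
    let ?Q = "quot_mod M ?JM"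
    have Q: "module R ?Q" by (rule quot_mod_module[OF M JM(1)])
    note qs = quot_mod_simps[OF M JM(1)]
    \<comment> \<open>multiplication of \<open>M / JM\<close> by a residue class modulo \<open>J\<close>, through a representative\<close>
    define b where "b = (\<lambda>X n. ?JM +>\<^bsub>M\<^esub> ((SOME x. x \<in> X) \<odot>\<^bsub>M\<^esub> n))"
    have b: "b (?c x) n = ?JM +>\<^bsub>M\<^esub> (x \<odot>\<^bsub>M\<^esub> n)" if x: "x \<in> carrier R" and n: "n \<in> carrier M" for x n
    proof -
      have "x \<in> ?c x" using idealD(2)[OF J] x unfolding a_r_coset_def' by force
      hence "(SOME y. y \<in> ?c x) \<in> ?c x" by (rule someI[of "\<lambda>y. y \<in> ?c x"])
      then obtain j where j: "j \<in> ?J" "(SOME y. y \<in> ?c x) = j \<oplus>\<^bsub>R\<^esub> x" unfolding a_r_coset_def' by blast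
      have jc: "j \<in> carrier R" by (rule idealD(1)[OF J j(1)])
      have "(j \<oplus>\<^bsub>R\<^esub> x) \<odot>\<^bsub>M\<^esub> n \<ominus>\<^bsub>M\<^esub> x \<odot>\<^bsub>M\<^esub> n = j \<odot>\<^bsub>M\<^esub> n"
        using jc x n by (simp add: M.smult_l_distr minus_add_cancel(4)[OF M])
      also have "\<dots> \<in> ?JM" by (rule JM(2)[OF j(1) n])
      finally show ?thesis unfolding b_def j(2)
        by (subst quot_eq_iff[OF M JM(1)]) (use jc x n in simp_all)
    qed
    have "bilinear_map R ?A M ?Q b"
      unfolding bilinear_map_def
    proof (intro conjI ballI)
      fix X assume "X \<in> carrier ?A"
      then obtain x where x: "x \<in> carrier R" "X = ?c x" unfolding s(1) by (elim imageE)
      show "b X \<in> mod_hom R M ?Q"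
      proof (rule mod_homI)
        fix r n assume "r \<in> carrier R" "n \<in> carrier M"
        thus "b X (r \<odot>\<^bsub>M\<^esub> n) = r \<odot>\<^bsub>?Q\<^esub> b X n"
          using x(1) by (simp only: x(2) b qs M.smult_closed) (simp add: M.smult_assoc1[symmetric] m_comm)
      qed (use x(1) in \<open>simp_all only: x(2) b qs M.smult_closed M.M.a_closed M.smult_r_distr imageI\<close>)
    next
      fix n assume n: "n \<in> carrier M"
      show "(\<lambda>X. b X n) \<in> mod_hom R ?A ?Q"
      proof (rule mod_homI)
        fix X assume "X \<in> carrier ?A"
        then obtain x where x: "x \<in> carrier R" "X = ?c x" unfolding s(1) by (elim imageE)
        show "b X n \<in> carrier ?Q" using x(1) n by (simp only: x(2) b qs M.smult_closed imageI)
      next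
        fix X X' assume "X \<in> carrier ?A" "X' \<in> carrier ?A"
        then obtain x x' where x: "x \<in> carrier R" "X = ?c x" "x' \<in> carrier R" "X' = ?c x'"
          unfolding s(1) by (elim imageE)
        show "b (X \<oplus>\<^bsub>?A\<^esub> X') n = b X n \<oplus>\<^bsub>?Q\<^esub> b X' n"
          using x(1,3) n by (simp only: x(2,4) s b qs M.smult_closed a_closed M.smult_l_distr)
      next
        fix r X assume r: "r \<in> carrier R" and "X \<in> carrier ?A"
        then obtain x where x: "x \<in> carrier R" "X = ?c x" unfolding s(1) by (elim imageE)
        show "b (r \<odot>\<^bsub>?A\<^esub> X) n = r \<odot>\<^bsub>?Q\<^esub> b X n"
          using x(1) r n by (simp only: x(2) s b qs M.smult_closed m_closed M.smult_assoc1)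
      qed
    qed
    note H = tensor_universal[OF A M Q this]
    let ?H = "\<lambda>X. the_elem (lin_ext R ?Q (\<lambda>(m, n). b m n) ` X)"
    have "?H ?L = ?JM +>\<^bsub>M\<^esub> m" using H(2)[OF c1 m] b[OF one_closed m] m by simp
    hence "?JM +>\<^bsub>M\<^esub> m = \<zero>\<^bsub>?Q\<^esub>" using mod_hom_zero[OF T Q H(1)] L by simp
    thus "m \<in> ?JM" using quot_eq_zero_iff[OF M JM(1) m] by simp
  qed
qed

lemma adically_complete_separated:
  assumes R: "cring R" and I: "ideal I R" and compl: "adically_complete R I M"
    and m: "m \<in> carrier M" and "\<And>k. m \<in> ideal_smult R (ideal_power R I k) M"
  shows "m = \<zero>\<^bsub>M\<^esub>"
proof -
  have M: "module R M" and iso: "to_completion R I M \<in> mod_iso R M (adic_completion R I M)"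
    using compl unfolding adically_complete_def by simp_all
  interpret M: module R M by (rule M)
  have "to_completion R I M m = (\<lambda>k. \<zero>\<^bsub>tensor R (adic_trunc R I k) M\<^esub>)"
    unfolding to_completion_def
    using adic_trunc_tensor_eq_zero_iff[OF R I M m] assms(5) by (simp only: fun_eq_iff) simp
  also have "\<dots> = \<zero>\<^bsub>adic_completion R I M\<^esub>" by (simp add: adic_completion_def inv_limit_def)
  also have "\<dots> = to_completion R I M \<zero>\<^bsub>M\<^esub>"
    by (rule mod_hom_zero[OF M adic_completion_module[OF M I] to_completion_hom[OF M I], symmetric])
  finally have "to_completion R I M m = to_completion R I M \<zero>\<^bsub>M\<^esub>" .
  moreover have "inj_on (to_completion R I M) (carrier M)"
    using iso unfolding mod_iso_def by (simp add: bij_betw_def)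
  ultimately show ?thesis using m by (simp add: inj_on_eq_iff)
qed

lemma adically_complete_limit:
  assumes R: "cring R" and I: "ideal I R" and compl: "adically_complete R I M"
    and m: "\<And>k. m k \<in> carrier M"
    and cauchy: "\<And>k. m (Suc k) \<ominus>\<^bsub>M\<^esub> m k \<in> ideal_smult R (ideal_power R I k) M"
  shows "\<exists>n\<in>carrier M. \<forall>k. n \<ominus>\<^bsub>M\<^esub> m k \<in> ideal_smult R (ideal_power R I k) M"
proof -
  have M: "module R M" and iso: "to_completion R I M \<in> mod_iso R M (adic_completion R I M)"
    using compl unfolding adically_complete_def by simp_all
  interpret M: module R M by (rule M)
  let ?A = "\<lambda>k. adic_trunc R I k" and ?o = "\<lambda>k. ideal_power R I (k + 1) +>\<^bsub>R\<^esub> \<one>\<^bsub>R\<^esub>"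
  let ?T = "\<lambda>k. tensor R (adic_trunc R I k) M"
  let ?u = "\<lambda>k n. pure_tensor R (?A k) M (?o k) n"
  have A: "module R (?A k)" for k by (rule adic_trunc_module[OF R I])
  have o: "?o k \<in> carrier (?A k)" for k
    unfolding adic_trunc_simps(1)[OF R I] by (rule imageI[OF M.R.one_closed])
  have u: "?u k \<in> mod_hom R M (?T k)" for k by (rule pure_tensor_right_hom[OF A M o])
  have eq: "?u k n = ?u k n' \<longleftrightarrow> n \<ominus>\<^bsub>M\<^esub> n' \<in> ideal_smult R (ideal_power R I (k + 1)) M"
    if "n \<in> carrier M" "n' \<in> carrier M" for k n n'
    using adic_trunc_tensor_eq_zero_iff[OF R I M M.M.minus_closed[OF that], of k]
      mod_hom_minus[OF M tensor_module[OF A M] u that]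
      minus_add_cancel(3)[OF tensor_module[OF A M] mod_homD(1)[OF u that(1)] mod_homD(1)[OF u that(2)]]
    by simp
  \<comment> \<open>the index is shifted because the \<open>k\<close>-th truncation is the quotient by the power \<open>k + 1\<close> of \<open>I\<close>\<close>
  define x where "x = (\<lambda>k. ?u k (m (k + 1)))"
  have "tensor_map R (?A k) M (\<lambda>X. ideal_power R I (k + 1) <+>\<^bsub>R\<^esub> X) id (x (Suc k)) = x k" for k
  proof -
    have "tensor_map R (?A k) M (\<lambda>X. ideal_power R I (k + 1) <+>\<^bsub>R\<^esub> X) id (x (Suc k)) = ?u k (m (Suc (Suc k)))"
      unfolding x_def
      by (subst tensor_map_pure[OF A M A M adic_proj_hom[OF R I] mod_hom_id o m])
         (simp only: adic_proj_coset[OF R I M.R.one_closed, unfolded Suc_eq_plus1] id_apply Suc_eq_plus1)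
    also have "\<dots> = x k"
      unfolding x_def eq[OF m m] using cauchy[of "Suc k"] by simp
    finally show ?thesis .
  qed
  moreover have "x k \<in> carrier (?T k)" for k unfolding x_def by (rule mod_homD(1)[OF u m])
  ultimately have "x \<in> carrier (adic_completion R I M)"
    unfolding adic_completion_def inv_limit_def by simp
  moreover have "to_completion R I M ` carrier M = carrier (adic_completion R I M)"
    using iso unfolding mod_iso_def by (simp add: bij_betw_def)
  ultimately obtain n where n: "n \<in> carrier M" "to_completion R I M n = x" by (metis imageE)
  have "n \<ominus>\<^bsub>M\<^esub> m k \<in> ideal_smult R (ideal_power R I k) M" for k
  proof (cases k)
    case 0
    have "n \<ominus>\<^bsub>M\<^esub> m 0 = \<one>\<^bsub>R\<^esub> \<odot>\<^bsub>M\<^esub> (n \<ominus>\<^bsub>M\<^esub> m 0)" using n(1) m by simp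
    also have "\<dots> \<in> ideal_smult R (ideal_power R I 0) M"
      by (rule ideal_smult_submodule(2)[OF M ideal_power_ideal(1)[OF R I]])
         (use n(1) m in \<open>simp_all add: ideal_power_simps(1)[OF R I]\<close>)
    finally show ?thesis using 0 by simp
  next
    case (Suc j)
    have "?u j n = ?u j (m (j + 1))" using n(2) unfolding to_completion_def x_def by (rule fun_cong)
    thus ?thesis unfolding eq[OF n(1) m] Suc by simp
  qed
  thus ?thesis using n(1) by blast
qed

section \<open>Coordinates in a free module with coefficients\<close>

text \<open>The projections of \<open>R\<^sup>X \<otimes> M = M\<^sup>X\<close> to \<open>M\<close>, induced by the bilinear map \<open>(c, m) \<mapsto> c\<^sub>i m\<close>.\<close>

definition tensor_coord :: "('a, 'r) ring_scheme \<Rightarrow> ('a, 'm, 'x) module_scheme \<Rightarrow> 'i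
    \<Rightarrow> (('i \<Rightarrow> 'a) \<times> 'm \<Rightarrow> 'a) set \<Rightarrow> 'm" where
  "tensor_coord R M i = (\<lambda>T. the_elem (lin_ext R M (\<lambda>(c, m). c i \<odot>\<^bsub>M\<^esub> m) ` T))"

lemma tensor_coord:
  assumes M: "module R M"
  shows "tensor_coord R M i \<in> mod_hom R (tensor R (free_mod R X) M) M"
    and "c \<in> carrier (free_mod R X) \<Longrightarrow> m \<in> carrier M \<Longrightarrow>
      tensor_coord R M i (pure_tensor R (free_mod R X) M c m) = c i \<odot>\<^bsub>M\<^esub> m"
proof -
  interpret M: module R M by fact
  have F: "module R (free_mod R X)" by (rule free_mod_module[OF M.R.cring_axioms])
  note c = free_modD(1)[where R = R and X = X]
  have b: "bilinear_map R (free_mod R X) M M (\<lambda>c m. c i \<odot>\<^bsub>M\<^esub> m)"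
    unfolding bilinear_map_def
    by (intro conjI ballI; rule mod_homI)
       (simp_all add: c free_mod_simps M.smult_l_distr M.smult_r_distr M.smult_assoc1[symmetric] M.R.m_comm)
  show "tensor_coord R M i \<in> mod_hom R (tensor R (free_mod R X) M) M"
    unfolding tensor_coord_def by (rule tensor_universal(1)[OF F M M b])
  show "c \<in> carrier (free_mod R X) \<Longrightarrow> m \<in> carrier M \<Longrightarrow>
      tensor_coord R M i (pure_tensor R (free_mod R X) M c m) = c i \<odot>\<^bsub>M\<^esub> m"
    unfolding tensor_coord_def by (rule tensor_universal(2)[OF F M M b])
qed

lemma mod_hom_finsum:
  assumes K: "module R K" and N: "module R N" and f: "f \<in> mod_hom R K N" and "finite A"
    and "\<And>x. x \<in> A \<Longrightarrow> g x \<in> carrier K"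
  shows "f (\<Oplus>\<^bsub>K\<^esub>x\<in>A. g x) = (\<Oplus>\<^bsub>N\<^esub>x\<in>A. f (g x))"
proof -
  interpret K: module R K by fact
  interpret N: module R N by fact
  show ?thesis using assms(4,5)
  proof (induction A)
    case empty
    show ?case by (simp add: mod_hom_zero[OF K N f])
  next
    case (insert a A)
    thus ?case by (simp add: mod_homD[OF f] Pi_iff)
  qed
qed

definition from_coords :: "('a, 'r) ring_scheme \<Rightarrow> ('a, 'm, 'x) module_scheme \<Rightarrow> 'i set
    \<Rightarrow> ('i \<Rightarrow> 'm) \<Rightarrow> (('i \<Rightarrow> 'a) \<times> 'm \<Rightarrow> 'a) set" where
  "from_coords R M X v =
    (\<Oplus>\<^bsub>tensor R (free_mod R X) M\<^esub>i\<in>X. pure_tensor R (free_mod R X) M (basis_elt R i) (v i))"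

lemma from_coords_in_submodule:
  assumes M: "module R M" and X: "finite X" and H: "submodule H R (tensor R (free_mod R X) M)"
    and "\<And>i. i \<in> X \<Longrightarrow> pure_tensor R (free_mod R X) M (basis_elt R i) (v i) \<in> H"
  shows "from_coords R M X v \<in> H"
proof -
  interpret M: module R M by fact
  show ?thesis unfolding from_coords_def
    by (rule finsum_in_submodule[OF tensor_module[OF free_mod_module[OF M.R.cring_axioms] M] H X assms(4)])
qed

lemma from_coords_closed:
  assumes M: "module R M" and X: "finite X" and v: "\<And>i. i \<in> X \<Longrightarrow> v i \<in> carrier M"
  shows "from_coords R M X v \<in> carrier (tensor R (free_mod R X) M)"
proof -
  interpret M: module R M by fact
  note F = free_mod_module[OF M.R.cring_axioms, of X]
  show ?thesis
    by (rule from_coords_in_submodule[OF M X module.carrier_is_submodule[OF tensor_module[OF F M]]])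
       (intro pure_tensor_closed[OF F M] basis_elt_closed[OF M.R.cring_axioms] v)
qed

lemma tensor_coord_from_coords:
  assumes M: "module R M" and X: "finite X" and v: "\<And>i. i \<in> X \<Longrightarrow> v i \<in> carrier M" and j: "j \<in> X"
  shows "tensor_coord R M j (from_coords R M X v) = v j"
proof -
  interpret M: module R M by fact
  note R = M.R.cring_axioms
  note F = free_mod_module[OF R, of X]
  have p: "pure_tensor R (free_mod R X) M (basis_elt R i) (v i) \<in> carrier (tensor R (free_mod R X) M)"
    if "i \<in> X" for i
    by (intro pure_tensor_closed[OF F M] basis_elt_closed[OF R] v that)
  have "tensor_coord R M j (from_coords R M X v) =
      (\<Oplus>\<^bsub>M\<^esub>i\<in>X. tensor_coord R M j (pure_tensor R (free_mod R X) M (basis_elt R i) (v i)))"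
    unfolding from_coords_def by (rule mod_hom_finsum[OF tensor_module[OF F M] M tensor_coord(1)[OF M] X p])
  also have "\<dots> = (\<Oplus>\<^bsub>M\<^esub>i\<in>X. if j = i then v i else \<zero>\<^bsub>M\<^esub>)"
  proof (rule M.M.finsum_cong'[OF refl])
    fix i assume i: "i \<in> X"
    show "tensor_coord R M j (pure_tensor R (free_mod R X) M (basis_elt R i) (v i)) = (if j = i then v i else \<zero>\<^bsub>M\<^esub>)"
      using v[OF i] by (simp add: tensor_coord(2)[OF M basis_elt_closed[OF R i]]) (simp add: basis_elt_def)
  qed (use v in auto)
  also have "\<dots> = v j" by (rule M.M.add.finprod_singleton[OF j X]) (use v in blast)
  finally show ?thesis .
qed

lemma from_coords_tensor_coord:
  assumes M: "module R M" and X: "finite X" and t: "t \<in> carrier (tensor R (free_mod R X) M)"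
  shows "from_coords R M X (\<lambda>i. tensor_coord R M i t) = t"
proof -
  interpret M: module R M by fact
  note R = M.R.cring_axioms
  let ?F = "free_mod R X" and ?TF = "tensor R (free_mod R X) M"
  note F = free_mod_module[OF R, of X]
  note TF = tensor_module[OF F M]
  interpret TF: module R ?TF by (rule TF)
  note kD = mod_homD[OF tensor_coord(1)[OF M, of _ X]]
  have e: "basis_elt R i \<in> carrier ?F" if "i \<in> X" for i by (rule basis_elt_closed[OF R that])
  let ?P = "\<lambda>i t. pure_tensor R ?F M (basis_elt R i) (tensor_coord R M i t)"
  have P: "?P i s \<in> carrier ?TF" if "i \<in> X" "s \<in> carrier ?TF" for i s
    by (rule pure_tensor_closed[OF F M e[OF that(1)] kD(1)[OF that(2)]])
  let ?S = "\<lambda>t. from_coords R M X (\<lambda>i. tensor_coord R M i t)"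
  have S: "?S \<in> mod_hom R ?TF ?TF"
  proof (rule mod_homI)
    fix s assume s: "s \<in> carrier ?TF"
    show "?S s \<in> carrier ?TF" by (rule from_coords_closed[OF M X]) (rule kD(1)[OF s])
  next
    fix s s' assume s: "s \<in> carrier ?TF" "s' \<in> carrier ?TF"
    have "?S (s \<oplus>\<^bsub>?TF\<^esub> s') = (\<Oplus>\<^bsub>?TF\<^esub>i\<in>X. ?P i s \<oplus>\<^bsub>?TF\<^esub> ?P i s')"
      unfolding from_coords_def
      by (rule TF.M.finsum_cong'[OF refl])
         (use P s in \<open>simp_all add: kD pure_tensor_bilinear(2)[OF F M e]\<close>)
    also have "\<dots> = ?S s \<oplus>\<^bsub>?TF\<^esub> ?S s'"
      unfolding from_coords_def by (rule TF.M.finsum_addf) (use P s in blast)+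
    finally show "?S (s \<oplus>\<^bsub>?TF\<^esub> s') = ?S s \<oplus>\<^bsub>?TF\<^esub> ?S s'" .
  next
    fix r s assume r: "r \<in> carrier R" and s: "s \<in> carrier ?TF"
    have "?S (r \<odot>\<^bsub>?TF\<^esub> s) = (\<Oplus>\<^bsub>?TF\<^esub>i\<in>X. r \<odot>\<^bsub>?TF\<^esub> ?P i s)"
      unfolding from_coords_def
      by (rule TF.M.finsum_cong'[OF refl])
         (use P s r in \<open>simp_all add: kD pure_tensor_bilinear(4)[OF F M r e]\<close>)
    also have "\<dots> = r \<odot>\<^bsub>?TF\<^esub> ?S s"
      unfolding from_coords_def by (rule TF.finsum_smult_ldistr[OF X r, symmetric]) (use P s in blast)
    finally show "?S (r \<odot>\<^bsub>?TF\<^esub> s) = r \<odot>\<^bsub>?TF\<^esub> ?S s" .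
  qed
  have basis: "?S (pure_tensor R ?F M (basis_elt R i) m) = pure_tensor R ?F M (basis_elt R i) m"
    if i: "i \<in> X" and m: "m \<in> carrier M" for i m
  proof -
    have "?S (pure_tensor R ?F M (basis_elt R i) m) =
        (\<Oplus>\<^bsub>?TF\<^esub>j\<in>X. if i = j then pure_tensor R ?F M (basis_elt R j) m else \<zero>\<^bsub>?TF\<^esub>)"
      unfolding from_coords_def
    proof (rule TF.M.finsum_cong'[OF refl])
      fix j assume j: "j \<in> X"
      have "pure_tensor R ?F M (basis_elt R j) \<zero>\<^bsub>M\<^esub> = \<zero>\<^bsub>?TF\<^esub>"
        by (rule mod_hom_zero[OF M TF pure_tensor_right_hom[OF F M e[OF j]]])
      thus "pure_tensor R ?F M (basis_elt R j) (tensor_coord R M j (pure_tensor R ?F M (basis_elt R i) m)) =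
          (if i = j then pure_tensor R ?F M (basis_elt R j) m else \<zero>\<^bsub>?TF\<^esub>)"
        using m by (simp add: tensor_coord(2)[OF M e[OF i] m]) (simp add: basis_elt_def)
    qed (use pure_tensor_closed[OF F M e m] in auto)
    also have "\<dots> = pure_tensor R ?F M (basis_elt R i) m"
      by (rule TF.M.add.finprod_singleton[OF i X]) (use pure_tensor_closed[OF F M e m] in blast)
    finally show ?thesis .
  qed
  have id: "(\<lambda>t. t) \<in> mod_hom R ?TF ?TF" by (simp add: mod_hom_def)
  show ?thesis
  proof (rule tensor_hom_ext[OF F M TF S id _ t])
    fix c m assume c: "c \<in> carrier ?F" and m: "m \<in> carrier M"
    have l: "(\<lambda>c. pure_tensor R ?F M c m) \<in> mod_hom R ?F ?TF"
      by (rule mod_homI) (simp_all add: pure_tensor_closed[OF F M] pure_tensor_bilinear[OF F M] m)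
    show "?S (pure_tensor R ?F M c m) = pure_tensor R ?F M c m"
      by (rule free_hom_ext[OF R TF mod_hom_comp[OF l S] l _ c]) (rule basis[OF _ m])
  qed
qed

text \<open>Under \<open>R\<^sup>X \<otimes> M = M\<^sup>X\<close>, the submodule \<open>(J R\<^sup>X) M\<close> becomes \<open>(J M)\<^sup>X\<close>. Separation and convergence can thus be
  transferred from \<open>M\<close> to \<open>R\<^sup>X \<otimes> M\<close> coordinate by coordinate.\<close>

lemma tensor_part_coord_part_iff:
  assumes M: "module R M" and X: "finite X" and J: "ideal J R"
    and t: "t \<in> carrier (tensor R (free_mod R X) M)"
  shows "t \<in> tensor_part R (free_mod R X) M (coord_part R J X) \<longleftrightarrow>
    (\<forall>i\<in>X. tensor_coord R M i t \<in> ideal_smult R J M)" (is "_ \<in> ?P \<longleftrightarrow> _")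
proof
  interpret M: module R M by fact
  note R = M.R.cring_axioms
  let ?F = "free_mod R X" and ?TF = "tensor R (free_mod R X) M"
  note F = free_mod_module[OF R, of X]
  note TF = tensor_module[OF F M]
  interpret F: module R ?F by (rule F)
  note JM = ideal_smult_submodule[OF M J]
  have C: "coord_part R J X \<subseteq> carrier ?F" unfolding coord_part_def by blast
  note P = tensor_part_submodule[OF F M C]
  { assume tP: "t \<in> ?P"
    show "\<forall>i\<in>X. tensor_coord R M i t \<in> ideal_smult R J M"
    proof
      fix i
      have "t \<in> {t \<in> carrier ?TF. tensor_coord R M i t \<in> ideal_smult R J M}"
      proof (rule subsetD[OF tensor_part_least[OF F M vimage_submodule[OF TF M tensor_coord(1)[OF M] JM(1)]] tP])
        fix c m assume c: "c \<in> coord_part R J X" and m: "m \<in> carrier M"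
        have cc: "c \<in> carrier ?F" "c i \<in> J" using c unfolding coord_part_def by simp_all
        show "pure_tensor R ?F M c m \<in> {t \<in> carrier ?TF. tensor_coord R M i t \<in> ideal_smult R J M}"
          using pure_tensor_closed[OF F M cc(1) m] JM(2)[OF cc(2) m] tensor_coord(2)[OF M cc(1) m, of i]
          by simp
      qed
      thus "tensor_coord R M i t \<in> ideal_smult R J M" by simp
    qed }
  { assume tJ: "\<forall>i\<in>X. tensor_coord R M i t \<in> ideal_smult R J M"
    have "from_coords R M X (\<lambda>i. tensor_coord R M i t) \<in> ?P"
    proof (rule from_coords_in_submodule[OF M X P])
      fix i assume i: "i \<in> X"
      note e = basis_elt_closed[OF R i]
      note V = vimage_submodule[OF M TF pure_tensor_right_hom[OF F M e] P]
      have "tensor_coord R M i t \<in> {m \<in> carrier M. pure_tensor R ?F M (basis_elt R i) m \<in> ?P}"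
      proof (rule subsetD[OF JM(3)[OF V] bspec[OF tJ i]])
        fix r m assume r: "r \<in> J" and m: "m \<in> carrier M"
        have rc: "r \<in> carrier R" by (rule idealD(1)[OF J r])
        have "r \<odot>\<^bsub>?F\<^esub> basis_elt R i \<in> coord_part R J X"
          using F.smult_closed[OF rc e] idealD(2)[OF J] r rc unfolding coord_part_def
          by (simp add: free_mod_simps basis_elt_def)
        from pure_in_tensor_part[OF F M C this m]
        have "pure_tensor R ?F M (basis_elt R i) (r \<odot>\<^bsub>M\<^esub> m) \<in> ?P"
          unfolding pure_tensor_bilinear(3)[OF F M rc e m] pure_tensor_bilinear(4)[OF F M rc e m] .
        thus "r \<odot>\<^bsub>M\<^esub> m \<in> {m \<in> carrier M. pure_tensor R ?F M (basis_elt R i) m \<in> ?P}" using rc m by simp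
      qed
      thus "pure_tensor R ?F M (basis_elt R i) (tensor_coord R M i t) \<in> ?P" by simp
    qed
    thus "t \<in> ?P" unfolding from_coords_tensor_coord[OF M X t] . }
qed

lemma tensor_free_separated:
  assumes R: "cring R" and I: "ideal I R" and compl: "adically_complete R I M" and X: "finite X"
    and t: "\<And>k. t \<in> tensor_part R (free_mod R X) M (coord_part R (ideal_power R I k) X)"
  shows "t = \<zero>\<^bsub>tensor R (free_mod R X) M\<^esub>"
proof -
  have M: "module R M" using compl unfolding adically_complete_def by simp
  let ?F = "free_mod R X" and ?TF = "tensor R (free_mod R X) M"
  note F = free_mod_module[OF R, of X]
  note TF = tensor_module[OF F M]
  have C: "coord_part R J X \<subseteq> carrier ?F" for J unfolding coord_part_def by blast
  have tc: "t \<in> carrier ?TF" by (rule submoduleD(1)[OF TF tensor_part_submodule[OF F M C] t])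
  have "tensor_coord R M i t = \<zero>\<^bsub>M\<^esub>" if i: "i \<in> X" for i
  proof (rule adically_complete_separated[OF R I compl])
    show "tensor_coord R M i t \<in> carrier M" by (rule mod_homD(1)[OF tensor_coord(1)[OF M] tc])
    show "tensor_coord R M i t \<in> ideal_smult R (ideal_power R I k) M" for k
      using t[of k] i unfolding tensor_part_coord_part_iff[OF M X ideal_power_ideal(1)[OF R I] tc] by blast
  qed
  hence "from_coords R M X (\<lambda>i. tensor_coord R M i t) \<in> {\<zero>\<^bsub>?TF\<^esub>}"
    by (intro from_coords_in_submodule[OF M X zero_submodule[OF TF]])
       (simp add: mod_hom_zero[OF M TF pure_tensor_right_hom[OF F M basis_elt_closed[OF R]]])
  thus ?thesis unfolding from_coords_tensor_coord[OF M X tc] by simp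
qed

lemma tensor_free_limit:
  assumes R: "cring R" and I: "ideal I R" and compl: "adically_complete R I M" and X: "finite X"
    and y: "\<And>k. y k \<in> carrier (tensor R (free_mod R X) M)"
    and cauchy: "\<And>k. y (Suc k) \<ominus>\<^bsub>tensor R (free_mod R X) M\<^esub> y k
      \<in> tensor_part R (free_mod R X) M (coord_part R (ideal_power R I k) X)"
  shows "\<exists>z\<in>carrier (tensor R (free_mod R X) M). \<forall>k. z \<ominus>\<^bsub>tensor R (free_mod R X) M\<^esub> y k
      \<in> tensor_part R (free_mod R X) M (coord_part R (ideal_power R I k) X)"
proof -
  have M: "module R M" using compl unfolding adically_complete_def by simp
  let ?F = "free_mod R X" and ?TF = "tensor R (free_mod R X) M" and ?k = "\<lambda>i. tensor_coord R M i"
  note F = free_mod_module[OF R, of X]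
  note TF = tensor_module[OF F M]
  interpret TF: module R ?TF by (rule TF)
  note k = tensor_coord(1)[OF M, where X = X]
  note iff = tensor_part_coord_part_iff[OF M X ideal_power_ideal(1)[OF R I]]
  have "\<forall>i\<in>X. \<exists>n. n \<in> carrier M \<and> (\<forall>k. n \<ominus>\<^bsub>M\<^esub> ?k i (y k) \<in> ideal_smult R (ideal_power R I k) M)"
  proof
    fix i assume i: "i \<in> X"
    have "?k i (y (Suc k)) \<ominus>\<^bsub>M\<^esub> ?k i (y k) \<in> ideal_smult R (ideal_power R I k) M" for k
      unfolding mod_hom_minus[OF TF M k y y, symmetric]
      by (rule bspec[OF iffD1[OF iff[OF TF.M.minus_closed[OF y y]] cauchy] i])
    from adically_complete_limit[OF R I compl mod_homD(1)[OF k y] this]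
    show "\<exists>n. n \<in> carrier M \<and> (\<forall>k. n \<ominus>\<^bsub>M\<^esub> ?k i (y k) \<in> ideal_smult R (ideal_power R I k) M)" by blast
  qed
  from bchoice[OF this] obtain n where n: "\<forall>i\<in>X. n i \<in> carrier M \<and>
    (\<forall>k. n i \<ominus>\<^bsub>M\<^esub> ?k i (y k) \<in> ideal_smult R (ideal_power R I k) M)" ..
  have nc: "n i \<in> carrier M" if "i \<in> X" for i using n that by blast
  let ?z = "from_coords R M X n"
  have z: "?z \<in> carrier ?TF" by (rule from_coords_closed[OF M X nc])
  have "?z \<ominus>\<^bsub>?TF\<^esub> y k \<in> tensor_part R ?F M (coord_part R (ideal_power R I k) X)" for k
    unfolding iff[OF TF.M.minus_closed[OF z y]]
  proof
    fix i assume i: "i \<in> X"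
    show "?k i (?z \<ominus>\<^bsub>?TF\<^esub> y k) \<in> ideal_smult R (ideal_power R I k) M"
    proof -
      have "?k i ?z = n i" by (rule tensor_coord_from_coords[OF M X _ i]) (rule nc)
      thus ?thesis unfolding mod_hom_minus[OF TF M k z y] using n i by simp
    qed
  qed
  thus ?thesis using z by blast
qed

section \<open>Relations over an adically flat and complete module\<close>

lemma minus_diff:
  assumes "module R M" "x \<in> carrier M" "y \<in> carrier M" "z \<in> carrier M"
  shows "(x \<ominus>\<^bsub>M\<^esub> y) \<ominus>\<^bsub>M\<^esub> (x \<ominus>\<^bsub>M\<^esub> z) = z \<ominus>\<^bsub>M\<^esub> y"
    and "(x \<ominus>\<^bsub>M\<^esub> y) \<ominus>\<^bsub>M\<^esub> (z \<ominus>\<^bsub>M\<^esub> y) = x \<ominus>\<^bsub>M\<^esub> z"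
proof -
  interpret M: module R M by fact
  have "(z \<ominus>\<^bsub>M\<^esub> y) \<oplus>\<^bsub>M\<^esub> (x \<ominus>\<^bsub>M\<^esub> z) = ((x \<ominus>\<^bsub>M\<^esub> z) \<oplus>\<^bsub>M\<^esub> z) \<oplus>\<^bsub>M\<^esub> (\<ominus>\<^bsub>M\<^esub> y)"
    using assms by (simp add: a_minus_def M.M.a_ac)
  hence "(x \<ominus>\<^bsub>M\<^esub> y) = (z \<ominus>\<^bsub>M\<^esub> y) \<oplus>\<^bsub>M\<^esub> (x \<ominus>\<^bsub>M\<^esub> z)"
    unfolding minus_add_cancel(1)[OF assms(1,2,4)] by (simp add: a_minus_def)
  thus "(x \<ominus>\<^bsub>M\<^esub> y) \<ominus>\<^bsub>M\<^esub> (x \<ominus>\<^bsub>M\<^esub> z) = z \<ominus>\<^bsub>M\<^esub> y"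
    "(x \<ominus>\<^bsub>M\<^esub> y) \<ominus>\<^bsub>M\<^esub> (z \<ominus>\<^bsub>M\<^esub> y) = x \<ominus>\<^bsub>M\<^esub> z"
    using assms by (simp_all add: minus_add_cancel(4,5)[OF assms(1)])
qed

lemma free_hom_coord_part:
  assumes R: "cring R" and J: "ideal J R" and h: "h \<in> mod_hom R (free_mod R X) (free_mod R Y)"
    and c: "c \<in> coord_part R J X"
  shows "h c \<in> coord_part R J Y"
proof -
  note F = free_mod_module[OF R, of X] and G = free_mod_module[OF R, of Y]
  interpret G: module R "free_mod R Y" by (rule G)
  have cc: "c \<in> carrier (free_mod R X)" and cJ: "c x \<in> J" for x using c unfolding coord_part_def by auto
  let ?e = "\<lambda>x. h (basis_elt R x)"
  have e: "?e x \<in> carrier (free_mod R Y)" if "x \<in> X" for x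
    by (rule mod_homD(1)[OF h basis_elt_closed[OF R that]])
  have "lin_ext R (free_mod R Y) ?e \<in> mod_hom R (free_mod R X) (free_mod R Y)"
    by (rule lin_ext_hom[OF R G]) (use e in blast)
  from free_hom_ext[OF R G h this _ cc] have "h c = lin_ext R (free_mod R Y) ?e c"
    using lin_ext_basis_elt[OF R G, of ?e] e by simp
  also have "\<dots> \<in> coord_part R J Y"
    unfolding lin_ext_def
  proof (rule finsum_in_submodule[OF G coord_part_submodule[OF R J] free_modD(2)[OF cc]])
    fix x assume "x \<in> {x. c x \<noteq> \<zero>\<^bsub>R\<^esub>}"
    hence x: "x \<in> X" using free_modD(3)[OF cc] by blast
    show "c x \<odot>\<^bsub>free_mod R Y\<^esub> ?e x \<in> coord_part R J Y"
      using G.smult_closed[OF idealD(1)[OF J cJ] e[OF x]] idealD(5)[OF J free_modD(1)[OF e[OF x]] cJ]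
      unfolding coord_part_def by (simp add: free_mod_simps)
  qed
  finally show ?thesis .
qed

text \<open>Cover \<open>ker h\<close> by a finite free module, \<open>B : R\<^sup>P \<rightarrow> R\<^sup>X\<close>. Applied to \<open>h\<close>, the Artin-Rees property of tensor
  products shows that \<open>t\<close> is a limit of elements of the image of \<open>B \<otimes> M\<close>. Applied to \<open>B\<close>, it shows that
  small elements of this image have small preimages. So the preimages of the approximations can be
  chosen to form a Cauchy sequence. Its limit exists because \<open>M\<close> is complete, and it is a preimage of
  \<open>t\<close> because \<open>M\<close> is separated.\<close>

theorem tensor_kernel_free:
  fixes R :: "('a, 'r) ring_scheme" and X :: "'x set" and Y :: "'y set"
  assumes R: "cring R" and No: "noetherian_ring R" and I: "ideal I R"
    and flat: "adically_flat TYPE('a list set) R I M" and compl: "adically_complete R I M"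
    and X: "finite X" and Y: "finite Y" and h: "h \<in> mod_hom R (free_mod R X) (free_mod R Y)"
    and t: "t \<in> carrier (tensor R (free_mod R X) M)"
    and ht: "tensor_map R (free_mod R Y) M h id t = \<zero>\<^bsub>tensor R (free_mod R Y) M\<^esub>"
  shows "t \<in> tensor_part R (free_mod R X) M {x \<in> carrier (free_mod R X). h x = \<zero>\<^bsub>free_mod R Y\<^esub>}"
proof -
  have M: "module R M" using compl unfolding adically_complete_def by simp
  let ?F = "free_mod R X" and ?G = "free_mod R Y" and ?K = "{x \<in> carrier (free_mod R X). h x = \<zero>\<^bsub>free_mod R Y\<^esub>}"
  have F: "module R ?F" and G: "module R ?G" by (rule free_mod_module[OF R])+
  have K: "submodule ?K R ?F"
    using vimage_submodule[OF F G h zero_submodule[OF G]] by simp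
  obtain P where P: "finite P" "P \<subseteq> ?K" and e: "lin_ext R ?F (\<lambda>c. c) \<in> mod_hom R (free_mod R P) ?F"
    and im: "lin_ext R ?F (\<lambda>c. c) ` carrier (free_mod R P) = ?K"
    by (rule free_submodule_image[OF R No X K])
  define B where "B = lin_ext R ?F (\<lambda>c. c)"
  note e = e[folded B_def] and im = im[folded B_def]
  let ?E = "free_mod R P"
  have E: "module R ?E" by (rule free_mod_module[OF R])
  let ?TE = "tensor R ?E M" and ?TF = "tensor R ?F M" and ?BM = "tensor_map R ?F M B id"
  have TE: "module R ?TE" and TF: "module R ?TF" by (intro tensor_module E F M)+
  interpret TE: module R ?TE by (rule TE)
  interpret TF: module R ?TF by (rule TF)
  have BM: "?BM \<in> mod_hom R ?TE ?TF" by (rule tensor_map_hom[OF E M F M e mod_hom_id])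
  note BD = mod_homD[OF BM]
  let ?CE = "\<lambda>k. tensor_part R ?E M (coord_part R (ideal_power R I k) P)"
  let ?CF = "\<lambda>k. tensor_part R ?F M (coord_part R (ideal_power R I k) X)"
  have cE: "coord_part R J P \<subseteq> carrier ?E" and cF: "coord_part R J X \<subseteq> carrier ?F" for J
    unfolding coord_part_def by blast+
  have CE: "submodule (?CE k) R ?TE" and CF: "submodule (?CF k) R ?TF" for k
    by (rule tensor_part_submodule[OF E M cE], rule tensor_part_submodule[OF F M cF])
  note CED = submoduleD[OF TE CE] and CFD = submoduleD[OF TF CF]
  have CF_mono: "?CF l \<subseteq> ?CF k" if "k \<le> l" for k l
    by (rule tensor_part_mono) (use ideal_power_antimono[OF R I that] in \<open>auto simp: coord_part_def\<close>)
  have BC: "?BM s \<in> ?CF k" if "s \<in> ?CE k" for s k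
    by (rule tensor_part_image[OF E M F e cE _ cF that])
       (use free_hom_coord_part[OF R ideal_power_ideal(1)[OF R I] e] in blast)
  \<comment> \<open>\<open>t\<close> lies in the closure of the image of \<open>B \<otimes> M\<close>\<close>
  have approx: "\<exists>y\<in>carrier ?TE. t \<ominus>\<^bsub>?TF\<^esub> ?BM y \<in> ?CF k" for k
  proof -
    from tensor_artin_rees[OF R No I M flat Y h, of k] obtain l where l:
      "\<forall>t\<in>carrier ?TF. tensor_map R ?G M h id t \<in> tensor_part R ?G M (coord_part R (ideal_power R I l) Y) \<longrightarrow>
        (\<exists>s\<in>?CF k. \<exists>w\<in>tensor_part R ?F M ?K. t = s \<oplus>\<^bsub>?TF\<^esub> w)" by (elim exE)
    have "tensor_map R ?G M h id t \<in> tensor_part R ?G M (coord_part R (ideal_power R I l) Y)"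
      unfolding ht by (rule tensor_part.zero)
    from l[rule_format, OF t this] obtain s w where sw: "s \<in> ?CF k" "w \<in> tensor_part R ?F M ?K" "t = s \<oplus>\<^bsub>?TF\<^esub> w"
      by (elim bexE)
    have img: "submodule (?BM ` carrier ?TE) R ?TF"
      by (rule image_submodule[OF TE TF BM TE.carrier_is_submodule])
    have "w \<in> ?BM ` carrier ?TE"
    proof (rule subsetD[OF tensor_part_least[OF F M img] sw(2)])
      fix c m assume c: "c \<in> ?K" and m: "m \<in> carrier M"
      from c obtain d where d: "d \<in> carrier ?E" "c = B d" unfolding im[symmetric] by (elim imageE)
      have "pure_tensor R ?F M c m = ?BM (pure_tensor R ?E M d m)"
        unfolding d(2) by (simp only: tensor_map_pure[OF E M F M e mod_hom_id d(1) m] id_apply)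
      thus "pure_tensor R ?F M c m \<in> ?BM ` carrier ?TE"
        by (rule image_eqI) (rule pure_tensor_closed[OF E M d(1) m])
    qed
    then obtain y where y: "y \<in> carrier ?TE" "w = ?BM y" by (elim imageE)
    have "t \<ominus>\<^bsub>?TF\<^esub> ?BM y = s"
      unfolding sw(3) y(2) by (rule minus_add_cancel(4)[OF TF CFD(1)[OF sw(1)] BD(1)[OF y(1)]])
    thus ?thesis using y(1) sw(1) by (intro bexI[of _ y]) simp_all
  qed
  \<comment> \<open>\<open>B \<otimes> M\<close> is open onto its image, with explicit moduli \<open>l\<close>\<close>
  have "\<forall>k. \<exists>l. \<forall>s\<in>carrier ?TE. ?BM s \<in> ?CF l \<longrightarrow> (\<exists>a\<in>?CE k. \<exists>b\<in>carrier ?TE. s = a \<oplus>\<^bsub>?TE\<^esub> b \<and> ?BM b = \<zero>\<^bsub>?TF\<^esub>)"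
  proof
    fix k
    let ?N = "{x \<in> carrier ?E. B x = \<zero>\<^bsub>?F\<^esub>}"
    from tensor_artin_rees[OF R No I M flat X e, of k] obtain l where l:
      "\<forall>t\<in>carrier ?TE. ?BM t \<in> ?CF l \<longrightarrow> (\<exists>s\<in>?CE k. \<exists>w\<in>tensor_part R ?E M ?N. t = s \<oplus>\<^bsub>?TE\<^esub> w)" by (elim exE)
    have ker: "tensor_part R ?E M ?N \<subseteq> {s \<in> carrier ?TE. ?BM s \<in> {\<zero>\<^bsub>?TF\<^esub>}}"
    proof (rule tensor_part_least[OF E M vimage_submodule[OF TE TF BM zero_submodule[OF TF]]])
      fix c m assume c: "c \<in> ?N" and m: "m \<in> carrier M"
      have "?BM (pure_tensor R ?E M c m) = pure_tensor R ?F M (B c) (id m)"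
        by (rule tensor_map_pure[OF E M F M e mod_hom_id _ m]) (use c in simp)
      also have "\<dots> = \<zero>\<^bsub>?TF\<^esub>" using c pure_tensor_zero[OF F M m] by simp
      finally show "pure_tensor R ?E M c m \<in> {s \<in> carrier ?TE. ?BM s \<in> {\<zero>\<^bsub>?TF\<^esub>}}"
        using pure_tensor_closed[OF E M _ m, of c] c by simp
    qed
    show "\<exists>l. \<forall>s\<in>carrier ?TE. ?BM s \<in> ?CF l \<longrightarrow> (\<exists>a\<in>?CE k. \<exists>b\<in>carrier ?TE. s = a \<oplus>\<^bsub>?TE\<^esub> b \<and> ?BM b = \<zero>\<^bsub>?TF\<^esub>)"
    proof (intro exI[of _ l] ballI impI)
      fix s assume "s \<in> carrier ?TE" "?BM s \<in> ?CF l"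
      from l[rule_format, OF this] obtain a b where ab: "a \<in> ?CE k" "b \<in> tensor_part R ?E M ?N" "s = a \<oplus>\<^bsub>?TE\<^esub> b"
        by (elim bexE)
      from subsetD[OF ker ab(2)] have "b \<in> carrier ?TE" "?BM b = \<zero>\<^bsub>?TF\<^esub>" by simp_all
      thus "\<exists>a\<in>?CE k. \<exists>b\<in>carrier ?TE. s = a \<oplus>\<^bsub>?TE\<^esub> b \<and> ?BM b = \<zero>\<^bsub>?TF\<^esub>"
        using ab by (intro bexI conjI)
    qed
  qed
  from choice[OF this] obtain l where l: "\<forall>k. \<forall>s\<in>carrier ?TE. ?BM s \<in> ?CF (l k) \<longrightarrow>
    (\<exists>a\<in>?CE k. \<exists>b\<in>carrier ?TE. s = a \<oplus>\<^bsub>?TE\<^esub> b \<and> ?BM b = \<zero>\<^bsub>?TF\<^esub>)" ..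
  \<comment> \<open>an increasing sequence that dominates both \<open>l\<close> and the identity\<close>
  define L where "L = (\<lambda>k. \<Sum>i\<le>k. l i + i)"
  have L: "L k \<le> L (Suc k)" "l k \<le> L k" "k \<le> L k" for k
    unfolding L_def using member_le_sum[of k "{..k}" "\<lambda>i. l i + i"] by auto
  \<comment> \<open>a better approximation differs from \<open>y\<close> by a small element \<open>a\<close> and an element \<open>b\<close> of the kernel, which
    may be dropped\<close>
  have step: "\<exists>y'\<in>carrier ?TE. t \<ominus>\<^bsub>?TF\<^esub> ?BM y' \<in> ?CF (L (Suc k)) \<and> y' \<ominus>\<^bsub>?TE\<^esub> y \<in> ?CE k"
    if y: "y \<in> carrier ?TE" "t \<ominus>\<^bsub>?TF\<^esub> ?BM y \<in> ?CF (L k)" for y k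
  proof -
    from approx[of "L (Suc k)"] obtain y' where y': "y' \<in> carrier ?TE" "t \<ominus>\<^bsub>?TF\<^esub> ?BM y' \<in> ?CF (L (Suc k))"
      by (elim bexE)
    have yy: "y' \<ominus>\<^bsub>?TE\<^esub> y \<in> carrier ?TE" using y y' by simp
    have "(t \<ominus>\<^bsub>?TF\<^esub> ?BM y) \<ominus>\<^bsub>?TF\<^esub> (t \<ominus>\<^bsub>?TF\<^esub> ?BM y') \<in> ?CF (L k)"
      by (rule CFD(6)[OF y(2) subsetD[OF CF_mono[OF L(1)] y'(2)]])
    also have "(t \<ominus>\<^bsub>?TF\<^esub> ?BM y) \<ominus>\<^bsub>?TF\<^esub> (t \<ominus>\<^bsub>?TF\<^esub> ?BM y') = ?BM (y' \<ominus>\<^bsub>?TE\<^esub> y)"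
      using minus_diff(1)[OF TF t BD(1)[OF y(1)] BD(1)[OF y'(1)]] mod_hom_minus[OF TE TF BM y'(1) y(1)] by simp
    finally have "?BM (y' \<ominus>\<^bsub>?TE\<^esub> y) \<in> ?CF (l k)" by (rule subsetD[OF CF_mono[OF L(2)]])
    from l[rule_format, OF yy this] obtain a b where ab: "a \<in> ?CE k" "b \<in> carrier ?TE" "y' \<ominus>\<^bsub>?TE\<^esub> y = a \<oplus>\<^bsub>?TE\<^esub> b"
      "?BM b = \<zero>\<^bsub>?TF\<^esub>" by (elim bexE conjE)
    have ac: "a \<in> carrier ?TE" by (rule CED(1)[OF ab(1)])
    have "y' = y \<oplus>\<^bsub>?TE\<^esub> (a \<oplus>\<^bsub>?TE\<^esub> b)" unfolding ab(3)[symmetric] by (rule minus_add_cancel(2)[OF TE y'(1) y(1), symmetric])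
    hence "y' = (y \<oplus>\<^bsub>?TE\<^esub> a) \<oplus>\<^bsub>?TE\<^esub> b" using y(1) ac ab(2) by (simp add: TE.M.a_assoc)
    hence "?BM y' = ?BM (y \<oplus>\<^bsub>?TE\<^esub> a)" using y(1) ac ab(2,4) BD by simp
    moreover have "(y \<oplus>\<^bsub>?TE\<^esub> a) \<ominus>\<^bsub>?TE\<^esub> y = a" by (rule minus_add_cancel(5)[OF TE ac y(1)])
    ultimately show ?thesis using y'(2) ab(1) y(1) ac by (intro bexI[of _ "y \<oplus>\<^bsub>?TE\<^esub> a"]) simp_all
  qed
  have "\<exists>y. \<forall>k. (y k \<in> carrier ?TE \<and> t \<ominus>\<^bsub>?TF\<^esub> ?BM (y k) \<in> ?CF (L k)) \<and> y (Suc k) \<ominus>\<^bsub>?TE\<^esub> y k \<in> ?CE k"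
  proof (rule dependent_nat_choice)
    show "\<exists>y. y \<in> carrier ?TE \<and> t \<ominus>\<^bsub>?TF\<^esub> ?BM y \<in> ?CF (L 0)" using approx[of "L 0"] by (elim bexE) blast
    show "\<exists>y'. (y' \<in> carrier ?TE \<and> t \<ominus>\<^bsub>?TF\<^esub> ?BM y' \<in> ?CF (L (Suc k))) \<and> y' \<ominus>\<^bsub>?TE\<^esub> y \<in> ?CE k"
      if "y \<in> carrier ?TE \<and> t \<ominus>\<^bsub>?TF\<^esub> ?BM y \<in> ?CF (L k)" for y k
      using step[of y k] that by blast
  qed
  then obtain y where y: "\<And>k. y k \<in> carrier ?TE" "\<And>k. t \<ominus>\<^bsub>?TF\<^esub> ?BM (y k) \<in> ?CF (L k)"
    "\<And>k. y (Suc k) \<ominus>\<^bsub>?TE\<^esub> y k \<in> ?CE k" by blast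
  from tensor_free_limit[OF R I compl P(1) y(1,3)] obtain z where z: "z \<in> carrier ?TE"
    "\<forall>k. z \<ominus>\<^bsub>?TE\<^esub> y k \<in> ?CE k" by (elim bexE)
  have "t \<ominus>\<^bsub>?TF\<^esub> ?BM z \<in> ?CF k" for k
  proof -
    have "(t \<ominus>\<^bsub>?TF\<^esub> ?BM (y k)) \<ominus>\<^bsub>?TF\<^esub> ?BM (z \<ominus>\<^bsub>?TE\<^esub> y k) \<in> ?CF k"
      by (rule CFD(6)[OF subsetD[OF CF_mono[OF L(3)] y(2)] BC[OF z(2)[rule_format]]])
    also have "(t \<ominus>\<^bsub>?TF\<^esub> ?BM (y k)) \<ominus>\<^bsub>?TF\<^esub> ?BM (z \<ominus>\<^bsub>?TE\<^esub> y k) = t \<ominus>\<^bsub>?TF\<^esub> ?BM z"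
      using minus_diff(2)[OF TF t BD(1)[OF y(1)] BD(1)[OF z(1)]] mod_hom_minus[OF TE TF BM z(1) y(1)] by simp
    finally show ?thesis .
  qed
  from tensor_free_separated[OF R I compl X this] have "t = ?BM z"
    unfolding minus_add_cancel(3)[OF TF t BD(1)[OF z(1)]] .
  also have "?BM z \<in> tensor_part R ?F M ?K"
    by (rule tensor_part_image[OF E M F e subset_refl])
       (use im z(1) in \<open>auto simp: tensor_part_carrier[OF E M]\<close>)
  finally show ?thesis .
qed

section \<open>Flatness against arbitrary modules\<close>

lemma tensor_map_surj:
  assumes F: "module R F" and L: "module R L" and M: "module R M" and p: "p \<in> mod_hom R F L"
    and surj: "p ` carrier F = carrier L"
  shows "tensor_map R L M p id ` carrier (tensor R F M) = carrier (tensor R L M)"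
proof
  note TF = tensor_module[OF F M] and TL = tensor_module[OF L M]
  note pM = tensor_map_hom[OF F M L M p mod_hom_id]
  show "tensor_map R L M p id ` carrier (tensor R F M) \<subseteq> carrier (tensor R L M)"
    by (rule image_subsetI) (rule mod_homD(1)[OF pM])
  have im: "submodule (tensor_map R L M p id ` carrier (tensor R F M)) R (tensor R L M)"
    by (rule image_submodule[OF TF TL pM module.carrier_is_submodule[OF TF]])
  show "carrier (tensor R L M) \<subseteq> tensor_map R L M p id ` carrier (tensor R F M)"
    unfolding tensor_part_carrier[OF L M, symmetric]
  proof (rule tensor_part_least[OF L M im])
    fix l m assume "l \<in> carrier L" and m: "m \<in> carrier M"
    then obtain c where c: "c \<in> carrier F" "l = p c" unfolding surj[symmetric] by (elim imageE)
    have "pure_tensor R L M l m = tensor_map R L M p id (pure_tensor R F M c m)"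
      by (simp only: c(2) tensor_map_pure[OF F M L M p mod_hom_id c(1) m] id_apply)
    thus "pure_tensor R L M l m \<in> tensor_map R L M p id ` carrier (tensor R F M)"
      by (rule image_eqI) (rule pure_tensor_closed[OF F M c(1) m])
  qed
qed

lemma tensor_part_kernel_subset:
  assumes F: "module R F" and L: "module R L" and M: "module R M" and p: "p \<in> mod_hom R F L"
    and t: "t \<in> tensor_part R F M {c \<in> carrier F. p c = \<zero>\<^bsub>L\<^esub>}"
  shows "tensor_map R L M p id t = \<zero>\<^bsub>tensor R L M\<^esub>"
proof -
  note TF = tensor_module[OF F M] and TL = tensor_module[OF L M]
  note pM = tensor_map_hom[OF F M L M p mod_hom_id]
  have "t \<in> {t \<in> carrier (tensor R F M). tensor_map R L M p id t \<in> {\<zero>\<^bsub>tensor R L M\<^esub>}}"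
  proof (rule subsetD[OF tensor_part_least[OF F M vimage_submodule[OF TF TL pM zero_submodule[OF TL]]] t])
    fix c m assume "c \<in> {c \<in> carrier F. p c = \<zero>\<^bsub>L\<^esub>}" and m: "m \<in> carrier M"
    hence c: "c \<in> carrier F" "p c = \<zero>\<^bsub>L\<^esub>" by simp_all
    have "tensor_map R L M p id (pure_tensor R F M c m) = \<zero>\<^bsub>tensor R L M\<^esub>"
      by (simp only: tensor_map_pure[OF F M L M p mod_hom_id c(1) m] c(2) id_apply pure_tensor_zero[OF L M m])
    thus "pure_tensor R F M c m \<in> {t \<in> carrier (tensor R F M). tensor_map R L M p id t \<in> {\<zero>\<^bsub>tensor R L M\<^esub>}}"
      using pure_tensor_closed[OF F M c(1) m] by simp
  qed
  thus ?thesis by simp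
qed

text \<open>Right exactness of the tensor product. Since \<open>p\<close> is onto, a section of \<open>p\<close> induces a map from \<open>L \<otimes> M\<close> to
  \<open>(F \<otimes> M) / (ker p) M\<close>, which recovers the class of \<open>t\<close> from its image.\<close>

lemma tensor_right_exact:
  assumes F: "module R F" and L: "module R L" and M: "module R M" and p: "p \<in> mod_hom R F L"
    and surj: "p ` carrier F = carrier L" and t: "t \<in> carrier (tensor R F M)"
    and pt: "tensor_map R L M p id t = \<zero>\<^bsub>tensor R L M\<^esub>"
  shows "t \<in> tensor_part R F M {c \<in> carrier F. p c = \<zero>\<^bsub>L\<^esub>}" (is "_ \<in> tensor_part R F M ?K")
proof -
  interpret F: module R F by fact
  interpret L: module R L by fact
  interpret M: module R M by fact
  let ?TF = "tensor R F M" and ?TL = "tensor R L M" and ?KM = "tensor_part R F M ?K"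
  note TF = tensor_module[OF F M] and TL = tensor_module[OF L M]
  interpret TF: module R ?TF by (rule TF)
  note pM = tensor_map_hom[OF F M L M p mod_hom_id] and pD = mod_homD[OF p]
  note bil = pure_tensor_bilinear[OF F M] and pc = pure_tensor_closed[OF F M]
  have K: "?K \<subseteq> carrier F" by blast
  have KM: "submodule ?KM R ?TF" by (rule tensor_part_submodule[OF F M K])
  let ?Q = "quot_mod ?TF ?KM" and ?q = "\<lambda>t. ?KM +>\<^bsub>?TF\<^esub> t"
  have Q: "module R ?Q" by (rule quot_mod_module[OF TF KM])
  have q: "?q \<in> mod_hom R ?TF ?Q" by (rule quot_proj_hom[OF TF KM])
  note qD = mod_homD[OF q]
  define s where "s = inv_into (carrier F) p"
  have s: "s l \<in> carrier F" "p (s l) = l" if "l \<in> carrier L" for l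
    using that unfolding s_def surj[symmetric] by (rule inv_into_into, rule f_inv_into_f)
  \<comment> \<open>the inverse of \<open>F \<otimes> M / KM \<rightarrow> L \<otimes> M\<close>, on pure tensors\<close>
  define b where "b = (\<lambda>l m. ?q (pure_tensor R F M (s l) m))"
  have b: "b (p c) m = ?q (pure_tensor R F M c m)" if c: "c \<in> carrier F" and m: "m \<in> carrier M" for c m
  proof -
    note s' = s[OF pD(1)[OF c]]
    let ?d = "s (p c) \<ominus>\<^bsub>F\<^esub> c"
    have d: "?d \<in> carrier F" using s' c by simp
    have "p ?d = \<zero>\<^bsub>L\<^esub>"
      using s' c pD(1)[OF c] by (simp add: mod_hom_minus[OF F L p] minus_add_cancel(3)[OF L])
    hence dK: "pure_tensor R F M ?d m \<in> ?KM" using d by (intro pure_in_tensor_part[OF F M K _ m]) simp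
    have "pure_tensor R F M (s (p c)) m = pure_tensor R F M (c \<oplus>\<^bsub>F\<^esub> ?d) m"
      unfolding minus_add_cancel(2)[OF F s'(1) c] ..
    also have "\<dots> = pure_tensor R F M c m \<oplus>\<^bsub>?TF\<^esub> pure_tensor R F M ?d m" by (rule bil(1)[OF c d m])
    finally have "pure_tensor R F M (s (p c)) m \<ominus>\<^bsub>?TF\<^esub> pure_tensor R F M c m = pure_tensor R F M ?d m"
      using minus_add_cancel(5)[OF TF pc[OF d m] pc[OF c m]] by simp
    thus ?thesis unfolding b_def using dK by (simp add: quot_eq_iff[OF TF KM pc[OF s'(1) m] pc[OF c m]])
  qed
  have bilb: "bilinear_map R L M ?Q b"
    unfolding bilinear_map_def
  proof (intro conjI ballI)
    fix l assume "l \<in> carrier L"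
    then obtain c where c: "c \<in> carrier F" "l = p c" unfolding surj[symmetric] by (elim imageE)
    show "b l \<in> mod_hom R M ?Q"
      by (rule mod_homI) (simp_all only: c b M.M.a_closed M.smult_closed bil qD pc)
  next
    fix m assume m: "m \<in> carrier M"
    show "(\<lambda>l. b l m) \<in> mod_hom R L ?Q"
    proof (rule mod_homI)
      fix l assume "l \<in> carrier L"
      then obtain c where c: "c \<in> carrier F" "l = p c" unfolding surj[symmetric] by (elim imageE)
      show "b l m \<in> carrier ?Q" by (simp only: c b m qD pc)
    next
      fix l l' assume "l \<in> carrier L" "l' \<in> carrier L"
      then obtain c c' where c: "c \<in> carrier F" "l = p c" "c' \<in> carrier F" "l' = p c'"
        unfolding surj[symmetric] by (elim imageE)
      show "b (l \<oplus>\<^bsub>L\<^esub> l') m = b l m \<oplus>\<^bsub>?Q\<^esub> b l' m"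
        unfolding c(2,4) pD(2)[OF c(1,3), symmetric]
        by (simp only: c(1,3) b m qD pc F.M.a_closed bil)
    next
      fix r l assume r: "r \<in> carrier R" and "l \<in> carrier L"
      then obtain c where c: "c \<in> carrier F" "l = p c" unfolding surj[symmetric] by (elim imageE)
      show "b (r \<odot>\<^bsub>L\<^esub> l) m = r \<odot>\<^bsub>?Q\<^esub> b l m"
        unfolding c(2) pD(3)[OF r c(1), symmetric]
        by (simp only: c(1) r b m qD pc F.smult_closed bil)
    qed
  qed
  note H = tensor_universal[OF L M Q bilb]
  let ?H = "\<lambda>X. the_elem (lin_ext R ?Q (\<lambda>(m, n). b m n) ` X)"
  have "?H (tensor_map R L M p id t) = ?q t"
  proof (rule tensor_hom_ext[OF F M Q mod_hom_comp[OF pM H(1)] q _ t])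
    fix c m assume c: "c \<in> carrier F" and m: "m \<in> carrier M"
    have "?H (tensor_map R L M p id (pure_tensor R F M c m)) = ?H (pure_tensor R L M (p c) m)"
      by (simp only: tensor_map_pure[OF F M L M p mod_hom_id c m] id_apply)
    also have "\<dots> = ?q (pure_tensor R F M c m)" unfolding H(2)[OF pD(1)[OF c] m] by (rule b[OF c m])
    finally show "?H (tensor_map R L M p id (pure_tensor R F M c m)) = ?q (pure_tensor R F M c m)" .
  qed
  hence "?q t = \<zero>\<^bsub>?Q\<^esub>" unfolding pt mod_hom_zero[OF TL Q H(1)] by simp
  thus ?thesis unfolding quot_eq_zero_iff[OF TF KM t] .
qed

text \<open>An element of \<open>S M\<close> involves only finitely many members of \<open>S\<close>, and they can be taken as a basis.\<close>

lemma tensor_part_finite_source: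
  fixes F :: "('a, 'f, 'y) module_scheme"
  assumes R: "cring R" and F: "module R F" and M: "module R M" and S: "S \<subseteq> carrier F"
    and t: "t \<in> tensor_part R F M S"
  shows "\<exists>C z. finite C \<and> C \<subseteq> S \<and> z \<in> carrier (tensor R (free_mod R C) M) \<and>
    tensor_map R F M (lin_ext R F (\<lambda>c. c)) id z = t"
  using t
proof induction
  let ?E = "\<lambda>C :: 'f set. free_mod R C" and ?TE = "\<lambda>C :: 'f set. tensor R (free_mod R C) M" and ?TF = "tensor R F M"
  let ?o = "lin_ext R F (\<lambda>c. c)"
  have E: "module R (?E C)" for C :: "'f set" by (rule free_mod_module[OF R])
  note TE = tensor_module[OF E M] and TF = tensor_module[OF F M]
  have o: "?o \<in> mod_hom R (?E C) F" if "C \<subseteq> S" for C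
    by (rule lin_ext_hom[OF R F]) (use that S in auto)
  note oM = tensor_map_hom[OF E M F M o mod_hom_id]
  {
    case zero
    have "\<zero>\<^bsub>?TE {}\<^esub> \<in> carrier (?TE {})"
      by (rule abelian_monoid.zero_closed[OF abelian_group.axioms(1)[OF module.axioms(2)[OF TE]]])
    moreover have "tensor_map R F M ?o id \<zero>\<^bsub>?TE {}\<^esub> = \<zero>\<^bsub>?TF\<^esub>"
      by (rule mod_hom_zero[OF TE TF oM]) simp
    ultimately show ?case by (intro exI[of _ "{}"] exI[of _ "\<zero>\<^bsub>?TE {}\<^esub>"] conjI finite.emptyI empty_subsetI)
  next
    case (add c m t)
    then obtain C z where C: "finite C" "C \<subseteq> S" and z: "z \<in> carrier (?TE C)"
      "tensor_map R F M ?o id z = t" by (elim exE conjE)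
    let ?D = "insert c C"
    have D: "?D \<subseteq> S" using C add(1) by simp
    interpret T: module R "?TE ?D" by (rule TE)
    have i: "(\<lambda>c. c) \<in> mod_hom R (?E C) (?E ?D)" by (rule free_mod_incl_hom) blast
    note b = basis_elt_closed[OF R insertI1[of c C]]
    let ?z = "tensor_map R (?E ?D) M (\<lambda>c. c) id z"
    have z': "?z \<in> carrier (?TE ?D)" by (rule mod_homD(1)[OF tensor_map_hom[OF E M E M i mod_hom_id] z(1)])
    have p: "pure_tensor R (?E ?D) M (basis_elt R c) m \<in> carrier (?TE ?D)"
      by (rule pure_tensor_closed[OF E M b add(2)])
    have cF: "c \<in> carrier F" using add(1) S by blast
    have oc: "?o (basis_elt R c) = c" by (rule lin_ext_basis_elt[OF R F]) (rule cF)
    have "tensor_map R F M ?o id (pure_tensor R (?E ?D) M (basis_elt R c) m \<oplus>\<^bsub>?TE ?D\<^esub> ?z) =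
        tensor_map R F M ?o id (pure_tensor R (?E ?D) M (basis_elt R c) m) \<oplus>\<^bsub>?TF\<^esub> tensor_map R F M ?o id ?z"
      by (rule mod_homD(2)[OF oM[OF D] p z'])
    also have "tensor_map R F M ?o id ?z = t"
      unfolding tensor_map_comp[OF E M E F i o[OF D] z(1)] by (rule z(2))
    also have "tensor_map R F M ?o id (pure_tensor R (?E ?D) M (basis_elt R c) m) = pure_tensor R F M c m"
      by (simp only: tensor_map_pure[OF E M F M o[OF D] mod_hom_id b add(2)] oc id_apply)
    finally show ?case
      by (intro exI[of _ ?D] exI[of _ "pure_tensor R (?E ?D) M (basis_elt R c) m \<oplus>\<^bsub>?TE ?D\<^esub> ?z"]
          conjI finite.insertI C(1) D T.M.a_closed[OF p z'])
  }
qed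

lemma tensor_map_cong:
  assumes F: "module R F" and M: "module R M" and G: "module R G"
    and f: "f \<in> mod_hom R F G" and g: "g \<in> mod_hom R F G"
    and eq: "\<And>c. c \<in> carrier F \<Longrightarrow> f c = g c" and t: "t \<in> carrier (tensor R F M)"
  shows "tensor_map R G M f id t = tensor_map R G M g id t"
  by (rule tensor_hom_ext[OF F M tensor_module[OF G M] tensor_map_hom[OF F M G M f mod_hom_id]
        tensor_map_hom[OF F M G M g mod_hom_id] _ t])
     (simp only: tensor_map_pure[OF F M G M f mod_hom_id] tensor_map_pure[OF F M G M g mod_hom_id] eq)

lemma tensor_map_ident:
  assumes F: "module R F" and M: "module R M" and f: "f \<in> mod_hom R F F"
    and eq: "\<And>c. c \<in> carrier F \<Longrightarrow> f c = c" and t: "t \<in> carrier (tensor R F M)"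
  shows "tensor_map R F M f id t = t"
proof -
  have "(\<lambda>t. t) \<in> mod_hom R (tensor R F M) (tensor R F M)" by (simp add: mod_hom_def)
  from tensor_hom_ext[OF F M tensor_module[OF F M] tensor_map_hom[OF F M F M f mod_hom_id] this _ t]
  show ?thesis by (simp only: tensor_map_pure[OF F M F M f mod_hom_id] eq id_apply)
qed

text \<open>The tautological presentation of \<open>N\<close>, with its elements as basis.\<close>

lemma free_cover:
  assumes N: "module R N"
  shows "lin_ext R N (\<lambda>n. n) \<in> mod_hom R (free_mod R (carrier N)) N"
    and "n \<in> carrier N \<Longrightarrow> lin_ext R N (\<lambda>n. n) (basis_elt R n) = n"
    and "lin_ext R N (\<lambda>n. n) ` carrier (free_mod R (carrier N)) = carrier N"
proof -
  interpret N: module R N by fact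
  let ?p = "lin_ext R N (\<lambda>n. n)"
  show hom: "?p \<in> mod_hom R (free_mod R (carrier N)) N"
    by (rule lin_ext_hom[OF N.R.cring_axioms N]) blast
  have b: "?p (basis_elt R n) = n" if "n \<in> carrier N" for n
    by (rule lin_ext_basis_elt[OF N.R.cring_axioms N]) (rule that)
  thus "n \<in> carrier N \<Longrightarrow> ?p (basis_elt R n) = n" .
  show "?p ` carrier (free_mod R (carrier N)) = carrier N"
  proof
    show "?p ` carrier (free_mod R (carrier N)) \<subseteq> carrier N"
      by (rule image_subsetI) (rule mod_homD(1)[OF hom])
    show "carrier N \<subseteq> ?p ` carrier (free_mod R (carrier N))"
    proof
      fix n assume n: "n \<in> carrier N"
      show "n \<in> ?p ` carrier (free_mod R (carrier N))"
        using imageI[OF basis_elt_closed[OF N.R.cring_axioms n], of ?p] unfolding b[OF n] .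
    qed
  qed
qed

lemma restrict_coords_hom:
  assumes R: "cring R" and f: "inj_on f X" "f ` X \<subseteq> Y"
  shows "(\<lambda>c x. if x \<in> X then c (f x) else \<zero>\<^bsub>R\<^esub>) \<in> mod_hom R (free_mod R Y) (free_mod R X)"
proof -
  interpret cring R by fact
  show ?thesis
  proof (rule mod_homI)
    fix c assume c: "c \<in> carrier (free_mod R Y)"
    show "(\<lambda>x. if x \<in> X then c (f x) else \<zero>\<^bsub>R\<^esub>) \<in> carrier (free_mod R X)"
    proof (rule free_modI[where A = "f -` {y. c y \<noteq> \<zero>\<^bsub>R\<^esub>} \<inter> X"])
      show "finite (f -` {y. c y \<noteq> \<zero>\<^bsub>R\<^esub>} \<inter> X)" by (rule finite_vimage_IntI[OF free_modD(2)[OF c] f(1)])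
    qed (use free_modD(1)[OF c] R in auto)
  qed (auto simp: free_mod_simps)
qed

text \<open>The reduction of flatness to relations between finitely many elements. Lift \<open>t\<close> to \<open>x\<close> in \<open>R\<^sup>K \<otimes> M\<close> and
  push \<open>x\<close> forward to \<open>R\<^sup>L \<otimes> M\<close> along \<open>f\<close>. By right exactness the result is a combination \<open>\<Sum> c \<otimes> z\<^sub>c\<close> of finitely
  many relations \<open>c\<close> that hold in \<open>L\<close>. Its coordinates outside \<open>f(K)\<close> vanish, which is a finite system of
  linear equations for the \<open>z\<^sub>c\<close>. By \<open>tensor_kernel_free\<close> the solutions in \<open>M\<close> are combinations of
  solutions in \<open>R\<close>, so that \<open>c\<close> may be replaced by relations supported in \<open>f(K)\<close>. As \<open>f\<close> is injective, these
  are relations in \<open>K\<close>, and \<open>x\<close> becomes \<open>0\<close> in \<open>K \<otimes> M\<close>.\<close>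

theorem tensor_map_injective_kernel_trivial:
  fixes R :: "('a, 'r) ring_scheme" and K :: "('a, 'k, 'y) module_scheme" and L :: "('a, 'l, 'z) module_scheme"
  assumes R: "cring R" and No: "noetherian_ring R" and I: "ideal I R"
    and flat: "adically_flat TYPE('a list set) R I M" and compl: "adically_complete R I M"
    and K: "module R K" and L: "module R L" and f: "f \<in> mod_hom R K L" and inj: "inj_on f (carrier K)"
    and t: "t \<in> carrier (tensor R K M)" and ft: "tensor_map R L M f id t = \<zero>\<^bsub>tensor R L M\<^esub>"
  shows "t = \<zero>\<^bsub>tensor R K M\<^esub>"
proof -
  have M: "module R M" using compl unfolding adically_complete_def by simp
  interpret K: module R K by fact
  interpret L: module R L by fact
  let ?AK = "free_mod R (carrier K)" and ?AL = "free_mod R (carrier L)"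
  let ?pK = "lin_ext R K (\<lambda>k. k)" and ?pL = "lin_ext R L (\<lambda>l. l)"
  have AK: "module R ?AK" and AL: "module R ?AL" by (rule free_mod_module[OF R])+
  note fD = mod_homD[OF f]
  note pK = free_cover(1)[OF K] and pL = free_cover(1)[OF L]
    and surjK = free_cover(3)[OF K] and surjL = free_cover(3)[OF L]
    and pK_b = free_cover(2)[OF K] and pL_b = free_cover(2)[OF L]
  define F where "F = lin_ext R ?AL (\<lambda>k. basis_elt R (f k))"
  have F: "F \<in> mod_hom R ?AK ?AL"
    unfolding F_def by (rule lin_ext_hom[OF R AL]) (intro Pi_I basis_elt_closed[OF R] fD(1))
  have F_b: "F (basis_elt R k) = basis_elt R (f k)" if "k \<in> carrier K" for k
    unfolding F_def by (rule lin_ext_basis_elt[OF R AL]) (rule basis_elt_closed[OF R fD(1)[OF that]])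
  have pF: "?pL (F c) = f (?pK c)" if "c \<in> carrier ?AK" for c
    by (rule free_hom_ext[OF R L mod_hom_comp[OF F pL] mod_hom_comp[OF pK f] _ that])
       (simp only: F_b pL_b pK_b fD)
  \<comment> \<open>restriction of coordinates to \<open>K\<close>, a left inverse of the push-forward \<open>F\<close>\<close>
  define \<rho> where "\<rho> = (\<lambda>c k. if k \<in> carrier K then c (f k) else \<zero>\<^bsub>R\<^esub>)"
  have \<rho>: "\<rho> \<in> mod_hom R ?AL ?AK"
    unfolding \<rho>_def by (rule restrict_coords_hom[OF R inj]) (use fD(1) in blast)
  have \<rho>_b: "\<rho> (basis_elt R (f k)) = basis_elt R k" if "k \<in> carrier K" for k
    using that inj_on_eq_iff[OF inj] by (auto simp: \<rho>_def basis_elt_def fun_eq_iff)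
  have \<rho>F: "\<rho> (F c) = c" if "c \<in> carrier ?AK" for c
    by (rule free_hom_ext[OF R AK mod_hom_comp[OF F \<rho>] _ _ that])
       (simp_all add: F_b \<rho>_b mod_hom_def)
  have F\<rho>: "F (\<rho> c) = c" if c: "c \<in> carrier (free_mod R (f ` carrier K))" for c
  proof -
    have sub: "f ` carrier K \<subseteq> carrier L" using fD(1) by blast
    note i = free_mod_incl_hom[OF sub, of R]
    show ?thesis
      by (rule free_hom_ext[OF R AL mod_hom_comp[OF i mod_hom_comp[OF \<rho> F]] i _ c])
         (auto simp: F_b \<rho>_b)
  qed
  from t obtain x where x: "x \<in> carrier (tensor R ?AK M)" "t = tensor_map R K M ?pK id x"
    unfolding tensor_map_surj[OF AK K M pK surjK, symmetric] by (elim imageE)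
  let ?y = "tensor_map R ?AL M F id x"
  have y: "?y \<in> carrier (tensor R ?AL M)" by (rule mod_homD(1)[OF tensor_map_hom[OF AK M AL M F mod_hom_id] x(1)])
  have "tensor_map R L M ?pL id ?y = tensor_map R L M (\<lambda>c. ?pL (F c)) id x"
    by (rule tensor_map_comp[OF AK M AL L F pL x(1)])
  also have "\<dots> = tensor_map R L M (\<lambda>c. f (?pK c)) id x"
    by (rule tensor_map_cong[OF AK M L mod_hom_comp[OF F pL] mod_hom_comp[OF pK f] pF x(1)])
  also have "\<dots> = \<zero>\<^bsub>tensor R L M\<^esub>"
    unfolding tensor_map_comp[OF AK M K L pK f x(1), symmetric] x(2)[symmetric] by (rule ft)
  finally have "?y \<in> tensor_part R ?AL M {c \<in> carrier ?AL. ?pL c = \<zero>\<^bsub>L\<^esub>}"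
    by (rule tensor_right_exact[OF AL L M pL surjL y])
  from tensor_part_finite_source[OF R AL M _ this]
  obtain C z where C: "finite C" "C \<subseteq> {c \<in> carrier ?AL. ?pL c = \<zero>\<^bsub>L\<^esub>}"
    and z: "z \<in> carrier (tensor R (free_mod R C) M)"
    and zy: "tensor_map R ?AL M (lin_ext R ?AL (\<lambda>c. c)) id z = ?y" by blast
  define \<theta> where "\<theta> = lin_ext R ?AL (\<lambda>c. c)"
  note zy = zy[folded \<theta>_def]
  let ?E = "free_mod R C"
  have E: "module R ?E" by (rule free_mod_module[OF R])
  have Cc: "c \<in> carrier ?AL" "?pL c = \<zero>\<^bsub>L\<^esub>" if "c \<in> C" for c using C(2) that by auto
  have \<theta>: "\<theta> \<in> mod_hom R ?E ?AL" unfolding \<theta>_def by (rule lin_ext_hom[OF R AL]) (use Cc in blast)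
  have \<theta>_b: "\<theta> (basis_elt R c) = c" if "c \<in> C" for c
    unfolding \<theta>_def by (rule lin_ext_basis_elt[OF R AL]) (rule Cc(1)[OF that])
  have \<theta>_in: "\<theta> d \<in> H" if H: "submodule H R ?AL" "C \<subseteq> H" and d: "d \<in> carrier ?E" for H d
  proof -
    have "d \<in> {d \<in> carrier ?E. \<theta> d \<in> H}"
      by (rule free_induct[OF R vimage_submodule[OF E AL \<theta> H(1)] _ d])
         (use H(2) \<theta>_b basis_elt_closed[OF R] in auto)
    thus ?thesis by simp
  qed
  \<comment> \<open>the finitely many coordinates outside the image of \<open>f\<close> that occur in the relations \<open>C\<close>\<close>
  define U where "U = (\<Union>c\<in>C. {l. c l \<noteq> \<zero>\<^bsub>R\<^esub>})"
  define G where "G = U - f ` carrier K"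
  have UL: "U \<subseteq> carrier L" unfolding U_def using free_modD(3)[OF Cc(1)] by blast
  have Gfin: "finite G" unfolding G_def U_def using C(1) free_modD(2)[OF Cc(1)] by blast
  have GL: "G \<subseteq> carrier L" using UL unfolding G_def by blast
  define q where "q = (\<lambda>(c :: 'l \<Rightarrow> 'a) l. if l \<in> G then c ((\<lambda>l. l) l) else \<zero>\<^bsub>R\<^esub>)"
  have q: "q \<in> mod_hom R ?AL (free_mod R G)"
    unfolding q_def by (rule restrict_coords_hom[OF R]) (use GL in auto)
  have FG: "module R (free_mod R G)" by (rule free_mod_module[OF R])
  interpret FG: module R "free_mod R G" by (rule FG)
  have qF: "q (F c) = \<zero>\<^bsub>free_mod R G\<^esub>" if "c \<in> carrier ?AK" for c
  proof (rule free_hom_ext[OF R FG mod_hom_comp[OF F q] _ _ that])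
    show "(\<lambda>_. \<zero>\<^bsub>free_mod R G\<^esub>) \<in> mod_hom R ?AK (free_mod R G)"
      by (rule mod_homI) simp_all
  next
    fix k assume k: "k \<in> carrier K"
    show "q (F (basis_elt R k)) = \<zero>\<^bsub>free_mod R G\<^esub>"
      unfolding F_b[OF k] using k by (auto simp: q_def basis_elt_def free_mod_simps G_def fun_eq_iff)
  qed
  have "tensor_map R (free_mod R G) M (\<lambda>d. q (\<theta> d)) id z = tensor_map R (free_mod R G) M q id ?y"
    unfolding zy[symmetric] by (rule tensor_map_comp[OF E M AL FG \<theta> q z, symmetric])
  also have "\<dots> = tensor_map R (free_mod R G) M (\<lambda>c. q (F c)) id x"
    by (rule tensor_map_comp[OF AK M AL FG F q x(1)])
  also have "\<dots> = \<zero>\<^bsub>tensor R (free_mod R G) M\<^esub>"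
  proof (rule tensor_part_kernel_subset[OF AK FG M mod_hom_comp[OF F q]])
    have "{c \<in> carrier ?AK. q (F c) = \<zero>\<^bsub>free_mod R G\<^esub>} = carrier ?AK" using qF by blast
    thus "x \<in> tensor_part R ?AK M {c \<in> carrier ?AK. q (F c) = \<zero>\<^bsub>free_mod R G\<^esub>}"
      using x(1) tensor_part_carrier[OF AK M] by simp
  qed
  finally have zK: "z \<in> tensor_part R ?E M {d \<in> carrier ?E. q (\<theta> d) = \<zero>\<^bsub>free_mod R G\<^esub>}"
    by (rule tensor_kernel_free[OF R No I flat compl C(1) Gfin mod_hom_comp[OF \<theta> q] z])
  have "x = tensor_map R ?AK M (\<lambda>c. \<rho> (F c)) id x"
    by (rule tensor_map_ident[OF AK M mod_hom_comp[OF F \<rho>] \<rho>F x(1), symmetric])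
  also have "\<dots> = tensor_map R ?AK M \<rho> id ?y" by (rule tensor_map_comp[OF AK M AL AK F \<rho> x(1), symmetric])
  also have "\<dots> = tensor_map R ?AK M (\<lambda>d. \<rho> (\<theta> d)) id z"
    unfolding zy[symmetric] by (rule tensor_map_comp[OF E M AL AK \<theta> \<rho> z])
  also have "\<dots> \<in> tensor_part R ?AK M {c \<in> carrier ?AK. ?pK c = \<zero>\<^bsub>K\<^esub>}"
  proof (rule tensor_part_image[OF E M AK mod_hom_comp[OF \<theta> \<rho>] _ _ _ zK])
    show "(\<lambda>d. \<rho> (\<theta> d)) ` {d \<in> carrier ?E. q (\<theta> d) = \<zero>\<^bsub>free_mod R G\<^esub>} \<subseteq> {c \<in> carrier ?AK. ?pK c = \<zero>\<^bsub>K\<^esub>}"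
    proof (rule image_subsetI)
      fix d assume "d \<in> {d \<in> carrier ?E. q (\<theta> d) = \<zero>\<^bsub>free_mod R G\<^esub>}"
      hence d: "d \<in> carrier ?E" "q (\<theta> d) = \<zero>\<^bsub>free_mod R G\<^esub>" by simp_all
      have td: "\<theta> d \<in> carrier ?AL" by (rule mod_homD(1)[OF \<theta> d(1)])
      have "\<theta> d \<in> {c \<in> carrier ?AL. ?pL c \<in> {\<zero>\<^bsub>L\<^esub>}}"
        by (rule \<theta>_in[OF vimage_submodule[OF AL L pL zero_submodule[OF L]] _ d(1)]) (use C(2) in blast)
      hence pt: "?pL (\<theta> d) = \<zero>\<^bsub>L\<^esub>" by simp
      have "submodule (carrier (free_mod R U)) R ?AL"
        using image_submodule[OF free_mod_module[OF R] AL free_mod_incl_hom[OF UL]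
            module.carrier_is_submodule[OF free_mod_module[OF R]]] by simp
      moreover have "C \<subseteq> carrier (free_mod R U)"
      proof
        fix c assume c: "c \<in> C"
        show "c \<in> carrier (free_mod R U)"
          by (rule free_modI[OF free_modD(2)[OF Cc(1)[OF c]]])
             (use c free_modD(1)[OF Cc(1)[OF c]] R in \<open>auto simp: U_def\<close>)
      qed
      ultimately have tU: "\<theta> d \<in> carrier (free_mod R U)" by (rule \<theta>_in[OF _ _ d(1)])
      have "\<theta> d l = \<zero>\<^bsub>R\<^esub>" if "l \<notin> f ` carrier K" for l
      proof (cases "l \<in> U")
        case True
        hence "l \<in> G" using that by (simp add: G_def)
        thus ?thesis using fun_cong[OF d(2), of l] by (simp add: q_def free_mod_simps)
      qed (rule free_modD(3)[OF tU])
      hence "\<theta> d \<in> carrier (free_mod R (f ` carrier K))"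
        by (intro free_modI[OF free_modD(2)[OF td] _ free_modD(1)[OF td] _ R]) auto
      from F\<rho>[OF this] have "F (\<rho> (\<theta> d)) = \<theta> d" .
      note rt = mod_homD(1)[OF \<rho> td]
      have "f (?pK (\<rho> (\<theta> d))) = \<zero>\<^bsub>L\<^esub>" using pF[OF rt] \<open>F (\<rho> (\<theta> d)) = \<theta> d\<close> pt by simp
      also have "\<dots> = f \<zero>\<^bsub>K\<^esub>" by (rule mod_hom_zero[OF K L f, symmetric])
      finally have "?pK (\<rho> (\<theta> d)) = \<zero>\<^bsub>K\<^esub>"
        using inj_onD[OF inj] mod_homD(1)[OF pK rt] K.M.zero_closed by blast
      thus "\<rho> (\<theta> d) \<in> {c \<in> carrier ?AK. ?pK c = \<zero>\<^bsub>K\<^esub>}" using rt by simp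
    qed
  qed blast+
  finally show ?thesis unfolding x(2) by (rule tensor_part_kernel_subset[OF AK K M pK])
qed

theorem theorem0p5:
  fixes R :: "('a, 'r) ring_scheme" and I :: "'a set" and M :: "('a, 'm, 'x) module_scheme"
  assumes "cring R" and "noetherian_ring R" and "ideal I R"
    and "module R M"
    and "adically_flat TYPE('a list set) R I M"
    and "adically_complete R I M"
  shows "flat_module TYPE('k) TYPE('l) R M"
  unfolding flat_module_def
proof (intro conjI allI impI)
  show "module R M" by fact
next
  fix K :: "('a, 'k) module" and L :: "('a, 'l) module" and f
  assume "module R K \<and> module R L \<and> f \<in> mod_hom R K L \<and> inj_on f (carrier K)"
  hence K: "module R K" and L: "module R L" and f: "f \<in> mod_hom R K L" and inj: "inj_on f (carrier K)"
    by simp_all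
  note TK = tensor_module[OF K assms(4)] and TL = tensor_module[OF L assms(4)]
  note fM = tensor_map_hom[OF K assms(4) L assms(4) f mod_hom_id]
  interpret TK: module R "tensor R K M" by (rule TK)
  show "inj_on (tensor_map R L M f id) (carrier (tensor R K M))"
  proof (rule inj_onI)
    fix s t assume s: "s \<in> carrier (tensor R K M)" and t: "t \<in> carrier (tensor R K M)"
      and eq: "tensor_map R L M f id s = tensor_map R L M f id t"
    have "tensor_map R L M f id (s \<ominus>\<^bsub>tensor R K M\<^esub> t) = \<zero>\<^bsub>tensor R L M\<^esub>"
      unfolding mod_hom_minus[OF TK TL fM s t] minus_add_cancel(3)[OF TL mod_homD(1)[OF fM s] mod_homD(1)[OF fM t]]
      by (rule eq)
    hence "s \<ominus>\<^bsub>tensor R K M\<^esub> t = \<zero>\<^bsub>tensor R K M\<^esub>"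
      by (rule tensor_map_injective_kernel_trivial[OF assms(1-3,5,6) K L f inj TK.M.minus_closed[OF s t]])
    thus "s = t" unfolding minus_add_cancel(3)[OF TK s t] .
  qed
qed

end
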